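(* Let $\theta=(\theta_0,\ldots,\theta_I)\in\Theta_{\rm finite}$ have length $I$. There exists a sequence $\mathbf p=\mathbf p_n=(p_{n1},\ldots,p_{nn})$ of ranked probability distributions ($p_{n1}\ge\cdots\ge p_{nn}>0$) satisfying, with $\sigma(\mathbf p_n)=\sqrt{\sum_ip_{ni}^2}$, $$\lim_n\sigma(\mathbf p_n)=0;\qquad \lim_n\frac{p_{ni}}{\sigma(\mathbf p_n)}=\theta_i,\ 1\le i\le I;\qquad \lim_n\frac{p_{ni}}{\sigma(\mathbf p_n)}=0,\ i>I,$$ and such that, as $n\to\infty$, $$\sup_{u\in[0,1]}\left|\frac{\theta_0^2}{2}\,\sigma(\mathbf p_n)H^{\mathbf p_n}(u)-\sigma(\mathbf p_n)^{-1}G^{\mathbf p_n}_I(u)\right|\ \longrightarrow\ 0\quad\text{in probability.}$$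
   Context: $\Theta_{\rm finite}$ is the set of $\theta=(\theta_0,\theta_1,\ldots)$ with $\theta_0>0$, $\theta_1\ge\theta_2\ge\cdots\ge0$, $\sum_{i\ge0}\theta_i^2=1$ and only finitely many nonzero entries; the length $I\ge 0$ is the smallest integer with $\theta_i=0$ for all $i>I$. Depth-first construction of the $\mathbf p$-tree. Given $\mathbf p=(p_1,\ldots,p_n)$, let $x_1,\ldots,x_n$ be independent uniform on $[0,1)$ and $F^{\mathbf p}(u)=-u+\sum_ip_i\mathbf 1_{\{x_i\le u\}}$. Almost surely there is a unique $w_1\in[n]$ with $F^{\mathbf p}(x_{w_1}-)=\inf_uF^{\mathbf p}(u)$. Put $x'_i=x_i-x_{w_1}\bmod 1\in[0,1)$ and $$F^{{\rm exc},\mathbf p}(u)=-u+\sum_ip_i\mathbf 1_{\{x'_i\le u\}},\quad 0\le u\le1.$$ The vertex $w_1$ is the root. Set $e_0=0$ and, recursively for $j\ge1$, $e_j=e_{j-1}+p_{w_j}$; the children of $w_j$ are the vertices $v$ with $x'_v\in(e_{j-1},e_j)$, ordered by increasing $x'_v$; and $w_{j+1}$ is the first child of $w_j$ if any, else the next not yet examined child of the parent of $w_j$ if any, else the next not yet examined child of the grandparent of $w_j$, and so on ("not yet examined" means not among $w_1,\ldots,w_j$). Almost surely this gives a rooted tree on $[n]$, with depth-first order $w_1,\ldots,w_n$. Write $e(w_j)=e_j$. The exploration process is $H^{\mathbf p}(u)=$ height (graph distance to the root) of $w_j$, for $u\in(e_{j-1},e_j]$, $1\le j\le n$, and $H^{\mathbf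 p}(0)=0$. The process $G^{\mathbf p}_I$. For $1\le i\le I$ let $\mathcal B_i$ be the set of children of vertex $i$. For $v\in\mathcal B_i$ let $\rho_v(u)=0$ for $0\le u<x'_i$; $\rho_v(u)=p_v$ for $x'_i\le u\le e(v)-p_v$; $\rho_v(u)=e(v)-u$ for $e(v)-p_v\le u\le e(v)$; $\rho_v(u)=0$ for $e(v)\le u\le1$. Then $r_i^{\mathbf p}=\sum_{v\in\mathcal B_i}\rho_v$ and $G^{\mathbf p}_I=F^{{\rm exc},\mathbf p}-\sum_{i=1}^Ir^{\mathbf p}_i$. *)

theory Defs
  imports "HOL-Probability.Probability"
begin

section \<open>Parameters\<close>

definition Theta_finite :: "(nat \<Rightarrow> real) set" where
  "Theta_finite = {\<theta>. \<theta> 0 > 0 \<and> (\<forall>i\<ge>1. \<theta> (Suc i) \<le> \<theta> i \<and> 0 \<le> \<theta> i)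
      \<and> (\<lambda>i. (\<theta> i)\<^sup>2) sums 1 \<and> finite {i. \<theta> i \<noteq> 0}}"

definition theta_length :: "(nat \<Rightarrow> real) \<Rightarrow> nat" where
  "theta_length \<theta> = (LEAST I. \<forall>i>I. \<theta> i = 0)"

text \<open>A vector \<open>(p\<^sub>1, \<dots>, p\<^sub>n)\<close> is a function on \<^typ>\<open>nat\<close> of which only the
  values at \<open>1, \<dots>, n\<close> are used.\<close>

definition ranked_distribution :: "nat \<Rightarrow> (nat \<Rightarrow> real) \<Rightarrow> bool" where
  "ranked_distribution n p \<longleftrightarrow>
     (\<forall>i\<in>{1..n}. 0 < p i) \<and> antimono_on {1..n} p \<and> (\<Sum>i=1..n. p i) = 1"

definition sigma_p :: "nat \<Rightarrow> (nat \<Rightarrow> real) \<Rightarrow> real" where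
  "sigma_p n p = sqrt (\<Sum>i=1..n. (p i)\<^sup>2)"


section \<open>Depth-first construction of the tree\<close>

text \<open>Everything below is a total function of \<open>n\<close>, \<open>p\<close> and the marks \<open>x\<^sub>1, \<dots>, x\<^sub>n\<close>. On the
  null set where the construction breaks down (ties between the marks, or a shifted mark equal
  to some \<open>e\<^sub>j\<close>) the values are arbitrary.

  The bridge \<open>F\<close> is defined on all of \<open>\<real>\<close>, so that its left limit at a mark equal to 0 makes
  sense; the infimum is over \<open>[0,1]\<close>.\<close>

definition bridge :: "nat \<Rightarrow> (nat \<Rightarrow> real) \<Rightarrow> (nat \<Rightarrow> real) \<Rightarrow> real \<Rightarrow> real" where
  "bridge n p x u = - u + (\<Sum>i=1..n. p i * of_bool (x i \<le> u))"

definition root_vertex :: "nat \<Rightarrow> (nat \<Rightarrow> real) \<Rightarrow> (nat \<Rightarrow> real) \<Rightarrow> nat" where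
  "root_vertex n p x =
     (THE v. v \<in> {1..n} \<and> Lim (at_left (x v)) (bridge n p x) = (INF u\<in>{0..1}. bridge n p x u))"

definition shifted :: "nat \<Rightarrow> (nat \<Rightarrow> real) \<Rightarrow> (nat \<Rightarrow> real) \<Rightarrow> nat \<Rightarrow> real" where
  "shifted n p x i = frac (x i - x (root_vertex n p x))"

definition F_exc :: "nat \<Rightarrow> (nat \<Rightarrow> real) \<Rightarrow> (nat \<Rightarrow> real) \<Rightarrow> real \<Rightarrow> real" where
  "F_exc n p x = bridge n p (shifted n p x)"

text \<open>A list \<open>ws = [w\<^sub>1, \<dots>, w\<^sub>j]\<close> records the vertices examined so far (so \<open>w\<^sub>k\<close> is
  \<open>ws ! (k - 1)\<close>), and \<open>e_list p ws k\<close> is \<open>e\<^sub>k\<close>. The argument \<open>y\<close> stands for the shifted marks.\<close>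

definition e_list :: "(nat \<Rightarrow> real) \<Rightarrow> nat list \<Rightarrow> nat \<Rightarrow> real" where
  "e_list p ws k = (\<Sum>w\<leftarrow>take k ws. p w)"

text \<open>Pairs (parent, child) with an examined parent.\<close>

definition child_rel ::
  "nat \<Rightarrow> (nat \<Rightarrow> real) \<Rightarrow> (nat \<Rightarrow> real) \<Rightarrow> nat list \<Rightarrow> (nat \<times> nat) set" where
  "child_rel n p y ws =
     {(ws ! k, v) |k v. k < length ws \<and> v \<in> {1..n} \<and> y v \<in> {e_list p ws k<..<e_list p ws (Suc k)}}"

text \<open>The not yet examined children of the \<open>m\<close>-th ancestor of the vertex examined last; the
  case \<open>m = 0\<close> is that vertex itself.\<close>

definition pending ::
  "nat \<Rightarrow> (nat \<Rightarrow> real) \<Rightarrow> (nat \<Rightarrow> real) \<Rightarrow> nat list \<Rightarrow> nat \<Rightarrow> nat set" where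
  "pending n p y ws m =
     {v. \<exists>a. (a, last ws) \<in> child_rel n p y ws ^^ m \<and> (a, v) \<in> child_rel n p y ws} - set ws"

definition next_vertex ::
  "nat \<Rightarrow> (nat \<Rightarrow> real) \<Rightarrow> (nat \<Rightarrow> real) \<Rightarrow> nat list \<Rightarrow> nat" where
  "next_vertex n p y ws = arg_min_on y (pending n p y ws (LEAST m. pending n p y ws m \<noteq> {}))"

primrec explore ::
  "nat \<Rightarrow> (nat \<Rightarrow> real) \<Rightarrow> (nat \<Rightarrow> real) \<Rightarrow> nat \<Rightarrow> nat \<Rightarrow> nat list" where
  "explore n p y r 0 = []"
| "explore n p y r (Suc j) =
     (if j = 0 then [r] else explore n p y r j @ [next_vertex n p y (explore n p y r j)])"

definition dfs_order :: "nat \<Rightarrow> (nat \<Rightarrow> real) \<Rightarrow> (nat \<Rightarrow> real) \<Rightarrow> nat list" where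
  "dfs_order n p x = explore n p (shifted n p x) (root_vertex n p x) n"

definition tree :: "nat \<Rightarrow> (nat \<Rightarrow> real) \<Rightarrow> (nat \<Rightarrow> real) \<Rightarrow> (nat \<times> nat) set" where
  "tree n p x = child_rel n p (shifted n p x) (dfs_order n p x)"

definition e_index :: "nat \<Rightarrow> (nat \<Rightarrow> real) \<Rightarrow> (nat \<Rightarrow> real) \<Rightarrow> nat \<Rightarrow> real" where
  "e_index n p x j = e_list p (dfs_order n p x) j"

definition e_vertex :: "nat \<Rightarrow> (nat \<Rightarrow> real) \<Rightarrow> (nat \<Rightarrow> real) \<Rightarrow> nat \<Rightarrow> real" where
  "e_vertex n p x v = e_index n p x (THE j. j \<in> {1..n} \<and> dfs_order n p x ! (j - 1) = v)"

text \<open>Graph distance to the root in the undirected tree.\<close>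

definition height :: "nat \<Rightarrow> (nat \<Rightarrow> real) \<Rightarrow> (nat \<Rightarrow> real) \<Rightarrow> nat \<Rightarrow> nat" where
  "height n p x v =
     (LEAST m. (root_vertex n p x, v) \<in> (tree n p x \<union> (tree n p x)\<inverse>) ^^ m)"


section \<open>The two processes\<close>

text \<open>The intervals \<open>(e\<^bsub>j-1\<^esub>, e\<^sub>j]\<close> are disjoint and do not contain 0, so the sum has at most one
  nonzero term and vanishes at \<open>u = 0\<close>.\<close>

definition H_proc :: "nat \<Rightarrow> (nat \<Rightarrow> real) \<Rightarrow> (nat \<Rightarrow> real) \<Rightarrow> real \<Rightarrow> real" where
  "H_proc n p x u =
     (\<Sum>j=1..n. of_bool (u \<in> {e_index n p x (j - 1)<..e_index n p x j})
               * real (height n p x (dfs_order n p x ! (j - 1))))"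

definition children :: "nat \<Rightarrow> (nat \<Rightarrow> real) \<Rightarrow> (nat \<Rightarrow> real) \<Rightarrow> nat \<Rightarrow> nat set" where
  "children n p x i = {v. (i, v) \<in> tree n p x}"

definition rho ::
  "nat \<Rightarrow> (nat \<Rightarrow> real) \<Rightarrow> (nat \<Rightarrow> real) \<Rightarrow> nat \<Rightarrow> nat \<Rightarrow> real \<Rightarrow> real" where
  "rho n p x i v u =
     (if u < shifted n p x i then 0
      else if u \<le> e_vertex n p x v - p v then p v
      else if u \<le> e_vertex n p x v then e_vertex n p x v - u
      else 0)"

definition r_proc :: "nat \<Rightarrow> (nat \<Rightarrow> real) \<Rightarrow> (nat \<Rightarrow> real) \<Rightarrow> nat \<Rightarrow> real \<Rightarrow> real" where
  "r_proc n p x i u = (\<Sum>v\<in>children n p x i. rho n p x i v u)"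

definition G_proc ::
  "nat \<Rightarrow> nat \<Rightarrow> (nat \<Rightarrow> real) \<Rightarrow> (nat \<Rightarrow> real) \<Rightarrow> real \<Rightarrow> real" where
  "G_proc I n p x u = F_exc n p x u - (\<Sum>i=1..I. r_proc n p x i u)"


section \<open>Randomness\<close>

definition uniform_marks :: "nat \<Rightarrow> (nat \<Rightarrow> real) measure" where
  "uniform_marks n = (\<Pi>\<^sub>M i\<in>{1..n}. uniform_measure lborel {0..<1})"

text \<open>Convergence to 0 in probability of functions \<open>X n\<close> on probability spaces \<open>M n\<close>. The outer
  measure agrees with the measure on events, and keeps the definition from becoming vacuous when
  \<open>X n\<close> is not measurable (\<^const>\<open>emeasure\<close> is 0 outside \<^const>\<open>sets\<close>).\<close>

definition conv_in_prob_0 :: "(nat \<Rightarrow> 'a measure) \<Rightarrow> (nat \<Rightarrow> 'a \<Rightarrow> real) \<Rightarrow> bool" where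
  "conv_in_prob_0 M X \<longleftrightarrow>
     (\<forall>\<epsilon>>0. (\<lambda>n. outer_measure_of (M n) {\<omega> \<in> space (M n). \<epsilon> < \<bar>X n \<omega>\<bar>}) \<longlonglongrightarrow> 0)"

lemma conv_in_prob_0_iff_prob:
  assumes "\<And>n. prob_space (M n)" and [measurable]: "\<And>n. X n \<in> borel_measurable (M n)"
  shows "conv_in_prob_0 M X \<longleftrightarrow>
    (\<forall>\<epsilon>>0. (\<lambda>n. measure (M n) {\<omega> \<in> space (M n). \<epsilon> < \<bar>X n \<omega>\<bar>}) \<longlonglongrightarrow> 0)"
proof -
  have "outer_measure_of (M n) {\<omega> \<in> space (M n). \<epsilon> < \<bar>X n \<omega>\<bar>} =
      ennreal (measure (M n) {\<omega> \<in> space (M n). \<epsilon> < \<bar>X n \<omega>\<bar>})" for n \<epsilon>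
  proof -
    interpret prob_space "M n" by fact
    show ?thesis by (simp add: emeasure_eq_measure)
  qed
  then show ?thesis
    by (simp add: conv_in_prob_0_def ennreal_tendsto_0_iff)
qed

text \<open>The difference of the rescaled processes is bounded in \<open>u\<close> for every choice of marks, so
  that its real-valued supremum over \<open>[0,1]\<close> is a genuine one.\<close>

lemma finite_children: "finite (children n p x i)"
  by (rule finite_subset[of _ "{1..n}"]) (auto simp: children_def tree_def child_rel_def)

lemma bdd_above_difference:
  "bdd_above ((\<lambda>u. \<bar>a * H_proc n p x u - b * G_proc I n p x u\<bar>) ` {0..1})"
proof -
  define K where "K = (\<Sum>j=1..n. real (height n p x (dfs_order n p x ! (j - 1))))"
  define R where "R = (\<lambda>i. \<Sum>v\<in>children n p x i. \<bar>p v\<bar> + \<bar>e_vertex n p x v\<bar> + 1)"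
  define L where "L = 1 + (\<Sum>i=1..n. \<bar>p i\<bar>) + (\<Sum>i=1..I. R i)"
  have "\<bar>a * H_proc n p x u - b * G_proc I n p x u\<bar> \<le> \<bar>a\<bar> * K + \<bar>b\<bar> * L"
    if u: "u \<in> {0..1}" for u
  proof -
    have "\<bar>H_proc n p x u\<bar> \<le> K"
      unfolding H_proc_def K_def by (rule order.trans[OF sum_abs], rule sum_mono) auto
    moreover have "\<bar>F_exc n p x u\<bar> \<le> 1 + (\<Sum>i=1..n. \<bar>p i\<bar>)"
    proof -
      have "\<bar>\<Sum>i=1..n. p i * of_bool (shifted n p x i \<le> u)\<bar> \<le> (\<Sum>i=1..n. \<bar>p i\<bar>)"
        by (rule order.trans[OF sum_abs], rule sum_mono) auto
      then show ?thesis using u by (auto simp: F_exc_def bridge_def abs_le_iff)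
    qed
    moreover have "\<bar>r_proc n p x i u\<bar> \<le> R i" for i
      unfolding r_proc_def R_def
      by (rule order.trans[OF sum_abs], rule sum_mono) (use u in \<open>auto simp: rho_def\<close>)
    then have "\<bar>\<Sum>i=1..I. r_proc n p x i u\<bar> \<le> (\<Sum>i=1..I. R i)"
      by (intro order.trans[OF sum_abs] sum_mono)
    ultimately have "\<bar>H_proc n p x u\<bar> \<le> K" "\<bar>G_proc I n p x u\<bar> \<le> L"
      by (auto simp: G_proc_def L_def)
    then have "\<bar>a * H_proc n p x u\<bar> \<le> \<bar>a\<bar> * K" "\<bar>b * G_proc I n p x u\<bar> \<le> \<bar>b\<bar> * L"
      by (auto simp: abs_mult intro: mult_left_mono)
    then show ?thesis by linarith
  qed
  then show ?thesis by (intro bdd_aboveI2) blast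
qed

end

theory Submission
  imports Defs "HOL-Real_Asymp.Real_Asymp"
begin

text \<open>The witness gives vertex \<open>i \<le> I\<close> (a hub) the weight \<open>\<theta>\<^sub>i / (\<theta>\<^sub>0 \<surd>n)\<close> and all others a common
  weight \<open>s\<close> of order \<open>1 / n\<close>. While the vertex \<open>w\<close> is examined, the excursion exceeds 0 by the
  weight of the vertices waiting to the right of the path from \<open>w\<close> to the root. The processes
  \<open>r\<^sub>i\<close> take away the children of hubs, up to errors controlled by the equidistribution of the
  marks of these children, so \<open>G(u)\<close> is close to \<open>s\<close> times the number of right siblings
  hanging off the non-hub ancestors of \<open>w\<close>. Such an ancestor contributes a half on average, whence
  \<open>G \<approx> s H / 2\<close>; and \<open>\<theta>\<^sub>0\<^sup>2 \<sigma>\<^sup>2\<close> is \<open>s\<close> up to a factor tending to 1.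

  For the probabilities, translate the interval of marks in which the children of \<open>w\<close> lie to a place
  depending on \<open>w\<close> alone. For a given root and a given depth-first order this is a piecewise
  translation of the circle, which preserves the law of the other marks; hence the marks seen in the
  new coordinates are dominated by independent uniform ones, at the cost of a sum over all roots.
  There a vertex chooses its parent \<open>w\<close> with probability \<open>p\<^sub>w\<close>, independently of the others, a
  given path to the root is present with probability \<open>\<Prod> p\<^sub>a\<close> over its ancestors, and Chernoff
  bounds summed over all paths control the deviation of the number of right siblings from half the
  height.\<close>

subsection \<open>Depth-first exploration\<close>

text \<open>The obstacle is that the interval belonging to a vertex depends, through the depth-first
  order, on all marks. With root and order fixed in advance, the change of coordinates acts mark by
  mark. Since the order can be recovered from the new coordinates, the events for different orders
  are disjoint and summing over them is free; the probabilities for different roots are simply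
  added, which costs a factor of up to \<open>n\<close>. Chernoff bounds absorb that factor.

  The union over paths is affordable because each path comes with its probability: for every height
  the products over the ancestors sum to at most \<open>n\<close>, the lowest vertex being the only
  free choice.

  The half arises because a path vertex sits uniformly in the slot of its parent, while a slot of
  length \<open>s\<close> receives about one small vertex in all.

  The weights make \<sigma> of order 1 / (\<theta>_0 sqrt n): in n \<sigma>^2 the hubs account for
  (1 - \<theta>_0^2) / \<theta>_0^2 and the small vertices for 1 in the limit. Hence \<theta>_0^2
  \<sigma>^2 and \<open>s\<close> are both 1 / n to first order.\<close>

lemma e_list_0 [simp]: "e_list p ws 0 = 0"
  by (simp add: e_list_def)

lemma e_list_Suc: "k < length ws \<Longrightarrow> e_list p ws (Suc k) = e_list p ws k + p (ws ! k)"
  by (simp add: e_list_def take_Suc_conv_app_nth)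

lemma e_list_append: "k \<le> length ws \<Longrightarrow> e_list p (ws @ us) k = e_list p ws k"
  by (simp add: e_list_def)

lemma e_list_take: "k \<le> j \<Longrightarrow> e_list p (take j ws) k = e_list p ws k"
  by (simp add: e_list_def min_def)

lemma e_list_snoc: "e_list p (ws @ [w]) (Suc (length ws)) = e_list p ws (length ws) + p w"
  by (simp add: e_list_def)

lemma e_list_eq_sum: "distinct ws \<Longrightarrow> e_list p ws k = sum p (set (take k ws))"
  by (simp add: e_list_def sum_list_distinct_conv_sum_set)

lemma e_list_length: "distinct ws \<Longrightarrow> e_list p ws (length ws) = sum p (set ws)"
  by (simp add: e_list_eq_sum)

text \<open>\<open>generic\<close> keeps the marks off all endpoints e_j whatever the order of
  exploration, because every e_j is the weight of a set of vertices. \<open>excursion\<close> says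
  that the excursion is still positive just before each mark other than that of the root; this is
  what keeps the exploration from stopping early.\<close>

locale marks =
  fixes n :: nat and p y :: "nat \<Rightarrow> real" and r :: nat
  assumes p_pos: "\<And>i. i \<in> {1..n} \<Longrightarrow> 0 < p i"
    and p_sum: "(\<Sum>i=1..n. p i) = 1"
    and r_in: "r \<in> {1..n}" and y_r: "y r = 0"
    and y_nonneg: "\<And>v. v \<in> {1..n} \<Longrightarrow> 0 \<le> y v" and y_less: "\<And>v. v \<in> {1..n} \<Longrightarrow> y v < 1"
    and y_inj: "inj_on y {1..n}"
    and generic: "\<And>v S. \<lbrakk>v \<in> {1..n}; v \<noteq> r; S \<subseteq> {1..n}\<rbrakk> \<Longrightarrow> y v \<noteq> sum p S"
    and excursion: "\<And>v. \<lbrakk>v \<in> {1..n}; v \<noteq> r\<rbrakk> \<Longrightarrow> y v < (\<Sum>i | i \<in> {1..n} \<and> y i < y v. p i)"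
begin

abbreviation C :: "nat list \<Rightarrow> (nat \<times> nat) set" where "C ws \<equiv> child_rel n p y ws"
abbreviation e :: "nat list \<Rightarrow> nat \<Rightarrow> real" where "e ws k \<equiv> e_list p ws k"

lemma e_mono:
  assumes "set ws \<subseteq> {1..n}" "k \<le> k'" "k' \<le> length ws"
  shows "e ws k \<le> e ws k'"
  using assms(2,3)
proof (induction k' rule: dec_induct)
  case (step m)
  then have "ws ! m \<in> {1..n}" using assms(1) nth_mem[of m ws] by (blast intro: Suc_le_lessD le_trans)
  then have "0 < p (ws ! m)" by (rule p_pos)
  then show ?case using step by (simp add: e_list_Suc)
qed simp

lemma e_nonneg: "set ws \<subseteq> {1..n} \<Longrightarrow> k \<le> length ws \<Longrightarrow> 0 \<le> e ws k"
  using e_mono[of ws 0 k] by simp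

lemma child_relE:
  assumes "(a, v) \<in> C ws"
  obtains k where "k < length ws" "a = ws ! k" "v \<in> {1..n}" "e ws k < y v" "y v < e ws (Suc k)"
  using assms by (auto simp: child_rel_def)

lemma child_relI:
  "\<lbrakk>k < length ws; v \<in> {1..n}; e ws k < y v; y v < e ws (Suc k)\<rbrakk> \<Longrightarrow> (ws ! k, v) \<in> C ws"
  by (auto simp: child_rel_def)

lemma C_snoc:
  "C (ws @ [w]) = C ws \<union> {(w, v) |v. v \<in> {1..n} \<and> e ws (length ws) < y v \<and> y v < e ws (length ws) + p w}"
  (is "?L = ?R")
proof (intro equalityI subrelI)
  fix a v assume "(a, v) \<in> ?L"
  then obtain k where k: "k < Suc (length ws)" "a = (ws @ [w]) ! k" "v \<in> {1..n}"
      "e (ws @ [w]) k < y v" "y v < e (ws @ [w]) (Suc k)"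
    by (auto elim: child_relE)
  show "(a, v) \<in> ?R"
  proof (cases "k < length ws")
    case True
    then show ?thesis using k child_relI[of k ws v] by (simp add: e_list_append nth_append)
  next
    case False
    then have "k = length ws" using k(1) by simp
    then show ?thesis using k by (simp add: e_list_append e_list_snoc)
  qed
next
  fix a v assume "(a, v) \<in> ?R"
  then consider "(a, v) \<in> C ws"
    | "a = w" "v \<in> {1..n}" "e ws (length ws) < y v" "y v < e ws (length ws) + p w" by auto
  then show "(a, v) \<in> ?L"
  proof cases
    case 1
    then obtain k where "k < length ws" "a = ws ! k" "v \<in> {1..n}" "e ws k < y v" "y v < e ws (Suc k)"
      by (auto elim: child_relE)
    then show ?thesis using child_relI[of k "ws @ [w]" v] by (simp add: e_list_append nth_append)
  next
    case 2
    then show ?thesis using child_relI[of "length ws" "ws @ [w]" v]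
      by (simp add: e_list_append e_list_snoc)
  qed
qed

lemma C_in: "(a, v) \<in> C ws \<Longrightarrow> a \<in> set ws \<and> v \<in> {1..n}"
  by (auto simp: child_rel_def)

lemma C_unique:
  assumes "set ws \<subseteq> {1..n}" "(a, v) \<in> C ws" "(a', v) \<in> C ws"
  shows "a = a'"
proof -
  obtain k where k: "k < length ws" "a = ws ! k" "e ws k < y v" "y v < e ws (Suc k)"
    using assms(2) by (auto elim: child_relE)
  obtain k' where k': "k' < length ws" "a' = ws ! k'" "e ws k' < y v" "y v < e ws (Suc k')"
    using assms(3) by (auto elim: child_relE)
  have "\<not> Suc k \<le> k'" using e_mono[OF assms(1), of "Suc k" k'] k k' by auto
  moreover have "\<not> Suc k' \<le> k" using e_mono[OF assms(1), of "Suc k'" k] k k' by auto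
  ultimately have "k = k'" by simp
  then show ?thesis using k k' by simp
qed

lemma C_not_root: "set ws \<subseteq> {1..n} \<Longrightarrow> (a, v) \<in> C ws \<Longrightarrow> v \<noteq> r"
proof -
  assume ws: "set ws \<subseteq> {1..n}" and "(a, v) \<in> C ws"
  then obtain k where "k < length ws" "e ws k < y v" by (auto elim: child_relE)
  then show ?thesis using e_nonneg[OF ws, of k] y_r by auto
qed

lemma C_less: "set ws \<subseteq> {1..n} \<Longrightarrow> (a, v) \<in> C ws \<Longrightarrow> y v < e ws (length ws)"
proof -
  assume ws: "set ws \<subseteq> {1..n}" and "(a, v) \<in> C ws"
  then obtain k where "k < length ws" "y v < e ws (Suc k)" by (auto elim: child_relE)
  then show ?thesis using e_mono[OF ws, of "Suc k" "length ws"] by simp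
qed

lemma C_ex:
  assumes "distinct ws" "set ws \<subseteq> {1..n}" "v \<in> {1..n}" "v \<noteq> r" "y v < e ws (length ws)"
  shows "\<exists>a. (a, v) \<in> C ws"
  using assms
proof (induction ws rule: rev_induct)
  case Nil
  then show ?case using y_nonneg[of v] by simp
next
  case (snoc w ws)
  have "y v \<noteq> e ws (length ws)"
    using generic[OF snoc.prems(3,4), of "set ws"] snoc.prems by (simp add: e_list_length)
  then consider "y v < e ws (length ws)" | "y v > e ws (length ws)" by linarith
  then show ?case
  proof cases
    case 1
    then show ?thesis using snoc by (auto simp: C_snoc)
  next
    case 2
    then show ?thesis using snoc.prems by (auto simp: C_snoc e_list_snoc)
  qed
qed

text \<open>The last two clauses say that siblings are examined in increasing order of their marks, and
  that the later siblings of an ancestor of the current vertex have not been examined.\<close>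

definition dfs_inv :: "nat list \<Rightarrow> bool" where
  "dfs_inv ws \<longleftrightarrow> ws \<noteq> [] \<and> ws ! 0 = r \<and> distinct ws \<and> set ws \<subseteq> {1..n}
    \<and> (\<forall>k<length ws. 0 < k \<longrightarrow> y (ws ! k) < e ws k)
    \<and> (\<forall>v\<in>{1..n} - set ws. y v < e ws (length ws) \<longrightarrow>
         (\<exists>a. (a, v) \<in> C ws \<and> (a, last ws) \<in> (C ws)\<^sup>*))
    \<and> (\<forall>a v v'. (a, v) \<in> C ws \<longrightarrow> (a, v') \<in> C ws \<longrightarrow> v' \<in> set ws \<longrightarrow> v \<notin> set ws \<longrightarrow> y v' < y v)
    \<and> (\<forall>a b v. (a, b) \<in> C ws \<longrightarrow> (b, last ws) \<in> (C ws)\<^sup>* \<longrightarrow> (a, v) \<in> C ws \<longrightarrow> y b < y v \<longrightarrow> v \<notin> set ws)"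

lemma dfs_invD:
  assumes "dfs_inv ws"
  shows "ws \<noteq> []" "ws ! 0 = r" "distinct ws" "set ws \<subseteq> {1..n}"
    "\<And>k. \<lbrakk>k < length ws; 0 < k\<rbrakk> \<Longrightarrow> y (ws ! k) < e ws k"
    "\<And>v. \<lbrakk>v \<in> {1..n}; v \<notin> set ws; y v < e ws (length ws)\<rbrakk> \<Longrightarrow>
         (\<exists>a. (a, v) \<in> C ws \<and> (a, last ws) \<in> (C ws)\<^sup>*)"
    "\<And>a v v'. \<lbrakk>(a, v) \<in> C ws; (a, v') \<in> C ws; v' \<in> set ws; v \<notin> set ws\<rbrakk> \<Longrightarrow> y v' < y v"
    "\<And>a b v. \<lbrakk>(a, b) \<in> C ws; (b, last ws) \<in> (C ws)\<^sup>*; (a, v) \<in> C ws; y b < y v\<rbrakk> \<Longrightarrow> v \<notin> set ws"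
    "r \<in> set ws"
proof -
  have h: "ws \<noteq> []" "ws ! 0 = r" "distinct ws" "set ws \<subseteq> {1..n}"
    and h5: "\<forall>k<length ws. 0 < k \<longrightarrow> y (ws ! k) < e ws k"
    and h6: "\<forall>v\<in>{1..n} - set ws. y v < e ws (length ws) \<longrightarrow>
         (\<exists>a. (a, v) \<in> C ws \<and> (a, last ws) \<in> (C ws)\<^sup>*)"
    and h7: "\<forall>a v v'. (a, v) \<in> C ws \<longrightarrow> (a, v') \<in> C ws \<longrightarrow> v' \<in> set ws \<longrightarrow> v \<notin> set ws \<longrightarrow> y v' < y v"
    and h8: "\<forall>a b v. (a, b) \<in> C ws \<longrightarrow> (b, last ws) \<in> (C ws)\<^sup>* \<longrightarrow> (a, v) \<in> C ws \<longrightarrow> y b < y v \<longrightarrow> v \<notin> set ws"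
    using assms unfolding dfs_inv_def by - (elim conjE, assumption)+
  show "ws \<noteq> []" "ws ! 0 = r" "distinct ws" "set ws \<subseteq> {1..n}" by fact+
  show "r \<in> set ws" using h(1,2) by (cases ws) auto
  show "y (ws ! k) < e ws k" if "k < length ws" "0 < k" for k using h5 that by blast
  show "\<exists>a. (a, v) \<in> C ws \<and> (a, last ws) \<in> (C ws)\<^sup>*"
    if "v \<in> {1..n}" "v \<notin> set ws" "y v < e ws (length ws)" for v
    by (rule h6[rule_format]) (use that in simp_all)
  show "y v' < y v" if "(a, v) \<in> C ws" "(a, v') \<in> C ws" "v' \<in> set ws" "v \<notin> set ws" for a v v'
    by (rule h7[rule_format]) fact+
  show "v \<notin> set ws" if "(a, b) \<in> C ws" "(b, last ws) \<in> (C ws)\<^sup>*" "(a, v) \<in> C ws" "y b < y v" for a b v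
    by (rule h8[rule_format]) fact+
qed

text \<open>The interval of the vertex at position k starts at e_k, whereas the vertex at position
  k' has its mark below e_k'. So a parent precedes its child.\<close>

lemma C_index:
  assumes "dfs_inv ws" "(a, v) \<in> C ws" "v \<in> set ws"
  shows "\<exists>k k'. k < k' \<and> k' < length ws \<and> a = ws ! k \<and> v = ws ! k'"
proof -
  obtain k where k: "k < length ws" "a = ws ! k" "e ws k < y v"
    using assms(2) by (auto elim: child_relE)
  obtain k' where k': "k' < length ws" "v = ws ! k'" using assms(3) by (auto simp: in_set_conv_nth)
  have "v \<noteq> r" using C_not_root assms(2) dfs_invD(4)[OF assms(1)] by blast
  then have "0 < k'" using k' dfs_invD(2)[OF assms(1)] by (cases k') auto
  then have "y v < e ws k'" using dfs_invD(5)[OF assms(1)] k' by blast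
  then have "k < k'"
    using e_mono[OF dfs_invD(4)[OF assms(1)], of k' k] k k' by (cases "k < k'") auto
  then show ?thesis using k k' by blast
qed

lemma C_trancl_index:
  assumes "dfs_inv ws" "(a, v) \<in> (C ws)\<^sup>+" "v \<in> set ws"
  shows "\<exists>k k'. k < k' \<and> k' < length ws \<and> a = ws ! k \<and> v = ws ! k'"
  using assms(2,3)
proof (induction rule: trancl_induct)
  case (base v)
  then show ?case using C_index[OF assms(1)] by blast
next
  case (step b v)
  have b: "b \<in> set ws" using step.hyps(2) C_in by blast
  obtain k k' where k: "k < k'" "k' < length ws" "a = ws ! k" "b = ws ! k'"
    using step.IH[OF b] by blast
  obtain l l' where l: "l < l'" "l' < length ws" "b = ws ! l" "v = ws ! l'"
    using C_index[OF assms(1) step.hyps(2) step.prems] by blast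
  have "k' = l" using k l dfs_invD(3)[OF assms(1)] by (simp add: nth_eq_iff_index_eq)
  then show ?case using k l less_trans[of k l l'] by blast
qed

lemma C_acyclic: "dfs_inv ws \<Longrightarrow> v \<in> set ws \<Longrightarrow> (v, v) \<notin> (C ws)\<^sup>+"
  using C_trancl_index[of ws v v] dfs_invD(3)[of ws] by (auto simp: nth_eq_iff_index_eq)

text \<open>The exploration cannot get stuck. If every unexamined mark lay at or beyond e_j, then
  only examined vertices could have marks below the smallest of them, and their weight e_j would
  contradict \<open>excursion\<close> there.\<close>

lemma ex_discovered:
  assumes inv: "dfs_inv ws" and len: "length ws < n"
  shows "\<exists>v\<in>{1..n}. v \<notin> set ws \<and> y v < e ws (length ws)"
proof (rule ccontr)
  assume neg: "\<not> ?thesis"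
  note D = dfs_invD[OF inv]
  let ?U = "{1..n} - set ws"
  have "card (set ws) < n" using len D(3) by (simp add: distinct_card)
  then have "?U \<noteq> {}" using card_mono[of "set ws" "{1..n}"] by auto
  then obtain v where v: "v \<in> ?U" "\<And>v'. v' \<in> ?U \<Longrightarrow> y v \<le> y v'"
    using finite_has_minimal[of "y ` ?U"] arg_min_if_finite(1)[of ?U y] arg_min_least[of ?U _ y]
    by (metis finite_Diff finite_atLeastAtMost)
  have "v \<noteq> r" using v D(9) by auto
  have "e ws (length ws) \<le> y v" using neg v by force
  have sub: "{i. i \<in> {1..n} \<and> y i < y v} \<subseteq> set ws" using v by force
  have "y v < (\<Sum>i | i \<in> {1..n} \<and> y i < y v. p i)" using excursion v \<open>v \<noteq> r\<close> by blast
  also have "\<dots> \<le> sum p (set ws)"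
    by (rule sum_mono2) (use sub D(4) p_pos in \<open>auto intro!: less_imp_le\<close>)
  also have "\<dots> = e ws (length ws)" using D(3) by (simp add: e_list_length)
  finally show False using \<open>e ws (length ws) \<le> y v\<close> by simp
qed

lemma pending_ex:
  assumes inv: "dfs_inv ws" and len: "length ws < n"
  shows "\<exists>m. pending n p y ws m \<noteq> {}"
proof -
  obtain v where v: "v \<in> {1..n}" "v \<notin> set ws" "y v < e ws (length ws)"
    using ex_discovered[OF assms] by blast
  then obtain a where a: "(a, v) \<in> C ws" "(a, last ws) \<in> (C ws)\<^sup>*"
    using dfs_invD(6)[OF inv] by blast
  then obtain m where "(a, last ws) \<in> C ws ^^ m" using rtrancl_imp_relpow by blast
  then have "v \<in> pending n p y ws m" using v a by (auto simp: pending_def)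
  then show ?thesis by blast
qed

lemma C_relpow_unique:
  assumes "set ws \<subseteq> {1..n}" "(a, v) \<in> C ws ^^ m" "(b, v) \<in> C ws ^^ m"
  shows "a = b"
  using assms(2,3)
proof (induction m arbitrary: v)
  case (Suc m)
  then show ?case using C_unique[OF assms(1)] by (metis relpow_Suc_E)
qed simp

lemma next_vertex_props:
  assumes inv: "dfs_inv ws" and len: "length ws < n"
  defines "w \<equiv> next_vertex n p y ws"
  obtains a m where "(a, last ws) \<in> C ws ^^ m" "(a, w) \<in> C ws" "w \<notin> set ws"
    "\<And>v. (a, v) \<in> C ws \<Longrightarrow> v \<notin> set ws \<Longrightarrow> y w \<le> y v"
    "\<And>m' b v. (b, last ws) \<in> C ws ^^ m' \<Longrightarrow> (b, v) \<in> C ws \<Longrightarrow> v \<notin> set ws \<Longrightarrow> m \<le> m'"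
proof -
  define m where "m = (LEAST m. pending n p y ws m \<noteq> {})"
  note D = dfs_invD[OF inv]
  have ne: "pending n p y ws m \<noteq> {}" unfolding m_def using pending_ex[OF inv len] by (rule LeastI_ex)
  have fin: "finite (pending n p y ws m)"
    by (rule finite_subset[of _ "{1..n}"]) (auto simp: pending_def child_rel_def)
  have w: "w = arg_min_on y (pending n p y ws m)" by (simp add: w_def next_vertex_def m_def)
  have wp: "w \<in> pending n p y ws m" unfolding w by (rule arg_min_if_finite(1)[OF fin ne])
  then obtain a where a: "(a, last ws) \<in> C ws ^^ m" "(a, w) \<in> C ws" "w \<notin> set ws"
    by (auto simp: pending_def)
  show ?thesis
  proof (rule that[OF a])
    fix v assume "(a, v) \<in> C ws" "v \<notin> set ws"
    then have "v \<in> pending n p y ws m" using a(1) unfolding pending_def by blast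
    then show "y w \<le> y v" unfolding w by (rule arg_min_least[OF fin ne])
  next
    fix m' b v assume "(b, last ws) \<in> C ws ^^ m'" "(b, v) \<in> C ws" "v \<notin> set ws"
    then have "pending n p y ws m' \<noteq> {}" by (auto simp: pending_def)
    then show "m \<le> m'" unfolding m_def by (rule Least_le)
  qed
qed

lemma C_relpow_diff:
  assumes "set ws \<subseteq> {1..n}" "(b, v) \<in> C ws ^^ m'" "(a, v) \<in> C ws ^^ m" "m \<le> m'"
  shows "(b, a) \<in> (C ws)\<^sup>*"
proof -
  have "C ws ^^ m' = C ws ^^ (m' - m) O C ws ^^ m"
    using assms(4) by (metis le_add_diff_inverse2 relpow_add)
  then obtain c where "(b, c) \<in> C ws ^^ (m' - m)" "(c, v) \<in> C ws ^^ m" using assms(2) by auto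
  then show ?thesis using C_relpow_unique[OF assms(1) _ assms(3)] relpow_imp_rtrancl by metis
qed

lemma dfs_inv_step:
  assumes inv: "dfs_inv ws" and len: "length ws < n"
  shows "dfs_inv (ws @ [next_vertex n p y ws])"
proof -
  define w where "w = next_vertex n p y ws"
  note D = dfs_invD[OF inv]
  obtain a m where a: "(a, last ws) \<in> C ws ^^ m" "(a, w) \<in> C ws" "w \<notin> set ws"
    and min: "\<And>v. (a, v) \<in> C ws \<Longrightarrow> v \<notin> set ws \<Longrightarrow> y w \<le> y v"
    and least: "\<And>m' b v. (b, last ws) \<in> C ws ^^ m' \<Longrightarrow> (b, v) \<in> C ws \<Longrightarrow> v \<notin> set ws \<Longrightarrow> m \<le> m'"
    by (rule next_vertex_props[OF inv len, folded w_def]) (rule that)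
  define ws' where "ws' = ws @ [w]"
  let ?e = "e ws (length ws)"
  have w_in: "w \<in> {1..n}" using a C_in by blast
  have sub': "set ws' \<subseteq> {1..n}" using D(4) w_in by (simp add: ws'_def)
  have C_sub: "C ws \<subseteq> C ws'" by (auto simp: ws'_def C_snoc)
  have C'_cases: "(b, v) \<in> C ws \<or> b = w \<and> ?e < y v" if "(b, v) \<in> C ws'" for b v
    using that by (auto simp: ws'_def C_snoc)
  have yw: "y w < ?e" using C_less[OF D(4) a(2)] .
  \<comment> \<open>The children gained by \<open>w\<close> have marks beyond \<open>?e\<close>, and
    the marks of all examined vertices lie below it. So new edges lead only to unexamined vertices,
    and ancestry among the examined ones is unchanged.\<close>
  have old: "(b, v) \<in> C ws" if bv: "(b, v) \<in> C ws'" "v \<in> set ws'" for b v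
  proof -
    have "\<not> ?e < y v"
    proof (cases "v = w")
      case False
      then obtain k where k: "k < length ws" "v = ws ! k" using bv by (auto simp: ws'_def in_set_conv_nth)
      show ?thesis
      proof (cases k)
        case 0
        then show ?thesis using k D(2) y_r e_nonneg[OF D(4), of "length ws"] by auto
      next
        case (Suc k0)
        then have "y v < e ws k" using D(5) k by simp
        then show ?thesis using e_mono[OF D(4), of k "length ws"] k by simp
      qed
    qed (use yw in simp)
    then show ?thesis using C'_cases[OF bv(1)] by blast
  qed
  have old_rtrancl: "(b, v) \<in> (C ws)\<^sup>*" if "(b, v) \<in> (C ws')\<^sup>*" "v \<in> set ws'" for b v
    using that
  proof (induction rule: rtrancl_induct)
    case (step c d)
    then have "(c, d) \<in> C ws" using old by blast
    moreover then have "c \<in> set ws'" using C_in by (auto simp: ws'_def)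
    ultimately show ?case using step by auto
  qed simp
  have last': "last ws' = w" by (simp add: ws'_def)
  \<comment> \<open>By minimality of \<open>m\<close>, an ancestor of the last vertex that still has
    unexamined children is \<open>a\<close> or lies above it, so it remains an ancestor after the
    step to \<open>w\<close>.\<close>
  have anc_a: "(b, a) \<in> (C ws)\<^sup>*"
    if h: "(b, v) \<in> C ws" "v \<notin> set ws" "(b, last ws) \<in> (C ws)\<^sup>*" for b v
  proof -
    obtain m' where m': "(b, last ws) \<in> C ws ^^ m'" using rtrancl_imp_relpow[OF h(3)] by blast
    show ?thesis by (rule C_relpow_diff[OF D(4) m' a(1) least[OF m' h(1,2)]])
  qed
  have a_last: "(a, last ws) \<in> (C ws)\<^sup>*" using a(1) relpow_imp_rtrancl by blast
  have "dfs_inv ws'"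
    unfolding dfs_inv_def
  proof (intro conjI allI ballI impI)
    show "ws' \<noteq> []" "ws' ! 0 = r" "distinct ws'" "set ws' \<subseteq> {1..n}"
      using D a sub' by (auto simp: ws'_def nth_append)
  next
    fix k assume k: "k < length ws'" "0 < k"
    show "y (ws' ! k) < e ws' k"
    proof (cases "k < length ws")
      case True
      then show ?thesis using D(5) k by (simp add: ws'_def nth_append e_list_append)
    next
      case False
      then have "k = length ws" using k by (simp add: ws'_def)
      then show ?thesis using yw by (simp add: ws'_def e_list_append)
    qed
  next
    fix v assume v: "v \<in> {1..n} - set ws'" "y v < e ws' (length ws')"
    then have "v \<noteq> r" using D(9) by (auto simp: ws'_def)
    then obtain b where b: "(b, v) \<in> C ws'"
      using C_ex[of ws' v] v D(3) a(3) sub' by (auto simp: ws'_def)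
    show "\<exists>b. (b, v) \<in> C ws' \<and> (b, last ws') \<in> (C ws')\<^sup>*"
    proof (cases "(b, v) \<in> C ws")
      case True
      then have "y v < ?e" using C_less[OF D(4)] by blast
      then obtain b' where b': "(b', v) \<in> C ws" "(b', last ws) \<in> (C ws)\<^sup>*"
        using D(6)[of v] v by (auto simp: ws'_def)
      then have "(b', a) \<in> (C ws)\<^sup>*" using anc_a v by (auto simp: ws'_def)
      then have "(b', w) \<in> (C ws)\<^sup>*" using a(2) by auto
      then have "(b', w) \<in> (C ws')\<^sup>*" using C_sub rtrancl_mono by blast
      then show ?thesis using b' C_sub last' by auto
    next
      case False
      then have "b = w" using C'_cases b by blast
      then show ?thesis using b last' by auto
    qed
  next
    fix b v v' assume h: "(b, v) \<in> C ws'" "(b, v') \<in> C ws'" "v' \<in> set ws'" "v \<notin> set ws'"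
    have bv': "(b, v') \<in> C ws" using old h by blast
    then have "b \<in> set ws" using C_in by blast
    then have "b \<noteq> w" using a by auto
    then have bv: "(b, v) \<in> C ws" using C'_cases h by blast
    show "y v' < y v"
    proof (cases "v' = w")
      case True
      then have "b = a" using C_unique[OF D(4)] bv' a by blast
      then have "y w \<le> y v" using min bv h by (auto simp: ws'_def)
      moreover have "v \<noteq> w" using h by (auto simp: ws'_def)
      moreover have "v \<in> {1..n}" using bv C_in by blast
      ultimately show ?thesis using True inj_onD[OF y_inj, of w v] w_in by fastforce
    next
      case False
      then show ?thesis using D(7)[OF bv bv'] h by (auto simp: ws'_def)
    qed
  next
    fix c b v assume h: "(c, b) \<in> C ws'" "(b, last ws') \<in> (C ws')\<^sup>*" "(c, v) \<in> C ws'" "y b < y v"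
    have bw: "(b, w) \<in> (C ws)\<^sup>*" using old_rtrancl h(2) last' by (auto simp: ws'_def)
    have b_in: "b \<in> set ws'"
      using bw by (cases rule: converse_rtranclE) (use C_in in \<open>auto simp: ws'_def\<close>)
    have cb: "(c, b) \<in> C ws" using old h(1) b_in by blast
    show "v \<notin> set ws'"
    proof
      assume v: "v \<in> set ws'"
      then have cv: "(c, v) \<in> C ws" using old h(3) by blast
      show False
      proof (cases "b = w")
        case True
        then have "c = a" using C_unique[OF D(4)] cb a by blast
        have "v \<noteq> w" using h(4) True by auto
        then have "v \<in> set ws" using v by (auto simp: ws'_def)
        then have "y v < y w" using D(7)[OF a(2) _ _ a(3)] cv \<open>c = a\<close> by blast
        then show False using h(4) True by simp
      next
        case False
        then obtain d where d: "(b, d) \<in> (C ws)\<^sup>*" "(d, w) \<in> C ws" using bw by (metis rtranclE)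
        then have ba: "(b, a) \<in> (C ws)\<^sup>*" using C_unique[OF D(4)] a by blast
        then have "(b, last ws) \<in> (C ws)\<^sup>*" using a_last by auto
        then have "v \<notin> set ws" using D(8)[OF cb _ cv h(4)] by blast
        then have "v = w" using v by (auto simp: ws'_def)
        then have "c = a" using C_unique[OF D(4)] cv a by blast
        \<comment> \<open>Otherwise \<open>a\<close> would be the parent of \<open>b\<close> and at
          the same time \<open>b\<close> or one of its descendants.\<close>
        then have "(a, a) \<in> (C ws)\<^sup>+" using cb ba by auto
        moreover have "a \<in> set ws" using a C_in by blast
        ultimately show False using C_acyclic[OF inv] by blast
      qed
    qed
  qed
  then show ?thesis by (simp add: ws'_def w_def)
qed

lemma dfs_inv_root: "dfs_inv [r]"
proof -
  have C1: "C [r] \<subseteq> {r} \<times> {1..n}" by (auto simp: child_rel_def)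
  have noself: "v \<noteq> r" if "(r, v) \<in> C [r]" for v
    using C_not_root[of "[r]"] that r_in by auto
  have "\<exists>a. (a, v) \<in> C [r] \<and> (a, r) \<in> (C [r])\<^sup>*" if "v \<in> {1..n} - {r}" "y v < e [r] (Suc 0)" for v
  proof -
    have "\<exists>a. (a, v) \<in> C [r]" using C_ex[of "[r]" v] that r_in by simp
    then show ?thesis using C1 by blast
  qed
  moreover have "v \<noteq> r" if "(a, v) \<in> C [r]" for a v
    using C1 noself that by blast
  ultimately show ?thesis unfolding dfs_inv_def using r_in by auto
qed

lemma explore_inv: "1 \<le> j \<Longrightarrow> j \<le> n \<Longrightarrow> dfs_inv (explore n p y r j) \<and> length (explore n p y r j) = j"
proof (induction j rule: dec_induct)
  case base
  then show ?case using dfs_inv_root by simp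
next
  case (step j)
  then show ?case using dfs_inv_step by auto
qed

lemma explore_prefix: "j \<le> k \<Longrightarrow> k \<le> n \<Longrightarrow> take j (explore n p y r k) = explore n p y r j"
proof (induction k rule: dec_induct)
  case base
  have "length (explore n p y r j) = j" using explore_inv[of j] base by (cases "j = 0") auto
  then show ?case by simp
next
  case (step k)
  show ?case
  proof (cases "k = 0")
    case False
    then show ?thesis using step explore_inv[of k] by simp
  qed (use step in simp)
qed

end

subsection \<open>Paths to the root and their right siblings\<close>

text \<open>The list runs upwards, from a vertex to the root \<open>r\<close>.\<close>

definition spine :: "('a \<times> 'a) set \<Rightarrow> 'a \<Rightarrow> 'a list \<Rightarrow> bool" where
  "spine T r l \<longleftrightarrow> l \<noteq> [] \<and> last l = r \<and> (\<forall>k. Suc k < length l \<longrightarrow> (l ! Suc k, l ! k) \<in> T)"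

lemma spine_single [simp]: "spine T r [v] \<longleftrightarrow> v = r"
  by (auto simp: spine_def)

lemma spine_Cons: "l \<noteq> [] \<Longrightarrow> spine T r (v # l) \<longleftrightarrow> (hd l, v) \<in> T \<and> spine T r l"
  unfolding spine_def by (auto simp: hd_conv_nth nth_Cons split: nat.splits)

lemma spine_rtrancl: "spine T r l \<Longrightarrow> a \<in> set l \<Longrightarrow> (a, hd l) \<in> T\<^sup>*"
proof (induction l)
  case (Cons v l)
  show ?case
  proof (cases "l = []")
    case False
    then have "(hd l, v) \<in> T" "spine T r l" using Cons.prems spine_Cons by metis+
    then show ?thesis using Cons False by (auto intro: rtrancl_into_rtrancl)
  qed (use Cons in auto)
qed simp

lemma spine_eq:
  assumes unique: "\<And>a a' v. (a, v) \<in> T \<Longrightarrow> (a', v) \<in> T \<Longrightarrow> a = a'"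
    and root: "\<And>a. (a, r) \<notin> T"
    and "spine T r l" "spine T r l'" "hd l = hd l'"
  shows "l = l'"
  using assms(3-5)
proof (induction l arbitrary: l')
  case Nil
  then show ?case by (simp add: spine_def)
next
  case (Cons v l)
  obtain v' m where l': "l' = v' # m" using Cons.prems(2) by (cases l') (auto simp: spine_def)
  then have v': "v' = v" using Cons.prems by simp
  show ?case
  proof (cases "l = []")
    case True
    then have "v = r" using Cons.prems by simp
    then have "m = []" using Cons.prems(2) l' v' root spine_Cons[of m T r v] by auto
    then show ?thesis using True l' v' by simp
  next
    case False
    then have l: "(hd l, v) \<in> T" "spine T r l" using Cons.prems(1) spine_Cons by metis+
    have "m \<noteq> []"
    proof
      assume "m = []"
      then have "v = r" using Cons.prems(2) l' v' by simp
      then show False using l root by blast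
    qed
    then have m: "(hd m, v) \<in> T" "spine T r m" using Cons.prems(2) l' v' spine_Cons by metis+
    have "l = m" by (rule Cons.IH[OF l(2) m(2)]) (use l m unique in blast)
    then show ?thesis using l' v' by simp
  qed
qed

lemma spine_tl:
  assumes "\<And>a. (a, r) \<notin> T" "\<And>a a' v. (a, v) \<in> T \<Longrightarrow> (a', v) \<in> T \<Longrightarrow> a = a'"
    and "spine T r l" "(a, hd l) \<in> T"
  shows "tl l \<noteq> [] \<and> hd (tl l) = a \<and> spine T r (tl l)"
proof -
  obtain v m where l: "l = v # m" using assms(3) by (cases l) (auto simp: spine_def)
  have "m \<noteq> []" using assms(1,3,4) l by auto
  then have "(hd m, v) \<in> T" "spine T r m" using assms(3) l spine_Cons by metis+
  then show ?thesis using l assms(2,4) \<open>m \<noteq> []\<close> by auto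
qed

lemma in_spine:
  assumes T: "\<And>a. (a, r) \<notin> T" "\<And>a a' v. (a, v) \<in> T \<Longrightarrow> (a', v) \<in> T \<Longrightarrow> a = a'"
    and l: "spine T r l" and "(a, hd l) \<in> T\<^sup>*"
  shows "a \<in> set l"
  using assms(4)
proof (induction rule: converse_rtrancl_induct)
  case base
  then show ?case using l by (simp add: spine_def)
next
  case (step a b)
  obtain k where k: "k < length l" "b = l ! k" using step.IH by (auto simp: in_set_conv_nth)
  show ?case
  proof (cases "Suc k < length l")
    case True
    then have "(l ! Suc k, b) \<in> T" using l k by (simp add: spine_def)
    then have "a = l ! Suc k" using T(2) step.hyps by blast
    then show ?thesis using True by simp
  next
    case False
    then have "k = length l - 1" using k by simp
    then have "b = r" using l k by (auto simp: spine_def last_conv_nth)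
    then show ?thesis using T(1) step.hyps by blast
  qed
qed

text \<open>Each step of an undirected walk lengthens or shortens the path to the root by one
  vertex, so a walk from the root with m steps ends at a vertex whose path has at most m + 1
  vertices.\<close>

lemma Least_walk_length:
  assumes T: "\<And>a. (a, r) \<notin> T" "\<And>a a' v. (a, v) \<in> T \<Longrightarrow> (a', v) \<in> T \<Longrightarrow> a = a'"
    and l: "spine T r l"
  shows "(LEAST m. (r, hd l) \<in> (T \<union> T\<inverse>) ^^ m) = length l - 1"
proof (rule Least_equality)
  have "(r, hd l) \<in> (T \<union> T\<inverse>) ^^ (length l - 1)" using l
  proof (induction l)
    case (Cons v l)
    show ?case
    proof (cases "l = []")
      case False
      then have "(hd l, v) \<in> T" "spine T r l" using Cons.prems spine_Cons by metis+
      then have "(r, v) \<in> (T \<union> T\<inverse>) ^^ Suc (length l - 1)" using Cons.IH by auto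
      then show ?thesis using False by simp
    qed (use Cons in auto)
  qed (simp add: spine_def)
  then show "(r, hd l) \<in> (T \<union> T\<inverse>) ^^ (length l - 1)" .
next
  have ex: "\<exists>l'. spine T r l' \<and> hd l' = v \<and> length l' \<le> Suc m" if "(r, v) \<in> (T \<union> T\<inverse>) ^^ m" for v m
    using that
  proof (induction m arbitrary: v)
    case 0
    then have "spine T r [r] \<and> hd [r] = v \<and> length [r] \<le> Suc 0" by simp
    then show ?case by blast
  next
    case (Suc m)
    then obtain b where b: "(r, b) \<in> (T \<union> T\<inverse>) ^^ m" "(b, v) \<in> T \<union> T\<inverse>" by auto
    then obtain l' where l': "spine T r l'" "hd l' = b" "length l' \<le> Suc m" using Suc.IH by blast
    have "l' \<noteq> []" using l' by (auto simp: spine_def)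
    consider "(b, v) \<in> T" | "(v, b) \<in> T" using b by blast
    then show ?case
    proof cases
      case 1
      then have "spine T r (v # l')" using l' \<open>l' \<noteq> []\<close> by (simp add: spine_Cons)
      then show ?thesis using l' by (intro exI[of _ "v # l'"]) simp
    next
      case 2
      then have "tl l' \<noteq> [] \<and> hd (tl l') = v \<and> spine T r (tl l')"
        using spine_tl[where r = r and T = T and l = l' and a = v] T l' by blast
      then show ?thesis using l' by (intro exI[of _ "tl l'"]) auto
    qed
  qed
  fix m assume "(r, hd l) \<in> (T \<union> T\<inverse>) ^^ m"
  then obtain l' where "spine T r l'" "hd l' = hd l" "length l' \<le> Suc m" using ex by blast
  moreover then have "l' = l" using spine_eq[of T r l' l] T l by metis
  ultimately show "length l - 1 \<le> m" by simp
qed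

text \<open>Children of hubs are left out because the processes r_i remove them. Hubs among the
  siblings are left out because the weight of a waiting hub is nearly cancelled by that of its own
  children, which r_i subtracts from the moment the hub is discovered. The order \<open>key\<close>
  is a parameter, to be instantiated both with the marks and with the slot coordinates.\<close>

definition right_sibs ::
  "nat \<Rightarrow> nat \<Rightarrow> (nat \<times> nat) set \<Rightarrow> (nat \<Rightarrow> real) \<Rightarrow> nat list \<Rightarrow> nat set" where
  "right_sibs n I T key l = {v \<in> {1..n} - set l. I < v \<and>
     (\<exists>k. Suc k < length l \<and> I < l ! Suc k \<and> (l ! Suc k, v) \<in> T \<and> key (l ! k) < key v)}"

section \<open>The complete depth-first order and its tree\<close>

context marks begin

definition W :: "nat list" where "W = explore n p y r n"
definition T :: "(nat \<times> nat) set" where "T = C W"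

lemma n_pos: "1 \<le> n" using r_in by simp

lemma W_inv: "dfs_inv W" and W_length: "length W = n"
  using explore_inv[of n] n_pos by (auto simp: W_def)

lemmas WD = dfs_invD[OF W_inv]

lemma W_set: "set W = {1..n}"
  by (rule card_subset_eq) (use WD(3,4) W_length in \<open>auto simp: distinct_card\<close>)

lemma take_inv: "1 \<le> j \<Longrightarrow> j \<le> n \<Longrightarrow> dfs_inv (take j W)"
  using explore_inv[of j] explore_prefix[of j n] by (simp add: W_def)

lemma e_W_n: "e W n = 1"
  using e_list_length[of W p] WD(3) W_length W_set p_sum by simp

lemma C_take: "j \<le> n \<Longrightarrow> C (take j W) = {(a, v). (a, v) \<in> T \<and> a \<in> set (take j W)}" (is "_ \<Longrightarrow> ?L = ?R")
proof (intro equalityI subrelI)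
  assume j: "j \<le> n"
  fix a v
  show "(a, v) \<in> ?R" if "(a, v) \<in> ?L"
  proof -
    obtain k where k: "k < length (take j W)" "a = take j W ! k" "v \<in> {1..n}"
      "e (take j W) k < y v" "y v < e (take j W) (Suc k)" using \<open>(a, v) \<in> ?L\<close> by (auto elim: child_relE)
    then have "k < j" "j \<le> length W" using j W_length by auto
    then have "(W ! k, v) \<in> C W" using k by (intro child_relI) (auto simp: e_list_take)
    then show ?thesis using \<open>(a, v) \<in> ?L\<close> C_in k \<open>k < j\<close> by (auto simp: T_def)
  qed
  show "(a, v) \<in> ?L" if "(a, v) \<in> ?R"
  proof -
    obtain k where k: "k < length W" "a = W ! k" "v \<in> {1..n}" "e W k < y v" "y v < e W (Suc k)"
      using \<open>(a, v) \<in> ?R\<close> by (auto simp: T_def elim: child_relE)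
    obtain k' where "k' < j" "a = W ! k'" using \<open>(a, v) \<in> ?R\<close> by (auto simp: in_set_conv_nth)
    then have "k < j" using k WD(3) W_length j by (simp add: nth_eq_iff_index_eq)
    then have "(take j W ! k, v) \<in> C (take j W)" using k j W_length
      by (intro child_relI) (auto simp: e_list_take)
    then show ?thesis using k \<open>k < j\<close> by simp
  qed
qed

lemma T_unique: "(a, v) \<in> T \<Longrightarrow> (a', v) \<in> T \<Longrightarrow> a = a'"
  unfolding T_def using C_unique[OF WD(4)] by blast

lemma T_not_root: "(a, r) \<notin> T"
  unfolding T_def using C_not_root[OF WD(4)] by blast

lemma T_in: "(a, v) \<in> T \<Longrightarrow> a \<in> {1..n} \<and> v \<in> {1..n}"
  unfolding T_def using C_in W_set by blast

lemma T_ex: "v \<in> {1..n} \<Longrightarrow> v \<noteq> r \<Longrightarrow> \<exists>a. (a, v) \<in> T"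
  unfolding T_def using C_ex[OF WD(3,4)] y_less[of v] e_W_n W_length by simp

lemma T_nth: "(W ! k, v) \<in> T \<Longrightarrow> k < n \<Longrightarrow> e W k < y v \<and> y v < e W (Suc k)"
  unfolding T_def using WD(3) W_length by (auto elim!: child_relE simp: nth_eq_iff_index_eq)

lemma T_index: "(W ! k, W ! k') \<in> T \<Longrightarrow> k < n \<Longrightarrow> k' < n \<Longrightarrow> k < k'"
  using C_index[OF W_inv, of "W ! k" "W ! k'"] WD(3) W_length
  by (auto simp: T_def nth_eq_iff_index_eq)

lemma y_W_le: "k < n \<Longrightarrow> y (W ! k) \<le> e W k"
  using WD(2) WD(5)[of k] y_r W_length by (cases "k = 0") auto

lemma e_W_mono: "k \<le> k' \<Longrightarrow> k' \<le> n \<Longrightarrow> e W k \<le> e W k'"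
  using e_mono[OF WD(4)] W_length by simp

lemma e_W_Suc: "k < n \<Longrightarrow> e W (Suc k) = e W k + p (W ! k)"
  using e_list_Suc W_length by simp

lemma spine_ex:
  assumes "j < n"
  shows "\<exists>l. spine T r l \<and> hd l = W ! j \<and> distinct l \<and> set l \<subseteq> set (take (Suc j) W)"
  using assms
proof (induction j rule: less_induct)
  case (less j)
  have jW: "W ! j \<in> set (take (Suc j) W)" using less.prems W_length by (auto simp: take_Suc_conv_app_nth)
  show ?case
  proof (cases "j = 0")
    case True
    then show ?thesis using WD(2) jW by (intro exI[of _ "[r]"]) auto
  next
    case False
    have "0 < length W" using n_pos W_length by simp
    then have "W ! j \<noteq> W ! 0" using False WD(3) less.prems W_length by (simp add: nth_eq_iff_index_eq)
    then have "W ! j \<noteq> r" using WD(2) by simp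
    moreover have "W ! j \<in> {1..n}" using nth_mem[of j W] less.prems W_length W_set by metis
    ultimately obtain a where a: "(a, W ! j) \<in> T" using T_ex by blast
    then obtain i where i: "i < n" "a = W ! i" using T_in W_set W_length by (metis in_set_conv_nth)
    then have "i < j" using T_index a less.prems by blast
    then obtain l where l: "spine T r l" "hd l = a" "distinct l" "set l \<subseteq> set (take (Suc i) W)"
      using less.IH i by blast
    have "l \<noteq> []" using l by (auto simp: spine_def)
    have sub: "set (take (Suc i) W) \<subseteq> set (take j W)" using \<open>i < j\<close> by (simp add: set_take_subset_set_take)
    have "W ! j \<notin> set (take j W)"
      using WD(3) less.prems W_length by (auto simp: in_set_conv_nth nth_eq_iff_index_eq)
    then have "spine T r (W ! j # l)" "distinct (W ! j # l)"
      using l a sub \<open>l \<noteq> []\<close> by (auto simp: spine_Cons)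
    moreover have "set (W ! j # l) \<subseteq> set (take (Suc j) W)"
      using jW l sub set_take_subset_set_take[of j "Suc j" W] by auto
    ultimately show ?thesis by (intro exI[of _ "W ! j # l"]) simp
  qed
qed

text \<open>A vertex discovered before step j and still waiting has its parent on the path from the
  current vertex to the root, by the invariant, and lies to the right of the path, because siblings
  are examined in order. The bound by \<open>e W j\<close> excludes the children of the current
  vertex itself, which have no sibling on the path.\<close>

lemma right_sibs_eq:
  assumes j: "j < n" and l: "spine T r l" "hd l = W ! j" "set l \<subseteq> set (take (Suc j) W)"
  shows "right_sibs n I T y l =
    {v \<in> {1..n} - set (take (Suc j) W). I < v \<and> y v < e W j \<and> (\<exists>a>I. (a, v) \<in> T)}" (is "?L = ?R")
proof -
  define ws where "ws = take (Suc j) W"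
  have inv: "dfs_inv ws" unfolding ws_def by (rule take_inv) (use j in auto)
  note D = dfs_invD[OF inv]
  have Cws: "C ws = {(a, v). (a, v) \<in> T \<and> a \<in> set ws}" unfolding ws_def by (rule C_take) (use j in auto)
  have len: "length ws = Suc j" using j W_length by (simp add: ws_def)
  have last: "last ws = W ! j" using j W_length by (simp add: ws_def take_Suc_conv_app_nth)
  have els: "e ws (length ws) = e W (Suc j)" using len by (simp add: ws_def e_list_take)
  have sub: "set l \<subseteq> set ws" using l by (simp add: ws_def)
  have ws_nth: "\<exists>i\<le>j. a = W ! i" if a: "a \<in> set ws" for a
  proof -
    obtain i where "i < length ws" "a = ws ! i" using a by (metis in_set_conv_nth)
    then show ?thesis using len by (intro exI[of _ i]) (auto simp: ws_def)
  qed
  have sp: "spine (C ws) r l"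
    unfolding spine_def
  proof (intro conjI allI impI)
    show "l \<noteq> []" "last l = r" using l(1) by (auto simp: spine_def)
    fix k assume k: "Suc k < length l"
    then have "l ! Suc k \<in> set ws" using sub nth_mem by blast
    then show "(l ! Suc k, l ! k) \<in> C ws" using l(1) k by (simp add: spine_def Cws)
  qed
  have "?L = {v \<in> {1..n} - set ws. I < v \<and> y v < e W j \<and> (\<exists>a>I. (a, v) \<in> T)}" (is "_ = ?R'")
  proof (intro equalityI subsetI)
    fix v assume "v \<in> ?L"
    then obtain k where k: "v \<in> {1..n}" "v \<notin> set l" "I < v" "Suc k < length l" "I < l ! Suc k"
      "(l ! Suc k, v) \<in> T" "y (l ! k) < y v" by (auto simp: right_sibs_def)
    have ab: "(l ! Suc k, l ! k) \<in> C ws" using sp k by (simp add: spine_def)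
    have av: "(l ! Suc k, v) \<in> C ws" using k sub by (auto simp: Cws)
    have "(l ! k, last ws) \<in> (C ws)\<^sup>*" using spine_rtrancl[OF sp, of "l ! k"] k l(2) last by simp
    then have "v \<notin> set ws" using D(8)[OF ab _ av] k by blast
    moreover have "y v < e W j"
    proof -
      obtain i i' where i: "i \<le> j" "l ! Suc k = W ! i" "i' \<le> j" "l ! k = W ! i'"
        using ws_nth[of "l ! Suc k"] ws_nth[of "l ! k"] sub k(4) by (meson Suc_lessD nth_mem subsetD)
      then have "i < i'" using T_index[of i i'] ab j by (auto simp: Cws)
      moreover have "y v < e W (Suc i)" using T_nth[of i v] k(6) i j by auto
      ultimately show ?thesis using e_W_mono[of "Suc i" j] i j by simp
    qed
    ultimately show "v \<in> ?R'" using k by blast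
  next
    fix v assume v: "v \<in> ?R'"
    have "e W j \<le> e W (Suc j)" using e_W_mono j by simp
    then obtain a where a: "(a, v) \<in> C ws" "(a, last ws) \<in> (C ws)\<^sup>*"
      using D(6)[of v] v els by auto
    have "(b, r) \<notin> C ws" for b using Cws T_not_root by blast
    moreover have "b = b'" if "(b, v) \<in> C ws" "(b', v) \<in> C ws" for b b' v
      using that C_unique[OF D(4)] by blast
    ultimately have "a \<in> set l" using in_spine[OF _ _ sp, of a] a(2) l(2) last by metis
    then obtain i where i: "i < length l" "a = l ! i" by (auto simp: in_set_conv_nth)
    have aT: "(a, v) \<in> T" using a(1) Cws by blast
    \<comment> \<open>\<open>a\<close> is not the current vertex, whose children have marks beyond
      \<open>e W j\<close>. So the path passes from \<open>a\<close> to another child of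
      \<open>a\<close>, with which \<open>v\<close> is then compared.\<close>
    have "i \<noteq> 0"
    proof
      assume "i = 0"
      then have "a = W ! j" using i l(1,2) by (simp add: hd_conv_nth spine_def)
      then show False using T_nth[of j v] aT j v by auto
    qed
    then obtain k where k: "i = Suc k" by (cases i) auto
    have b: "(a, l ! k) \<in> C ws" "l ! k \<in> set ws" using sp sub i k by (auto simp: spine_def)
    have "y (l ! k) < y v" using D(7)[OF a(1) b] v by blast
    moreover have "I < a" using v aT T_unique by auto
    ultimately show "v \<in> ?L" using v i k aT sub by (auto simp: right_sibs_def)
  qed
  then show ?thesis by (simp add: ws_def)
qed

text \<open>All vertices examined so far, the current one included, have marks at most u and
  together weigh e_(j+1). Thus the excursion is the unexplored part of the current vertex plus the
  weight of the waiting vertices.\<close>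

lemma bridge_eq:
  assumes j: "j < n" and u: "j = 0 \<and> u = 0 \<or> e W j < u \<and> u \<le> e W (Suc j)"
  shows "bridge n p y u = e W (Suc j) - u + (\<Sum>v | v \<in> {1..n} - set (take (Suc j) W) \<and> y v \<le> u. p v)"
proof -
  let ?A = "set (take (Suc j) W)"
  have ju: "e W j \<le> u" using u by auto
  have y_le: "y v \<le> u" if v: "v \<in> ?A" for v
  proof -
    obtain i where i: "i < Suc j" "v = W ! i" using v j W_length by (auto simp: in_set_conv_nth)
    then show ?thesis using y_W_le[of i] e_W_mono[of i j] ju j by auto
  qed
  have sub: "?A \<subseteq> {1..n}" using WD(4) set_take_subset by fast
  have "(\<Sum>i=1..n. p i * of_bool (y i \<le> u)) = (\<Sum>v | v \<in> {1..n} \<and> y v \<le> u. p v)"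
    unfolding of_bool_def by (subst sum.inter_filter) (auto intro: sum.cong)
  also have "{v. v \<in> {1..n} \<and> y v \<le> u} = ?A \<union> {v. v \<in> {1..n} - ?A \<and> y v \<le> u}"
    using sub y_le by blast
  also have "sum p \<dots> = sum p ?A + (\<Sum>v | v \<in> {1..n} - ?A \<and> y v \<le> u. p v)"
    by (rule sum.union_disjoint) auto
  also have "sum p ?A = e W (Suc j)" using e_list_eq_sum[OF WD(3)] by simp
  finally show ?thesis by (simp add: bridge_def)
qed

end

subsection \<open>The process \<open>G\<close> on a tree without exceptional behaviour\<close>

definition small_ancestors :: "nat \<Rightarrow> nat list \<Rightarrow> nat" where
  "small_ancestors I l = length (filter (\<lambda>a. I < a) (tl l))"

lemma small_ancestors_bounds:
  assumes "distinct l" "set l \<subseteq> {1..n}"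
  shows "small_ancestors I l \<le> length l - 1" "length l - 1 \<le> small_ancestors I l + I"
proof -
  have "length (tl l) = small_ancestors I l + length (filter (\<lambda>a. \<not> I < a) (tl l))"
    unfolding small_ancestors_def by (rule sum_length_filter_compl[symmetric])
  moreover have "length (filter (\<lambda>a. \<not> I < a) (tl l)) = card (set (filter (\<lambda>a. \<not> I < a) (tl l)))"
    by (rule distinct_card[symmetric]) (simp add: assms distinct_tl)
  moreover have "\<dots> \<le> card {1..I}"
  proof (rule card_mono)
    have "set (tl l) \<subseteq> {1..n}" using assms(2) by (cases l) auto
    then show "set (filter (\<lambda>a. \<not> I < a) (tl l)) \<subseteq> {1..I}" by auto
  qed simp
  ultimately show "small_ancestors I l \<le> length l - 1" "length l - 1 \<le> small_ancestors I l + I"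
    by simp_all
qed

section \<open>Heights and the processes r_i during one step of the exploration\<close>

locale hub_tree = marks +
  fixes x :: "nat \<Rightarrow> real" and I :: nat and s :: real
  assumes shifted_eq: "shifted n p x = y" and root_eq: "root_vertex n p x = r"
    and I_le: "I \<le> n" and s_pos: "0 < s"
    and small: "\<And>i. i \<in> {1..n} \<Longrightarrow> I < i \<Longrightarrow> p i = s"
begin

lemma in_take_W_iff: "k < n \<Longrightarrow> m \<le> n \<Longrightarrow> W ! k \<in> set (take m W) \<longleftrightarrow> k < m"
  using WD(3) W_length by (auto simp: in_set_conv_nth nth_eq_iff_index_eq intro!: exI[of _ k])

lemma in_take_W_nth: "v \<in> set (take m W) \<Longrightarrow> m \<le> n \<Longrightarrow> \<exists>i<m. v = W ! i"
  using W_length by (auto simp: in_set_conv_nth)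

lemma dfs_order_eq: "dfs_order n p x = W"
  by (simp add: dfs_order_def shifted_eq root_eq W_def)

lemma tree_eq: "tree n p x = T"
  by (simp add: tree_def dfs_order_eq shifted_eq T_def)

lemma e_index_eq: "e_index n p x j = e W j"
  by (simp add: e_index_def dfs_order_eq)

lemma children_eq: "children n p x i = {v. (i, v) \<in> T}"
  by (simp add: children_def tree_eq)

lemma finite_children_T: "finite {v. (i, v) \<in> T}"
  using finite_children[of n p x i] by (simp add: children_eq)

lemma e_vertex_eq: "k < n \<Longrightarrow> e_vertex n p x (W ! k) = e W (Suc k)"
proof -
  assume k: "k < n"
  have "(THE j. j \<in> {1..n} \<and> W ! (j - 1) = W ! k) = Suc k"
  proof (rule the_equality)
    fix j assume j: "j \<in> {1..n} \<and> W ! (j - 1) = W ! k"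
    then have "j - 1 = k" using k WD(3) W_length nth_eq_iff_index_eq[of W "j - 1" k] by auto
    then show "j = Suc k" using j by auto
  qed (use k in auto)
  then show ?thesis by (simp add: e_vertex_def dfs_order_eq e_index_eq)
qed

lemma height_eq:
  assumes "spine T r l"
  shows "height n p x (hd l) = length l - 1"
  unfolding height_def root_eq tree_eq
  by (rule Least_walk_length) (use assms T_not_root T_unique in blast)+

text \<open>The intervals are open on the left, so u = 0 belongs to none of them; it is attached to
  the step of the root.\<close>

definition in_step :: "nat \<Rightarrow> real \<Rightarrow> bool" where
  "in_step j u \<longleftrightarrow> j < n \<and> (j = 0 \<and> u = 0 \<or> e W j < u \<and> u \<le> e W (Suc j))"

lemma in_step_ex:
  assumes "0 \<le> u" "u \<le> 1"
  shows "\<exists>j. in_step j u"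
proof (cases "u = 0")
  case True
  then show ?thesis using n_pos by (intro exI[of _ 0]) (simp add: in_step_def)
next
  case False
  define k where "k = (LEAST k. u \<le> e W k)"
  have ex: "u \<le> e W n" using e_W_n assms by simp
  then have k: "u \<le> e W k" unfolding k_def by (rule LeastI)
  have "k \<le> n" unfolding k_def using ex by (rule Least_le)
  have "k \<noteq> 0" using k False assms by (cases k) auto
  then obtain j where j: "k = Suc j" by (cases k) auto
  have "\<not> u \<le> e W j" using not_less_Least[of j "\<lambda>k. u \<le> e W k"] j by (simp add: k_def)
  then show ?thesis using k j \<open>k \<le> n\<close> by (intro exI[of _ j]) (auto simp: in_step_def)
qed

lemma in_step_D:
  assumes "in_step j u"
  shows "j < n" "e W j \<le> u" "u \<le> e W (Suc j)" "j \<noteq> 0 \<Longrightarrow> e W j < u" "e W (Suc j) \<le> u + p (W ! j)"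
proof -
  show j: "j < n" using assms by (simp add: in_step_def)
  have "0 \<le> e W (Suc 0)" using e_W_mono[of 0 "Suc 0"] n_pos by simp
  then show u: "e W j \<le> u" "u \<le> e W (Suc j)" "j \<noteq> 0 \<Longrightarrow> e W j < u"
    using assms by (auto simp: in_step_def)
  show "e W (Suc j) \<le> u + p (W ! j)" using u j by (simp add: e_W_Suc)
qed

lemma H_proc_eq:
  assumes u: "in_step j u" and l: "spine T r l" "hd l = W ! j"
  shows "H_proc n p x u = length l - 1"
proof -
  let ?f = "\<lambda>i. of_bool (u \<in> {e W (i - 1)<..e W i}) * real (height n p x (W ! (i - 1)))"
  have H: "H_proc n p x u = (\<Sum>i=1..n. ?f i)" by (simp add: H_proc_def e_index_eq dfs_order_eq)
  have zero: "?f i = 0" if "i \<in> {1..n}" "i \<noteq> Suc j" for i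
  proof -
    have "u \<notin> {e W (i - 1)<..e W i}"
    proof (cases "i \<le> j")
      case True
      then have "e W i \<le> e W j" "j \<noteq> 0" using e_W_mono[of i j] in_step_D(1)[OF u] that by auto
      then show ?thesis using in_step_D(4)[OF u] by auto
    next
      case False
      then have "e W (Suc j) \<le> e W (i - 1)" using e_W_mono[of "Suc j" "i - 1"] that by auto
      then show ?thesis using in_step_D(3)[OF u] by auto
    qed
    then show ?thesis by simp
  qed
  have "H_proc n p x u = (\<Sum>i\<in>{Suc j}. ?f i)"
    unfolding H by (rule sum.mono_neutral_right) (use zero in_step_D(1)[OF u] in auto)
  also have "\<dots> = of_bool (u \<in> {e W j<..e W (Suc j)}) * (length l - 1)"
    using height_eq[OF l(1)] l(2) by simp
  \<comment> \<open>At u = 0 the interval test fails, but the height of the root is 0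
    anyway.\<close>
  also have "\<dots> = length l - 1"
  proof (cases "j = 0")
    case True
    then have "hd l = r" using l(2) WD(2) by simp
    have "l = [r]" by (rule spine_eq[of T r]) (use T_unique T_not_root l \<open>hd l = r\<close> in auto)
    then show ?thesis by simp
  next
    case False
    then show ?thesis using in_step_D(3,4)[OF u] by simp
  qed
  finally show ?thesis .
qed

text \<open>The constant piece of \<open>rho\<close> lasts while \<open>v\<close> is waiting and the
  sloping piece while \<open>v\<close> is under examination. Since \<open>v\<close> has a parent it
  is not the root, so in the second case u lies strictly beyond the left endpoint and the sloping
  branch is really the one taken.\<close>

lemma rho_eq:
  assumes u: "in_step j u" and v: "(i, v) \<in> T"
  shows "rho n p x i v u = of_bool (y i \<le> u) *
    (if v \<in> set (take (Suc j) W) then of_bool (v = W ! j) * (e W (Suc j) - u) else p v)"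
proof -
  note U = in_step_D[OF u]
  obtain k where k: "k < n" "v = W ! k" using v T_in W_set W_length by (metis in_set_conv_nth)
  have ev: "e_vertex n p x v = e W (Suc k)" using e_vertex_eq k by simp
  have ek: "e_vertex n p x v - p v = e W k" using ev e_W_Suc k by simp
  have mem: "v \<in> set (take (Suc j) W) \<longleftrightarrow> k \<le> j"
    using k U(1) in_take_W_iff[of k "Suc j"] by auto
  have eq: "v = W ! j \<longleftrightarrow> k = j" using k U(1) WD(3) W_length by (simp add: nth_eq_iff_index_eq)
  have rho: "rho n p x i v u = (if u < y i then 0 else if u \<le> e W k then p v
      else if u \<le> e W (Suc k) then e W (Suc k) - u else 0)"
    unfolding rho_def shifted_eq ek unfolding ev ..
  have "k \<noteq> 0" using v k T_not_root WD(2) by (cases k) auto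
  consider "k < j" | "k = j" | "j < k" by linarith
  then show ?thesis
  proof cases
    case 1
    then have "e W (Suc k) < u" "e W k < u"
      using e_W_mono[of "Suc k" j] e_W_mono[of k j] U by auto
    then show ?thesis using 1 by (simp add: rho mem eq)
  next
    case 2
    then have "e W k < u" using U(4) \<open>k \<noteq> 0\<close> by simp
    then show ?thesis using 2 U(3) by (simp add: rho mem eq)
  next
    case 3
    then have "u \<le> e W k" using e_W_mono[of "Suc j" k] U k by auto
    then show ?thesis using 3 by (simp add: rho mem eq)
  qed
qed

lemma r_proc_eq:
  assumes u: "in_step j u"
  shows "r_proc n p x i u = of_bool (y i \<le> u) *
    (sum p ({v. (i, v) \<in> T} - set (take (Suc j) W)) + of_bool ((i, W ! j) \<in> T) * (e W (Suc j) - u))"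
proof -
  let ?B = "{v. (i, v) \<in> T}" and ?A = "set (take (Suc j) W)"
  have wA: "W ! j \<in> ?A" using in_step_D(1)[OF u] W_length by (simp add: take_Suc_conv_app_nth)
  have "r_proc n p x i u = (\<Sum>v\<in>?B. of_bool (y i \<le> u) *
      (if v \<in> ?A then of_bool (v = W ! j) * (e W (Suc j) - u) else p v))"
    unfolding r_proc_def children_eq by (rule sum.cong) (use rho_eq[OF u] in auto)
  also have "\<dots> = of_bool (y i \<le> u) *
      (\<Sum>v\<in>?B. if v \<in> ?A then of_bool (v = W ! j) * (e W (Suc j) - u) else p v)"
    by (simp add: sum_distrib_left)
  also have "(\<Sum>v\<in>?B. if v \<in> ?A then of_bool (v = W ! j) * (e W (Suc j) - u) else p v)
      = (\<Sum>v\<in>?B \<inter> ?A. of_bool (v = W ! j) * (e W (Suc j) - u)) + sum p (?B \<inter> - ?A)"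
    by (subst sum.If_cases) (auto simp: finite_children_T)
  also have "(\<Sum>v\<in>?B \<inter> ?A. of_bool (v = W ! j) * (e W (Suc j) - u))
      = of_bool ((i, W ! j) \<in> T) * (e W (Suc j) - u)"
  proof (cases "(i, W ! j) \<in> T")
    case True
    have "(\<Sum>v\<in>?B \<inter> ?A. of_bool (v = W ! j) * (e W (Suc j) - u))
        = (\<Sum>v\<in>{W ! j}. of_bool (v = W ! j) * (e W (Suc j) - u))"
      by (rule sum.mono_neutral_right) (use True wA finite_children_T in auto)
    then show ?thesis using True by simp
  next
    case False
    then show ?thesis by (auto intro!: sum.neutral)
  qed
  finally show ?thesis by (simp add: Diff_eq add.commute)
qed

end

text \<open>The deterministic properties that make G close to \<open>s\<close> times the number of
  right siblings. Without edges between hubs, all children of a hub weigh \<open>s\<close>, so that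
  \<open>window\<close> controls their mass. \<open>balance\<close> is required of all paths at
  once; the numbers of children of small vertices are then controlled as well.\<close>

locale good_tree = hub_tree +
  fixes t \<delta> :: real
  assumes \<delta>_nonneg: "0 \<le> \<delta>"
    and no_hub_pair: "\<And>i i'. (i, i') \<in> T \<Longrightarrow> i' \<le> I \<Longrightarrow> I < i"
    and window: "\<And>k a. \<lbrakk>k < n; W ! k \<le> I; 0 \<le> a; a \<le> p (W ! k)\<rbrakk> \<Longrightarrow>
      \<bar>s * real (card {v. I < v \<and> (W ! k, v) \<in> T \<and> y v \<le> e W k + a}) - (a :: real)\<bar> \<le> \<delta>"
    and balance: "\<And>l. \<lbrakk>spine T r l; distinct l; set l \<subseteq> {1..n}\<rbrakk> \<Longrightarrow>
      \<bar>card (right_sibs n I T y l) - small_ancestors I l / 2\<bar> \<le> t"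
begin

lemma hub_children_mass:
  assumes "k < n" "W ! k \<le> I"
  shows "\<bar>sum p {v. (W ! k, v) \<in> T} - p (W ! k)\<bar> \<le> \<delta>"
proof -
  have eq: "{v. I < v \<and> (W ! k, v) \<in> T \<and> y v \<le> e W k + p (W ! k)} = {v. (W ! k, v) \<in> T}"
    using no_hub_pair assms T_nth[of k] e_W_Suc[of k] by (fastforce simp: not_less[symmetric])
  have "W ! k \<in> {1..n}" using nth_mem[of k W] assms W_set W_length by metis
  then have "0 \<le> p (W ! k)" using p_pos less_imp_le by blast
  then have "\<bar>s * card {v. (W ! k, v) \<in> T} - p (W ! k)\<bar> \<le> \<delta>"
    using window[of k "p (W ! k)"] assms unfolding eq by simp
  moreover have "sum p {v. (W ! k, v) \<in> T} = (\<Sum>v\<in>{v. (W ! k, v) \<in> T}. s)"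
  proof (rule sum.cong[OF refl])
    fix v assume "v \<in> {v. (W ! k, v) \<in> T}"
    then have "v \<in> {1..n}" "I < v"
      using no_hub_pair[of "W ! k" v] T_in[of "W ! k" v] assms by (auto simp: not_le[symmetric])
    then show "p v = s" by (rule small)
  qed
  ultimately show ?thesis by (simp add: mult.commute)
qed

text \<open>Prolong the path by the first child \<open>c\<close>: the other small children become
  right siblings, while half the number of small ancestors grows by 1/2 only. Comparing
  \<open>balance\<close> for the two paths gives at most 2 t + 1/2 such children, and
  \<open>c\<close> itself adds at most 1.\<close>

lemma small_children_bound:
  assumes j: "j < n" and w: "I < W ! j" and l: "spine T r l" "hd l = W ! j" "distinct l"
    "set l \<subseteq> set (take (Suc j) W)"
  shows "card {v. I < v \<and> (W ! j, v) \<in> T} \<le> 2 * t + 3 / 2"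
proof (cases "{v. I < v \<and> (W ! j, v) \<in> T} = {}")
  case True
  have "0 \<le> t" using balance[of "[r]"] r_in by auto
  then show ?thesis by (subst True) simp
next
  case False
  let ?B = "{v. (W ! j, v) \<in> T}" and ?K = "{v. I < v \<and> (W ! j, v) \<in> T}"
  have ne: "?B \<noteq> {}" using False by blast
  define c where "c = arg_min_on y ?B"
  have c: "(W ! j, c) \<in> T" using arg_min_if_finite(1)[OF finite_children_T ne] by (simp add: c_def)
  have c_min: "y c \<le> y v" if "(W ! j, v) \<in> T" for v
    unfolding c_def by (rule arg_min_least[OF finite_children_T ne]) (use that in simp)
  have ws: "set (take (Suc j) W) \<subseteq> {1..n}" using set_take_subset W_set by metis
  have new: "v \<notin> set (take (Suc j) W)" if "(W ! j, v) \<in> T" for v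
  proof
    assume "v \<in> set (take (Suc j) W)"
    then obtain i where i: "i \<le> j" "v = W ! i" using in_take_W_nth[of v "Suc j"] j by (auto simp: less_Suc_eq_le)
    then show False using T_index[of j i] that j by auto
  qed
  have l0: "l \<noteq> []" "l ! 0 = W ! j" using l by (auto simp: spine_def hd_conv_nth)
  have sp: "spine T r (c # l)" using l c l0 by (simp add: spine_Cons)
  have "c \<notin> set l" using new[OF c] l(4) by blast
  then have bal: "\<bar>card (right_sibs n I T y (c # l)) - small_ancestors I (c # l) / 2\<bar> \<le> t"
    using balance[OF sp] l T_in[OF c] ws by auto
  have sa: "small_ancestors I (c # l) = Suc (small_ancestors I l)"
    using w l0 l(2) by (cases l) (auto simp: small_ancestors_def)
  have bal': "\<bar>card (right_sibs n I T y l) - small_ancestors I l / 2\<bar> \<le> t"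
    using balance[OF l(1,3)] l(4) ws by auto
  note RS = right_sibs_eq[OF j l(1,2,4), of I]
  have disj: "right_sibs n I T y l \<inter> (?K - {c}) = {}"
    unfolding RS using T_nth[of j] j by fastforce
  have fin: "finite (right_sibs n I T y l')" for l'
    by (rule finite_subset[of _ "{1..n}"]) (auto simp: right_sibs_def)
  have finK: "finite ?K" by (rule finite_subset[OF _ finite_children_T[of "W ! j"]]) auto
  have sub1: "right_sibs n I T y l \<subseteq> right_sibs n I T y (c # l)"
  proof
    fix v assume v: "v \<in> right_sibs n I T y l"
    then have "y v < e W j" using RS by blast
    then have "v \<noteq> c" using T_nth[OF c j] by auto
    moreover obtain k where "Suc k < length l" "I < l ! Suc k" "(l ! Suc k, v) \<in> T" "y (l ! k) < y v"
      using v by (auto simp: right_sibs_def)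
    ultimately show "v \<in> right_sibs n I T y (c # l)" using v
      by (auto simp: right_sibs_def intro!: exI[of _ "Suc k"])
  qed
  have sub2: "?K - {c} \<subseteq> right_sibs n I T y (c # l)"
  proof
    fix v assume v: "v \<in> ?K - {c}"
    then have "y c \<noteq> y v" using inj_onD[OF y_inj, of c v] T_in c by blast
    then have "y c < y v" using c_min v by force
    moreover have "v \<notin> set l" using new v l(4) by blast
    ultimately show "v \<in> right_sibs n I T y (c # l)" using v w l0 T_in[of "W ! j" v]
      by (auto simp: right_sibs_def intro!: exI[of _ 0])
  qed
  have "card (right_sibs n I T y l) + card (?K - {c}) \<le> card (right_sibs n I T y (c # l))"
    using card_mono[OF fin, of "right_sibs n I T y l \<union> (?K - {c})" "c # l"] sub1 sub2
      card_Un_disjoint[OF fin _ disj] finK by simp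
  moreover have "card ?K \<le> Suc (card (?K - {c}))"
    by (cases "c \<in> ?K") (use card_Suc_Diff1[OF finK, of c] in auto)
  ultimately have "real (card (right_sibs n I T y l)) + real (card ?K) \<le> card (right_sibs n I T y (c # l)) + 1"
    by linarith
  then show ?thesis using bal bal' by (simp add: sa abs_le_iff field_simps)
qed

text \<open>\<open>Z\<close> is the set of waiting hubs: each contributes its own weight to the
  excursion, while r_i has already started and takes away its children. The coefficient
  \<open>b\<close> vanishes when the current vertex is a child of a hub, for then its unexplored
  part is removed too.\<close>

lemma G_proc_eq:
  assumes u: "in_step j u" and l: "spine T r l" "hd l = W ! j" "set l \<subseteq> set (take (Suc j) W)"
  obtains Z b where "Z \<subseteq> {1..I}" "0 \<le> b" "b \<le> 1" "W ! j \<le> I \<Longrightarrow> b = 1"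
    "G_proc I n p x u =
      s * card (right_sibs n I T y l) + b * (e W (Suc j) - u)
      + (\<Sum>i\<in>Z. p i - sum p {v. (i, v) \<in> T})
      + s * card {v. I < v \<and> (W ! j, v) \<in> T \<and> y v \<le> u}
      - of_bool (W ! j \<le> I) * sum p {v. (W ! j, v) \<in> T}"
proof -
  note U = in_step_D[OF u]
  define A where "A = set (take j W)"
  define ws where "ws = set (take (Suc j) W)"
  define D where "D = {v \<in> {1..n} - ws. y v \<le> u}"
  define B where "B i = {v. (i, v) \<in> T}" for i
  define \<kappa> where "\<kappa> = e W (Suc j) - u"
  let ?w = "W ! j"
  have ws: "ws = insert ?w A" using U(1) W_length by (auto simp: ws_def A_def take_Suc_conv_app_nth)
  have wA: "?w \<notin> A" using WD(3) U(1) W_length by (auto simp: A_def in_set_conv_nth nth_eq_iff_index_eq)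
  have ws_sub: "ws \<subseteq> {1..n}" using set_take_subset W_set unfolding ws_def by metis
  have A_nth: "\<exists>k<j. a = W ! k" if "a \<in> A" for a
    using that in_take_W_nth[of a j] U(1) unfolding A_def by auto
  have ws_nth: "\<exists>k\<le>j. a = W ! k" if "a \<in> ws" for a
    using that A_nth less_imp_le unfolding ws by blast
  have rws: "r \<in> ws" using WD(2) U(1) W_length by (force simp: ws_def in_set_conv_nth)
  have finD: "finite D" by (simp add: D_def)
  have finB: "finite (B i)" for i by (simp add: B_def finite_children_T)
  have B_A: "B i \<inter> ws = {}" if "i \<notin> A" for i
  proof -
    have False if v: "v \<in> B i" "v \<in> ws" for v
    proof -
      obtain k where k: "k \<le> j" "v = W ! k" using ws_nth v by blast
      obtain k' where k': "k' < n" "i = W ! k'"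
        using v T_in[of i v] W_set W_length unfolding B_def by (metis in_set_conv_nth mem_Collect_eq)
      then have "k' < k" using T_index[of k' k] v k U(1) by (auto simp: B_def)
      then show False using \<open>i \<notin> A\<close> k k' U(1) in_take_W_iff[of k' j] by (auto simp: A_def)
    qed
    then show ?thesis by blast
  qed
  have y_A: "y i \<le> u" if i_ws: "i \<in> ws" for i
  proof -
    obtain k where "k \<le> j" "i = W ! k" using ws_nth[OF i_ws] by blast
    then show ?thesis using y_W_le[of k] e_W_mono[of k j] U(1,2) by simp
  qed
  have B_D: "B i - ws \<subseteq> D" if iA: "i \<in> A" for i
  proof
    fix v assume v: "v \<in> B i - ws"
    obtain k where k: "k < j" "i = W ! k" using A_nth[OF iA] by blast
    then have "y v < e W (Suc k)" using T_nth[of k v] v U(1) by (auto simp: B_def)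
    then have "y v \<le> u" using e_W_mono[of "Suc k" j] k U by auto
    then show "v \<in> D" using v T_in by (auto simp: D_def B_def)
  qed
  have D_cases: "(\<exists>a\<in>A. (a, v) \<in> T \<and> y v < e W j) \<or> (?w, v) \<in> T" if v: "v \<in> D" for v
  proof -
    have vn: "v \<in> {1..n}" "v \<notin> ws" "y v \<le> u" using v by (auto simp: D_def)
    then have "v \<noteq> r" using rws by blast
    then obtain a where a: "(a, v) \<in> T" using T_ex vn by blast
    then obtain k where k: "k < n" "a = W ! k" using T_in W_set W_length by (metis in_set_conv_nth)
    then have yv: "e W k < y v" "y v < e W (Suc k)" using T_nth a by auto
    have "\<not> Suc j \<le> k" using e_W_mono[of "Suc j" k] U vn yv k by auto
    then consider "k = j" | "k < j" by linarith
    then show ?thesis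
    proof cases
      case 2
      then have "a \<in> A" using k U(1) in_take_W_iff[of k j] by (auto simp: A_def)
      moreover have "y v < e W j" using e_W_mono[of "Suc k" j] 2 U(1) yv by auto
      ultimately show ?thesis using a by blast
    qed (use a k in blast)
  qed
  define R where "R = right_sibs n I T y l"
  have R: "R = {v \<in> {1..n} - ws. I < v \<and> y v < e W j \<and> (\<exists>a>I. (a, v) \<in> T)}"
    unfolding R_def ws_def by (rule right_sibs_eq[OF U(1) l])
  define K where "K = {v. I < v \<and> (?w, v) \<in> T \<and> y v \<le> u}"
  \<comment> \<open>The waiting children of hubs examined before the current vertex. Their weight
    appears in the excursion and in the r_i alike, and cancels exactly.\<close>
  define Q where "Q = (\<Union>i\<in>{1..I} \<inter> A. B i - ws)"
  have finR: "finite R" and finK: "finite K" unfolding R K_def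
    using finite_children_T[of ?w] by (auto intro: finite_subset)
  have D_split: "D = Q \<union> (R \<union> (D \<inter> {1..I} \<union> K))"
  proof (intro equalityI subsetI)
    fix v assume v: "v \<in> D"
    show "v \<in> Q \<union> (R \<union> (D \<inter> {1..I} \<union> K))"
    proof (cases "v \<le> I")
      case True
      then show ?thesis using v by (auto simp: D_def)
    next
      case False
      show ?thesis
      proof (cases "(?w, v) \<in> T")
        case True
        then show ?thesis using v \<open>\<not> v \<le> I\<close> by (auto simp: D_def K_def)
      next
        case nw: False
        then obtain a where a: "a \<in> A" "(a, v) \<in> T" "y v < e W j" using D_cases v by blast
        show ?thesis
        proof (cases "a \<le> I")
          case True
          then have "v \<in> Q" using a v T_in[OF a(2)] by (auto simp: Q_def B_def D_def)
          then show ?thesis by blast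
        next
          case aI: False
          then have "\<exists>a>I. (a, v) \<in> T" using a by (intro exI[of _ a]) simp
          then have "v \<in> R" using a v \<open>\<not> v \<le> I\<close> unfolding R D_def by auto
          then show ?thesis by blast
        qed
      qed
    qed
  next
    fix v assume "v \<in> Q \<union> (R \<union> (D \<inter> {1..I} \<union> K))"
    then consider "v \<in> Q" | "v \<in> R" | "v \<in> D" | "v \<in> K" by blast
    then show "v \<in> D"
    proof cases
      case 1
      then show ?thesis using B_D by (auto simp: Q_def)
    next
      case 2
      then show ?thesis using U(2) unfolding R D_def by auto
    next
      case 4
      then have "v \<in> B ?w" "y v \<le> u" by (auto simp: K_def B_def)
      moreover then have "v \<notin> ws" using B_A[OF wA] by blast
      ultimately show ?thesis using T_in by (auto simp: D_def B_def)
    qed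
  qed
  have RK: "R \<inter> K = {}" using T_nth[of j] U(1) unfolding R K_def by fastforce
  have hub_disj: "(D \<inter> {1..I}) \<inter> K = {}" "R \<inter> (D \<inter> {1..I}) = {}" by (auto simp: R K_def)
  have Q_disj: "Q \<inter> (R \<union> (D \<inter> {1..I} \<union> K)) = {}"
  proof -
    have False if v: "v \<in> Q" "v \<in> R \<union> (D \<inter> {1..I} \<union> K)" for v
    proof -
      obtain i where i: "i \<in> {1..I}" "i \<in> A" "(i, v) \<in> T" using v(1) by (auto simp: Q_def B_def)
      have "I < v"
      proof (rule ccontr)
        assume "\<not> I < v"
        then show False using no_hub_pair[OF i(3)] i(1) by simp
      qed
      moreover have "v \<notin> K"
      proof
        assume "v \<in> K"
        then have "i = ?w" using T_unique[OF i(3)] by (simp add: K_def)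
        then show False using i(2) wA by simp
      qed
      moreover have "v \<notin> R"
      proof
        assume "v \<in> R"
        then obtain a where a: "I < a" "(a, v) \<in> T" unfolding R by blast
        then have "i = a" using T_unique[OF i(3)] by blast
        then show False using a i(1) by simp
      qed
      ultimately show False using v(2) by auto
    qed
    then show ?thesis by blast
  qed
  have finQ: "finite Q" by (auto simp: Q_def finB)
  have "sum p D = sum p (Q \<union> (R \<union> (D \<inter> {1..I} \<union> K)))" by (rule arg_cong[OF D_split])
  also have "\<dots> = sum p Q + sum p (R \<union> (D \<inter> {1..I} \<union> K))"
    by (rule sum.union_disjoint) (use finQ finR finK Q_disj in auto)
  also have "sum p (R \<union> (D \<inter> {1..I} \<union> K)) = sum p R + sum p (D \<inter> {1..I} \<union> K)"
    by (rule sum.union_disjoint) (use finR finK RK hub_disj in auto)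
  also have "sum p (D \<inter> {1..I} \<union> K) = sum p (D \<inter> {1..I}) + sum p K"
    by (rule sum.union_disjoint) (use finK hub_disj in auto)
  finally have "sum p D = sum p Q + (sum p R + (sum p (D \<inter> {1..I}) + sum p K))" .
  moreover have "sum p Q = (\<Sum>i\<in>{1..I} \<inter> A. sum p (B i - ws))"
    unfolding Q_def by (rule sum.UNION_disjoint) (use finB T_unique in \<open>auto simp: B_def\<close>)
  moreover have "sum p R = s * card R"
    using sum.cong[OF refl, of R p "\<lambda>_. s"] small by (auto simp: R)
  moreover have "sum p K = s * card K"
  proof -
    have "sum p K = (\<Sum>v\<in>K. s)" by (rule sum.cong) (use small T_in in \<open>auto simp: K_def\<close>)
    then show ?thesis by simp
  qed
  ultimately have pD: "sum p D = (\<Sum>i\<in>{1..I} \<inter> A. sum p (B i - ws)) + s * card R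
      + sum p (D \<inter> {1..I}) + s * card K" by simp
  define f where "f i = of_bool (y i \<le> u) * sum p (B i - ws)" for i
  \<comment> \<open>A hub whose mark is at most u has been examined, is the current vertex, or is
    waiting. In the last two cases none of its children has been examined.\<close>
  have f_sum: "(\<Sum>i=1..I. f i) = (\<Sum>i\<in>{1..I} \<inter> A. sum p (B i - ws))
      + (\<Sum>i\<in>D \<inter> {1..I}. sum p (B i)) + of_bool (?w \<le> I) * sum p (B ?w)"
  proof -
    have w_pos: "1 \<le> ?w" using nth_mem[of j W] W_set U(1) W_length by simp
    have split: "{1..I} = ({1..I} \<inter> A) \<union> (({1..I} \<inter> {?w}) \<union> ({1..I} - ws))" unfolding ws by blast
    have "(\<Sum>i=1..I. f i) = sum f ({1..I} \<inter> A) + (sum f ({1..I} \<inter> {?w}) + sum f ({1..I} - ws))"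
    proof -
      have "(\<Sum>i=1..I. f i) = sum f (({1..I} \<inter> A) \<union> (({1..I} \<inter> {?w}) \<union> ({1..I} - ws)))"
        by (subst split[symmetric]) (rule refl)
      also have "\<dots> = sum f ({1..I} \<inter> A) + sum f (({1..I} \<inter> {?w}) \<union> ({1..I} - ws))"
        by (rule sum.union_disjoint) (use wA ws in auto)
      also have "sum f (({1..I} \<inter> {?w}) \<union> ({1..I} - ws)) = sum f ({1..I} \<inter> {?w}) + sum f ({1..I} - ws)"
        by (rule sum.union_disjoint) (use ws in auto)
      finally show ?thesis .
    qed
    moreover have "sum f ({1..I} \<inter> A) = (\<Sum>i\<in>{1..I} \<inter> A. sum p (B i - ws))"
      unfolding f_def by (rule sum.cong[OF refl]) (simp add: y_A ws)
    moreover have "sum f ({1..I} \<inter> {?w}) = of_bool (?w \<le> I) * sum p (B ?w)"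
    proof -
      have "B ?w - ws = B ?w" using B_A[OF wA] by (rule Diff_triv)
      moreover have "y ?w \<le> u" by (rule y_A) (simp add: ws)
      ultimately have "f ?w = sum p (B ?w)" by (simp only: f_def) simp
      then show ?thesis using w_pos by auto
    qed
    moreover have "sum f ({1..I} - ws) = (\<Sum>i\<in>D \<inter> {1..I}. sum p (B i))"
    proof -
      have "sum f (D \<inter> {1..I}) = sum f ({1..I} - ws)"
        by (rule sum.mono_neutral_left) (use I_le in \<open>auto simp: D_def f_def\<close>)
      moreover have "f i = sum p (B i)" if "i \<in> D \<inter> {1..I}" for i
      proof -
        have "i \<notin> A" "y i \<le> u" using that by (auto simp: D_def ws)
        moreover have "B i - ws = B i" using B_A[OF \<open>i \<notin> A\<close>] by (rule Diff_triv)
        ultimately show ?thesis by (simp only: f_def) simp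
      qed
      ultimately show ?thesis by simp
    qed
    ultimately show ?thesis by simp
  qed
  define m where "m = (\<Sum>i=1..I. of_bool (y i \<le> u) * of_bool ((i, ?w) \<in> T) :: real)"
  have m01: "m = 0 \<or> (m = 1 \<and> (\<exists>i\<le>I. (i, ?w) \<in> T))"
  proof (cases "\<exists>i\<in>{1..I}. y i \<le> u \<and> (i, ?w) \<in> T")
    case True
    then obtain i where i: "i \<in> {1..I}" "y i \<le> u" "(i, ?w) \<in> T" by blast
    have "m = (\<Sum>i\<in>{i}. of_bool (y i \<le> u) * of_bool ((i, ?w) \<in> T))"
      unfolding m_def by (rule sum.mono_neutral_right) (use i T_unique in auto)
    then show ?thesis using i by auto
  next
    case False
    then have "m = 0" unfolding m_def by (intro sum.neutral) auto
    then show ?thesis ..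
  qed
  have "(\<Sum>i=1..I. r_proc n p x i u) = (\<Sum>i=1..I. f i) + m * \<kappa>"
    unfolding m_def sum_distrib_right sum.distrib[symmetric]
    by (rule sum.cong) (auto simp: r_proc_eq[OF u] f_def ws_def B_def \<kappa>_def)
  moreover have "F_exc n p x u = \<kappa> + sum p D"
    using bridge_eq[OF U(1)] u by (simp add: F_exc_def shifted_eq \<kappa>_def D_def ws_def in_step_def)
  ultimately have G_eq: "G_proc I n p x u = s * card R + (1 - m) * \<kappa>
    + (\<Sum>i\<in>D \<inter> {1..I}. p i - sum p (B i)) + s * card K - of_bool (?w \<le> I) * sum p (B ?w)"
    unfolding G_proc_def pD f_sum by (simp add: sum_subtractf algebra_simps)
  show ?thesis
  proof (rule that)
    show "D \<inter> {1..I} \<subseteq> {1..I}" by blast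
    show "0 \<le> 1 - m" "1 - m \<le> 1" using m01 by auto
    show "1 - m = 1" if "?w \<le> I" using m01 no_hub_pair[of _ ?w] that by force
  qed (fact G_eq[unfolded R_def K_def B_def \<kappa>_def])
qed

text \<open>If the current vertex is a hub, its unexplored part and the mass of its children found
  so far add up to about its weight, which the removal of all its children compensates; this costs 2
  \<delta>, and the waiting hubs cost \<delta> each. If it is small, its unexplored part is at most
  \<open>s\<close> and it has at most 2 t + 3/2 small children.\<close>

lemma G_proc_close:
  assumes u: "in_step j u" and l: "spine T r l" "hd l = W ! j" "distinct l" "set l \<subseteq> set (take (Suc j) W)"
  shows "\<bar>G_proc I n p x u - s * card (right_sibs n I T y l)\<bar> \<le> (I + 2) * \<delta> + s * (2 * t + 3)"
proof -
  note U = in_step_D[OF u]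
  let ?w = "W ! j" and ?B = "\<lambda>i. {v. (i, v) \<in> T}"
  let ?K = "{v. I < v \<and> (?w, v) \<in> T \<and> y v \<le> u}"
  obtain Z b where Z: "Z \<subseteq> {1..I}" and b: "0 \<le> b" "b \<le> 1" "?w \<le> I \<Longrightarrow> b = 1"
    and G: "G_proc I n p x u = s * card (right_sibs n I T y l) + b * (e W (Suc j) - u)
      + (\<Sum>i\<in>Z. p i - sum p (?B i)) + s * card ?K - of_bool (?w \<le> I) * sum p (?B ?w)"
    by (rule G_proc_eq[OF u l(1,2,4)]) (rule that)
  have t0: "0 \<le> t" using balance[of "[r]"] r_in by auto
  have hub: "\<bar>sum p (?B i) - p i\<bar> \<le> \<delta>" if i: "i \<in> {1..I}" for i
  proof -
    have "i \<in> set W" using i I_le W_set by auto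
    then obtain k where "k < n" "i = W ! k" using W_length by (auto simp: in_set_conv_nth)
    then show ?thesis using hub_children_mass[of k] i by auto
  qed
  have "\<bar>\<Sum>i\<in>Z. p i - sum p (?B i)\<bar> \<le> (\<Sum>i\<in>Z. \<bar>p i - sum p (?B i)\<bar>)" by (rule sum_abs)
  also have "\<dots> \<le> (\<Sum>i\<in>{1..I}. \<bar>p i - sum p (?B i)\<bar>)" by (rule sum_mono2) (use Z in auto)
  also have "\<dots> \<le> (\<Sum>i\<in>{1..I}. \<delta>)" by (rule sum_mono) (use hub in \<open>simp add: abs_minus_commute\<close>)
  finally have sumZ: "\<bar>\<Sum>i\<in>Z. p i - sum p (?B i)\<bar> \<le> I * \<delta>" by simp
  have \<kappa>: "0 \<le> e W (Suc j) - u" "e W (Suc j) - u \<le> p ?w" using U by auto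
  show ?thesis
  proof (cases "?w \<le> I")
    case True
    have "\<bar>sum p (?B ?w) - p ?w\<bar> \<le> \<delta>" using hub_children_mass U(1) True by blast
    moreover have "\<bar>s * card {v. I < v \<and> (?w, v) \<in> T \<and> y v \<le> e W j + (u - e W j)} - (u - e W j)\<bar> \<le> \<delta>"
      by (rule window) (use U True e_W_Suc in auto)
    ultimately have "\<bar>b * (e W (Suc j) - u) + s * card ?K - sum p (?B ?w)\<bar> \<le> 2 * \<delta>"
      using b True e_W_Suc[OF U(1)] by (auto simp: abs_le_iff)
    moreover have "0 \<le> s * (2 * t + 3)" using s_pos t0 by simp
    ultimately show ?thesis using sumZ True unfolding G by (simp add: abs_le_iff algebra_simps)
  next
    case False
    have "?w \<in> {1..n}" using nth_mem[of j W] W_set U(1) W_length by metis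
    then have pw: "p ?w = s" using small False by simp
    have "0 \<le> b * (e W (Suc j) - u)" using b \<kappa> by simp
    moreover have "b * (e W (Suc j) - u) \<le> 1 * (e W (Suc j) - u)"
      by (rule mult_right_mono) (use b \<kappa> in auto)
    moreover have "card ?K \<le> 2 * t + 3 / 2"
    proof -
      have "card ?K \<le> card {v. I < v \<and> (?w, v) \<in> T}"
        by (rule card_mono) (use finite_children_T[of ?w] in \<open>auto intro: finite_subset\<close>)
      then show ?thesis using small_children_bound[OF U(1) _ l] False by linarith
    qed
    then have "s * card ?K \<le> s * (2 * t + 3 / 2)" using s_pos by (simp add: mult_left_mono)
    moreover have "0 \<le> s * card ?K" using s_pos by simp
    moreover have "I * \<delta> \<le> (I + 2) * \<delta>" using \<delta>_nonneg by (simp add: algebra_simps)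
    moreover have "\<bar>q + x1 + x2 + x3 - z - q\<bar> \<le> d + s * (2 * t + 3)"
      if "0 \<le> x1" "x1 \<le> s" "\<bar>x2\<bar> \<le> d1" "d1 \<le> d" "0 \<le> x3" "x3 \<le> s * (2 * t + 3 / 2)" "z = 0"
      for q x1 x2 x3 z d d1 :: real
    proof -
      have "s * (2 * t + 3) = s * (2 * t + 3 / 2) + s * 3 / 2" by (simp add: algebra_simps)
      then show ?thesis using that s_pos t0 by (auto simp: abs_le_iff)
    qed
    ultimately show ?thesis using \<kappa> pw sumZ False unfolding G by simp
  qed
qed

end

subsection \<open>Generic marks\<close>

text \<open>Integers are excluded because marks are shifted modulo 1. The choice S = {} excludes
  ties, and the other sets keep shifted marks off the possible values of e_j. Marks strictly inside
  the unit interval have their left limits determined inside it.\<close>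

definition generic_marks :: "nat \<Rightarrow> (nat \<Rightarrow> real) \<Rightarrow> (nat \<Rightarrow> real) \<Rightarrow> bool" where
  "generic_marks n p x \<longleftrightarrow> (\<forall>i\<in>{1..n}. 0 < x i \<and> x i < 1)
    \<and> (\<forall>i\<in>{1..n}. \<forall>j\<in>{1..n}. \<forall>S. i \<noteq> j \<longrightarrow> S \<subseteq> {1..n} \<longrightarrow> x i - x j - sum p S \<notin> \<int>)"

lemma frac_diff_less: "0 \<le> a \<Longrightarrow> a < b \<Longrightarrow> b < 1 \<Longrightarrow> frac (a - b :: real) = a - b + 1"
  by (simp add: frac_unique_iff)

section \<open>The root and the rotation of the bridge for generic marks\<close>

context
  fixes n :: nat and p x :: "nat \<Rightarrow> real"
  assumes n: "1 \<le> n" and pos: "\<And>i. i \<in> {1..n} \<Longrightarrow> 0 < p i" and sum1: "(\<Sum>i=1..n. p i) = 1"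
    and gen: "generic_marks n p x"
begin

definition bridge_left :: "nat \<Rightarrow> real" where
  "bridge_left v = - x v + (\<Sum>i | i \<in> {1..n} \<and> x i < x v. p i)"

lemma x_range: "i \<in> {1..n} \<Longrightarrow> 0 < x i" "i \<in> {1..n} \<Longrightarrow> x i < 1"
  using gen unfolding generic_marks_def by blast+

lemma x_generic: "\<lbrakk>i \<in> {1..n}; j \<in> {1..n}; i \<noteq> j; S \<subseteq> {1..n}\<rbrakk> \<Longrightarrow> x i - x j - sum p S \<notin> \<int>"
  using gen unfolding generic_marks_def by blast

lemma bridge_eq_filter: "bridge n p x u = - u + (\<Sum>i | i \<in> {1..n} \<and> x i \<le> u. p i)"
  unfolding bridge_def of_bool_def by (subst sum.inter_filter) (auto intro: sum.cong)

lemma tendsto_bridge_left: "(bridge n p x \<longlongrightarrow> bridge_left v) (at_left (x v))"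
proof -
  have "eventually (\<lambda>u. (\<Sum>i=1..n. p i * of_bool (x i \<le> u)) = (\<Sum>i=1..n. p i * of_bool (x i < x v))) (at_left (x v))"
  proof -
    have "eventually (\<lambda>u. \<forall>i\<in>{1..n}. (x i \<le> u) = (x i < x v)) (at_left (x v))"
    proof (intro eventually_ball_finite ballI)
      fix i
      show "eventually (\<lambda>u. (x i \<le> u) = (x i < x v)) (at_left (x v))"
      proof (cases "x i < x v")
        case True
        then have "eventually (\<lambda>u. x i < u) (at_left (x v))"
          by (intro order_tendstoD(1)[OF tendsto_ident_at])
        then show ?thesis using True by (auto elim!: eventually_mono)
      next
        case False
        have "eventually (\<lambda>u. u < x v) (at_left (x v))" by (simp add: eventually_at_filter)
        then show ?thesis using False by (auto elim!: eventually_mono)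
      qed
    qed simp
    then show ?thesis by (rule eventually_mono) (auto intro!: sum.cong)
  qed
  then have "((\<lambda>u. \<Sum>i=1..n. p i * of_bool (x i \<le> u)) \<longlongrightarrow> (\<Sum>i=1..n. p i * of_bool (x i < x v))) (at_left (x v))"
    by (rule tendsto_eventually)
  then have "((\<lambda>u. - u + (\<Sum>i=1..n. p i * of_bool (x i \<le> u))) \<longlongrightarrow>
      - x v + (\<Sum>i=1..n. p i * of_bool (x i < x v))) (at_left (x v))"
    by (intro tendsto_add tendsto_minus tendsto_ident_at)
  moreover have "(\<Sum>i=1..n. p i * of_bool (x i < x v)) = (\<Sum>i | i \<in> {1..n} \<and> x i < x v. p i)"
    unfolding of_bool_def by (subst sum.inter_filter) (auto intro: sum.cong)
  ultimately show ?thesis by (simp add: bridge_def[abs_def] bridge_left_def)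
qed

lemma Lim_bridge: "Lim (at_left (x v)) (bridge n p x) = bridge_left v"
  by (rule tendsto_Lim[OF trivial_limit_at_left_real tendsto_bridge_left])

lemma bridge_left_less_diff:
  assumes "x v \<le> x w"
  shows "(\<Sum>i | i \<in> {1..n} \<and> x v \<le> x i \<and> x i < x w. p i) = bridge_left w + x w - bridge_left v - x v"
proof -
  have eq: "{i. i \<in> {1..n} \<and> x i < x w} =
      {i. i \<in> {1..n} \<and> x i < x v} \<union> {i. i \<in> {1..n} \<and> x v \<le> x i \<and> x i < x w}"
    using assms by auto
  have "(\<Sum>i | i \<in> {1..n} \<and> x i < x w. p i) = (\<Sum>i | i \<in> {1..n} \<and> x i < x v. p i)
      + (\<Sum>i | i \<in> {1..n} \<and> x v \<le> x i \<and> x i < x w. p i)"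
    unfolding eq by (rule sum.union_disjoint) auto
  then show ?thesis by (simp add: bridge_left_def)
qed

lemma bridge_left_inj:
  assumes "v \<in> {1..n}" "w \<in> {1..n}" "v \<noteq> w"
  shows "bridge_left v \<noteq> bridge_left w"
proof -
  have aux: "bridge_left v \<noteq> bridge_left w" if "v \<in> {1..n}" "w \<in> {1..n}" "v \<noteq> w" "x v \<le> x w" for v w
  proof
    assume "bridge_left v = bridge_left w"
    then have "x w - x v - sum p {i. i \<in> {1..n} \<and> x v \<le> x i \<and> x i < x w} = 0"
      using bridge_left_less_diff[OF that(4)] by simp
    moreover have "x w - x v - sum p {i. i \<in> {1..n} \<and> x v \<le> x i \<and> x i < x w} \<notin> \<int>"
      using that by (intro x_generic) auto
    ultimately show False by simp
  qed
  show ?thesis using aux[of v w] aux[of w v] assms by (cases "x v \<le> x w") auto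
qed

definition min_vertex :: nat where "min_vertex = arg_min_on bridge_left {1..n}"

lemma min_vertex: "min_vertex \<in> {1..n}" "v \<in> {1..n} \<Longrightarrow> bridge_left min_vertex \<le> bridge_left v"
  using arg_min_if_finite(1)[of "{1..n}" bridge_left] arg_min_least[of "{1..n}" v bridge_left] n
  by (auto simp: min_vertex_def)

lemma min_vertex_less: "v \<in> {1..n} \<Longrightarrow> v \<noteq> min_vertex \<Longrightarrow> bridge_left min_vertex < bridge_left v"
  using min_vertex bridge_left_inj[of v min_vertex] by force

text \<open>Between marks the bridge decreases, so its value is at least the left limit at the next
  mark. Beyond the last mark it is 1 - u, which is nonnegative, whereas the left limit at the first
  mark is negative.\<close>

lemma bridge_ge:
  assumes u: "u \<le> 1"
  shows "bridge_left min_vertex \<le> bridge n p x u"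
proof (cases "\<exists>v\<in>{1..n}. u < x v")
  case True
  let ?V = "{v\<in>{1..n}. u < x v}"
  have ne: "?V \<noteq> {}" "finite ?V" using True by auto
  define v where "v = arg_min_on x ?V"
  have v: "v \<in> ?V" unfolding v_def by (rule arg_min_if_finite(1)) (use ne in auto)
  have least: "x v \<le> x i" if "i \<in> ?V" for i
    unfolding v_def by (rule arg_min_least) (use ne that in auto)
  have "{i. i \<in> {1..n} \<and> x i \<le> u} = {i. i \<in> {1..n} \<and> x i < x v}"
    using v least by (auto simp: not_less[symmetric])
  then have "bridge_left v \<le> bridge n p x u" using v by (simp add: bridge_left_def bridge_eq_filter)
  then show ?thesis using min_vertex(2)[of v] v by simp
next
  case False
  then have all: "{i. i \<in> {1..n} \<and> x i \<le> u} = {1..n}" by (auto simp: not_less)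
  have ge: "0 \<le> bridge n p x u" unfolding bridge_eq_filter all using sum1 u by simp
  define v where "v = arg_min_on x {1..n}"
  have v: "v \<in> {1..n}" unfolding v_def by (rule arg_min_if_finite(1)) (use n in auto)
  have least: "x v \<le> x i" if "i \<in> {1..n}" for i
    unfolding v_def by (rule arg_min_least) (use that in auto)
  have none: "{i. i \<in> {1..n} \<and> x i < x v} = {}" using least by (auto simp: not_less)
  have "bridge_left v = - x v" unfolding bridge_left_def none by simp
  then have "bridge_left min_vertex \<le> 0" using min_vertex(2)[OF v] x_range(1)[OF v] by simp
  then show ?thesis using ge by simp
qed

lemma INF_bridge: "(INF u\<in>{0..1}. bridge n p x u) = bridge_left min_vertex"
proof (rule antisym)
  have bdd: "bdd_below (bridge n p x ` {0..1})" using bridge_ge by (intro bdd_belowI2) auto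
  have "eventually (\<lambda>u. 0 < u) (at_left (x min_vertex))"
    using x_range min_vertex by (intro order_tendstoD(1)[OF tendsto_ident_at])
  moreover have "eventually (\<lambda>u. u < x min_vertex) (at_left (x min_vertex))"
    by (simp add: eventually_at_filter)
  ultimately have "eventually (\<lambda>u. (INF u\<in>{0..1}. bridge n p x u) \<le> bridge n p x u) (at_left (x min_vertex))"
  proof eventually_elim
    case (elim u)
    then show ?case using x_range(2)[OF min_vertex(1)] by (intro cINF_lower[OF bdd]) auto
  qed
  then show "(INF u\<in>{0..1}. bridge n p x u) \<le> bridge_left min_vertex"
    by (rule tendsto_lowerbound[OF tendsto_bridge_left]) simp
  show "bridge_left min_vertex \<le> (INF u\<in>{0..1}. bridge n p x u)"
    by (rule cINF_greatest) (use bridge_ge in auto)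
qed

lemma root_vertex_eq: "root_vertex n p x = min_vertex"
  unfolding root_vertex_def Lim_bridge INF_bridge
  using min_vertex(1) bridge_left_inj[of _ min_vertex] by (intro the_equality) auto

lemma shifted_eq: "shifted n p x i = frac (x i - x min_vertex)"
  by (simp add: shifted_def root_vertex_eq)

lemma shifted_ge: "i \<in> {1..n} \<Longrightarrow> x min_vertex \<le> x i \<Longrightarrow> shifted n p x i = x i - x min_vertex"
  using x_range(1)[OF min_vertex(1)] x_range(2)[of i] by (simp add: shifted_eq frac_eq)

lemma shifted_less: "i \<in> {1..n} \<Longrightarrow> x i < x min_vertex \<Longrightarrow> shifted n p x i = x i - x min_vertex + 1"
  using x_range(2)[OF min_vertex(1)] x_range(1)[of i] by (simp add: shifted_eq frac_diff_less)

text \<open>The Vervaat transform: rotating the bridge at its unique lowest left limit makes the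
  left limits at all other marks positive. If the arc from the root to \<open>v\<close> wraps around
  1, the weight in it is found from the complementary arc, the total weight being 1.\<close>

lemma shifted_excursion:
  assumes v: "v \<in> {1..n}" "v \<noteq> min_vertex"
  shows "shifted n p x v < (\<Sum>i | i \<in> {1..n} \<and> shifted n p x i < shifted n p x v. p i)"
proof -
  let ?r = "min_vertex"
  note less = min_vertex_less[OF v]
  have cases: "shifted n p x i = (if x ?r \<le> x i then x i - x ?r else x i - x ?r + 1)" if "i \<in> {1..n}" for i
    using shifted_ge shifted_less that by auto
  show ?thesis
  proof (cases "x ?r \<le> x v")
    case True
    have "(i \<in> {1..n} \<and> shifted n p x i < shifted n p x v) \<longleftrightarrow> (i \<in> {1..n} \<and> x ?r \<le> x i \<and> x i < x v)" for i
      using cases[of i] cases[OF v(1)] True x_range(1)[of i] x_range(2)[OF v(1)] by (auto split: if_splits)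
    then have "{i. i \<in> {1..n} \<and> shifted n p x i < shifted n p x v} = {i. i \<in> {1..n} \<and> x ?r \<le> x i \<and> x i < x v}"
      by simp
    then have "(\<Sum>i | i \<in> {1..n} \<and> shifted n p x i < shifted n p x v. p i)
        = bridge_left v + x v - bridge_left ?r - x ?r"
      using bridge_left_less_diff[OF True] by simp
    then show ?thesis using less cases[OF v(1)] True by simp
  next
    case False
    have "(i \<in> {1..n} \<and> shifted n p x i < shifted n p x v) \<longleftrightarrow> (i \<in> {1..n} \<and> \<not> (x v \<le> x i \<and> x i < x ?r))" for i
      using cases[of i] cases[OF v(1)] False x_range(1)[OF v(1)] x_range(2)[of i] by (auto split: if_splits)
    then have eq: "{i. i \<in> {1..n} \<and> shifted n p x i < shifted n p x v} = {1..n} - {i. i \<in> {1..n} \<and> x v \<le> x i \<and> x i < x ?r}"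
      by blast
    have "(\<Sum>i | i \<in> {1..n} \<and> shifted n p x i < shifted n p x v. p i)
        = sum p {1..n} - (\<Sum>i | i \<in> {1..n} \<and> x v \<le> x i \<and> x i < x ?r. p i)"
      unfolding eq by (rule sum_diff) auto
    also have "\<dots> = 1 - (bridge_left ?r + x ?r - bridge_left v - x v)"
      using bridge_left_less_diff[of v ?r] False sum1 by simp
    finally show ?thesis using less cases[OF v(1)] False by simp
  qed
qed

lemma marks_shifted: "marks n p (shifted n p x) (root_vertex n p x)"
proof unfold_locales
  show "0 < p i" if "i \<in> {1..n}" for i by (rule pos) fact
  show "(\<Sum>i=1..n. p i) = 1" by (rule sum1)
  show "root_vertex n p x \<in> {1..n}" by (simp only: root_vertex_eq min_vertex(1))
  show "shifted n p x (root_vertex n p x) = 0" by (simp add: shifted_def)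
  show "0 \<le> shifted n p x v" "shifted n p x v < 1" for v by (simp_all add: shifted_def frac_lt_1)
  show "inj_on (shifted n p x) {1..n}"
  proof (rule inj_onI, rule ccontr)
    fix i j assume ij: "i \<in> {1..n}" "j \<in> {1..n}" "shifted n p x i = shifted n p x j" "i \<noteq> j"
    then have "x i - x j = of_int (\<lfloor>x i - x min_vertex\<rfloor> - \<lfloor>x j - x min_vertex\<rfloor>)"
      by (simp add: shifted_eq frac_def)
    then have "x i - x j \<in> \<int>" using Ints_of_int by (rule ssubst)
    then have "x i - x j - sum p {} \<in> \<int>" by simp
    then show False using x_generic[OF ij(1,2,4), of "{}"] by blast
  qed
  show "shifted n p x v \<noteq> sum p S" if "v \<in> {1..n}" "v \<noteq> root_vertex n p x" "S \<subseteq> {1..n}" for v S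
  proof
    assume "shifted n p x v = sum p S"
    then have "x v - x min_vertex - sum p S = of_int \<lfloor>x v - x min_vertex\<rfloor>"
      by (simp add: shifted_eq frac_def)
    then have "x v - x min_vertex - sum p S \<in> \<int>" using Ints_of_int by (rule ssubst)
    then show False using x_generic[of v min_vertex S] that min_vertex(1) by (simp add: root_vertex_eq)
  qed
  show "shifted n p x v < (\<Sum>i | i \<in> {1..n} \<and> shifted n p x i < shifted n p x v. p i)"
    if "v \<in> {1..n}" "v \<noteq> root_vertex n p x" for v
    using shifted_excursion[of v] that by (simp add: root_vertex_eq)
qed

end

subsection \<open>Uniform marks and the slot coordinates\<close>

definition unif :: "real measure" where "unif = uniform_measure lborel {0..<1}"

definition unif_prod :: "nat set \<Rightarrow> (nat \<Rightarrow> real) measure" where "unif_prod V = (\<Pi>\<^sub>M i\<in>V. unif)"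

lemma uniform_marks_eq: "uniform_marks n = unif_prod {1..n}"
  by (simp add: uniform_marks_def unif_prod_def unif_def)

lemma sets_unif [simp, measurable_cong]: "sets unif = sets borel"
  by (simp add: unif_def)

lemma space_unif [simp]: "space unif = UNIV"
  by (simp add: unif_def)

lemma prob_space_unif: "prob_space unif"
  unfolding unif_def by (rule prob_space_uniform_measure) auto

interpretation unif: prob_space unif by (rule prob_space_unif)

interpretation unif_prod: product_prob_space "\<lambda>_. unif" V for V
  by unfold_locales

lemma sets_unif_prod [measurable_cong]: "sets (unif_prod V) = sets (\<Pi>\<^sub>M i\<in>V. borel)"
  unfolding unif_prod_def by (rule sets_PiM_cong) simp_all

lemma space_unif_prod: "space (unif_prod V) = (\<Pi>\<^sub>E i\<in>V. UNIV)"
  by (simp add: unif_prod_def space_PiM)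

lemma measurable_unif_prod_component:
  "i \<in> V \<Longrightarrow> (\<lambda>x. x i) \<in> borel_measurable (unif_prod V)"
  using measurable_component_singleton[of i V "\<lambda>_. unif"] by (simp add: unif_prod_def)

lemma emeasure_unif: "A \<in> sets borel \<Longrightarrow> emeasure unif A = emeasure lborel ({0..<1} \<inter> A)"
  unfolding unif_def by (subst emeasure_uniform_measure) (auto simp: divide_ennreal_def)

lemma emeasure_unif_interval:
  "0 \<le> a \<Longrightarrow> a \<le> b \<Longrightarrow> b \<le> 1 \<Longrightarrow> emeasure unif {a<..<b} = ennreal (b - a)"
proof -
  assume "0 \<le> a" "a \<le> b" "b \<le> 1"
  then have "{0..<1} \<inter> {a<..<b} = {a<..<b}" by auto
  then show ?thesis using \<open>a \<le> b\<close> by (simp add: emeasure_unif)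
qed

lemma nn_integral_unif:
  "f \<in> borel_measurable borel \<Longrightarrow> (\<integral>\<^sup>+u. f u \<partial>unif) = (\<integral>\<^sup>+u. f u * indicator {0..<1} u \<partial>lborel)"
  unfolding unif_def by (subst nn_integral_uniform_measure) (auto simp: divide_ennreal_def)

lemma AE_unif: "AE u in unif. 0 \<le> u \<and> u < 1"
  unfolding unif_def by (rule AE_uniform_measureI) auto

lemma emeasure_unif_countable: "countable A \<Longrightarrow> emeasure unif A = 0"
proof -
  assume "countable A"
  then have "A \<in> null_sets lborel" by (rule countable_imp_null_set_lborel)
  then have "emeasure lborel ({0..<1} \<inter> A) = 0" "A \<in> sets borel"
    by (auto intro: emeasure_eq_0 simp: null_sets_def)
  then show ?thesis by (simp add: emeasure_unif)
qed

text \<open>An interval exchange preserves Lebesgue measure, since it translates each piece.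
  Rotation of the circle and the passage to the slots are both instances.\<close>

lemma distr_unif_exchange:
  fixes a b l :: "'k \<Rightarrow> real"
  assumes K: "finite K"
    and a: "disjoint_family_on (\<lambda>k. {a k..<a k + l k}) K" "(\<Union>k\<in>K. {a k..<a k + l k}) = {0..<1}"
    and b: "disjoint_family_on (\<lambda>k. {b k..<b k + l k}) K" "(\<Union>k\<in>K. {b k..<b k + l k}) = {0..<1}"
    and f [measurable]: "f \<in> borel_measurable borel"
    and eq: "\<And>k u. k \<in> K \<Longrightarrow> a k \<le> u \<Longrightarrow> u < a k + l k \<Longrightarrow> f u = b k + (u - a k)"
  shows "distr unif unif f = unif"
proof (rule measure_eqI)
  fix A assume "A \<in> sets (distr unif unif f)"
  then have A [measurable]: "A \<in> sets borel" by simp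
  have split: "emeasure lborel ({0..<1} \<inter> X) = (\<Sum>k\<in>K. emeasure lborel ({c k..<c k + l k} \<inter> X))"
    if "disjoint_family_on (\<lambda>k. {c k..<c k + l k}) K" "(\<Union>k\<in>K. {c k..<c k + l k}) = {0..<1}"
      "X \<in> sets borel" for c X
  proof -
    have "{0..<1} \<inter> X = (\<Union>k\<in>K. {c k..<c k + l k} \<inter> X)" using that(2) by blast
    moreover have "disjoint_family_on (\<lambda>k. {c k..<c k + l k} \<inter> X) K"
      using that(1) unfolding disjoint_family_on_def by blast
    ultimately show ?thesis
      using K that(3) by (simp add: image_subset_iff sum_emeasure)
  qed
  have pre [measurable]: "f -` A \<in> sets borel" using measurable_sets[OF f A] by simp
  have "emeasure (distr unif unif f) A = emeasure unif (f -` A)"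
    by (subst emeasure_distr) auto
  also have "\<dots> = (\<Sum>k\<in>K. emeasure lborel ({a k..<a k + l k} \<inter> f -` A))"
    by (simp add: emeasure_unif split[OF a])
  also have "\<dots> = (\<Sum>k\<in>K. emeasure lborel ({b k..<b k + l k} \<inter> A))"
  proof (rule sum.cong[OF refl])
    fix k assume k: "k \<in> K"
    have "{a k..<a k + l k} \<inter> f -` A = (+) (b k - a k) -` ({b k..<b k + l k} \<inter> A) \<inter> space lborel"
    proof (intro set_eqI)
      fix u
      show "u \<in> {a k..<a k + l k} \<inter> f -` A \<longleftrightarrow> u \<in> (+) (b k - a k) -` ({b k..<b k + l k} \<inter> A) \<inter> space lborel"
      proof (cases "a k \<le> u \<and> u < a k + l k")
        case True
        then have "f u = b k - a k + u" using eq[OF k, of u] by simp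
        then show ?thesis using True by auto
      qed auto
    qed
    then have "emeasure lborel ({a k..<a k + l k} \<inter> f -` A)
        = emeasure (distr lborel borel ((+) (b k - a k))) ({b k..<b k + l k} \<inter> A)"
      by (subst emeasure_distr) auto
    then show "emeasure lborel ({a k..<a k + l k} \<inter> f -` A) = emeasure lborel ({b k..<b k + l k} \<inter> A)"
      by (simp only: lborel_distr_plus)
  qed
  also have "\<dots> = emeasure unif A" by (simp add: emeasure_unif split[OF b])
  finally show "emeasure (distr unif unif f) A = emeasure unif A" .
qed simp

lemma distr_unif_frac:
  assumes "0 \<le> t" "t < 1"
  shows "distr unif unif (\<lambda>u. frac (u - t)) = unif"
proof -
  let ?a = "\<lambda>k::bool. if k then t else 0" and ?b = "\<lambda>k::bool. if k then 0 else 1 - t"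
    and ?l = "\<lambda>k::bool. if k then 1 - t else t"
  show ?thesis
  proof (rule distr_unif_exchange[of UNIV ?a ?l ?b])
    show "disjoint_family_on (\<lambda>k. {?a k..<?a k + ?l k}) UNIV" "disjoint_family_on (\<lambda>k. {?b k..<?b k + ?l k}) UNIV"
      by (auto simp: disjoint_family_on_def split: if_splits)
    show "(\<Union>k\<in>UNIV. {?a k..<?a k + ?l k}) = {0..<1}" "(\<Union>k\<in>UNIV. {?b k..<?b k + ?l k}) = {0..<1}"
      using assms by (auto simp: UNIV_bool)
    show "(\<lambda>u. frac (u - t)) \<in> borel_measurable borel" unfolding frac_def by measurable
    show "frac (u - t) = ?b k + (u - ?a k)" if "?a k \<le> u" "u < ?a k + ?l k" for k u
      using that assms by (cases k) (simp_all add: frac_eq frac_diff_less)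
  qed simp
qed

text \<open>The slots \<open>(c\<^sub>w, c\<^sub>w + p\<^sub>w)\<close> lie next to each other in the order of the labels. Sending a mark
  in the interval of its parent \<open>w\<close> to the slot of \<open>w\<close>, with the same offset, makes the parents
  readable from the marks without knowing the depth-first order.\<close>

definition slot_start :: "(nat \<Rightarrow> real) \<Rightarrow> nat \<Rightarrow> real" where
  "slot_start p w = e_list p [1..<w] (w - 1)"

definition slot :: "(nat \<Rightarrow> real) \<Rightarrow> nat \<Rightarrow> real set" where
  "slot p w = {slot_start p w<..<slot_start p w + p w}"

text \<open>The pieces are half-open so that they tile [0,1) and the map is an interval exchange on
  all of it. \<open>slot\<close> is open, like the intervals that define children.\<close>

definition to_slots :: "(nat \<Rightarrow> real) \<Rightarrow> nat list \<Rightarrow> real \<Rightarrow> real" where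
  "to_slots p ws u = (\<Sum>k<length ws. of_bool (e_list p ws k \<le> u \<and> u < e_list p ws (Suc k))
     * (slot_start p (ws ! k) + (u - e_list p ws k)))"

lemma to_slots_measurable [measurable]: "to_slots p ws \<in> borel_measurable borel"
  unfolding to_slots_def[abs_def] of_bool_def by measurable

lemma slot_start_eq: "w \<in> {1..n} \<Longrightarrow> slot_start p w = e_list p [1..<Suc n] (w - 1)"
  by (simp add: slot_start_def e_list_def)

section \<open>The slots as a tiling of the unit interval\<close>

context
  fixes n :: nat and p :: "nat \<Rightarrow> real"
  assumes pos: "\<And>i. i \<in> {1..n} \<Longrightarrow> 0 < p i" and sum1: "(\<Sum>i=1..n. p i) = 1"
begin

lemma e_list_mono:
  assumes "set ws \<subseteq> {1..n}" "k \<le> k'" "k' \<le> length ws"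
  shows "e_list p ws k \<le> e_list p ws k'"
  using assms(2,3)
proof (induction k' rule: dec_induct)
  case (step m)
  then have "ws ! m \<in> {1..n}" using assms(1) nth_mem[of m ws] by (blast intro: Suc_le_lessD le_trans)
  then show ?case using step pos[of "ws ! m"] by (simp add: e_list_Suc)
qed simp

lemma e_list_partition:
  assumes ws: "distinct ws" "set ws = {1..n}"
  shows "disjoint_family_on (\<lambda>k. {e_list p ws k..<e_list p ws k + p (ws ! k)}) {..<length ws}"
    and "(\<Union>k<length ws. {e_list p ws k..<e_list p ws k + p (ws ! k)}) = {0..<1}"
proof -
  have sub: "set ws \<subseteq> {1..n}" using ws by simp
  have Suc: "e_list p ws k + p (ws ! k) = e_list p ws (Suc k)" if "k < length ws" for k
    using that by (simp add: e_list_Suc)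
  have top: "e_list p ws (length ws) = 1" using ws sum1 by (simp add: e_list_length)
  show "disjoint_family_on (\<lambda>k. {e_list p ws k..<e_list p ws k + p (ws ! k)}) {..<length ws}"
  proof -
    have "{e_list p ws k..<e_list p ws (Suc k)} \<inter> {e_list p ws k'..<e_list p ws (Suc k')} = {}"
      if "k < k'" "k' < length ws" for k k'
      using e_list_mono[OF sub, of "Suc k" k'] that by auto
    then show ?thesis unfolding disjoint_family_on_def
      by (metis Int_commute Suc lessThan_iff nat_neq_iff)
  qed
  show "(\<Union>k<length ws. {e_list p ws k..<e_list p ws k + p (ws ! k)}) = {0..<1}" (is "?L = _")
  proof (intro equalityI subsetI)
    fix u assume "u \<in> ?L"
    then obtain k where k: "k < length ws" "e_list p ws k \<le> u" "u < e_list p ws (Suc k)"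
      using Suc by auto
    then show "u \<in> {0..<1}"
      using e_list_mono[OF sub, of 0 k] e_list_mono[OF sub, of "Suc k" "length ws"] top by auto
  next
    fix u :: real assume u: "u \<in> {0..<1}"
    define k where "k = (LEAST k. u < e_list p ws k)"
    have ex: "u < e_list p ws (length ws)" using u top by simp
    then have k: "u < e_list p ws k" unfolding k_def by (rule LeastI)
    have le: "k \<le> length ws" unfolding k_def using ex by (rule Least_le)
    have "k \<noteq> 0" using k u by (cases k) auto
    then obtain j where j: "k = Suc j" by (cases k) auto
    have "\<not> u < e_list p ws j" using not_less_Least[of j "\<lambda>k. u < e_list p ws k"] j by (simp add: k_def)
    then have "j < length ws" "e_list p ws j \<le> u" "u < e_list p ws j + p (ws ! j)"
      using k j le Suc[of j] by auto
    then show "u \<in> ?L" by auto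
  qed
qed

lemma to_slots_eq:
  assumes ws: "distinct ws" "set ws = {1..n}" and k: "k < length ws"
    and u: "e_list p ws k \<le> u" "u < e_list p ws (Suc k)"
  shows "to_slots p ws u = slot_start p (ws ! k) + (u - e_list p ws k)"
proof -
  have "to_slots p ws u = (\<Sum>i\<in>{k}. of_bool (e_list p ws i \<le> u \<and> u < e_list p ws (Suc i))
     * (slot_start p (ws ! i) + (u - e_list p ws i)))"
    unfolding to_slots_def
  proof (rule sum.mono_neutral_right)
    show "\<forall>i\<in>{..<length ws} - {k}. of_bool (e_list p ws i \<le> u \<and> u < e_list p ws (Suc i))
       * (slot_start p (ws ! i) + (u - e_list p ws i)) = 0"
    proof
      fix i assume i: "i \<in> {..<length ws} - {k}"
      have "\<not> (e_list p ws i \<le> u \<and> u < e_list p ws (Suc i))"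
        using e_list_mono[of ws "Suc i" k] e_list_mono[of ws "Suc k" i] i k u ws(2)
        by (cases "i < k") auto
      then show "of_bool (e_list p ws i \<le> u \<and> u < e_list p ws (Suc i))
        * (slot_start p (ws ! i) + (u - e_list p ws i)) = 0" by auto
    qed
  qed (use k in auto)
  then show ?thesis using u by simp
qed

lemma slot_partition:
  shows "disjoint_family_on (\<lambda>w. {slot_start p w..<slot_start p w + p w}) {1..n}"
    and "(\<Union>w\<in>{1..n}. {slot_start p w..<slot_start p w + p w}) = {0..<1}"
proof -
  define us where "us = [1..<Suc n]"
  define f where "f k = {e_list p us k..<e_list p us k + p (us ! k)}" for k
  define g where "g w = {slot_start p w..<slot_start p w + p w}" for w
  have us: "distinct us" "set us = {1..n}" "length us = n" by (auto simp: us_def simp del: upt_Suc)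
  have part: "disjoint_family_on f {..<n}" "(\<Union>k<n. f k) = {0..<1}"
    using e_list_partition[OF us(1,2)] unfolding us(3) f_def .
  have fg: "f k = g (Suc k)" if "k < n" for k
    using that slot_start_eq[of "Suc k" n p] by (simp add: f_def g_def us_def del: upt_Suc)
  have img: "{1..n} = Suc ` {..<n}" using image_Suc_lessThan by simp
  have "disjoint_family_on g {1..n}"
    unfolding img disjoint_family_on_def
  proof (intro ballI impI)
    fix w w' assume "w \<in> Suc ` {..<n}" "w' \<in> Suc ` {..<n}" "w \<noteq> w'"
    then obtain k k' where k: "w = Suc k" "w' = Suc k'" "k < n" "k' < n" "k \<noteq> k'" by auto
    then have "f k \<inter> f k' = {}" using part(1) unfolding disjoint_family_on_def by blast
    then show "g w \<inter> g w' = {}" using fg k by simp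
  qed
  then show "disjoint_family_on (\<lambda>w. {slot_start p w..<slot_start p w + p w}) {1..n}"
    unfolding g_def .
  have "(\<Union>w\<in>{1..n}. g w) = (\<Union>k<n. g (Suc k))" unfolding img by simp
  also have "\<dots> = (\<Union>k<n. f k)" using fg by simp
  finally show "(\<Union>w\<in>{1..n}. {slot_start p w..<slot_start p w + p w}) = {0..<1}"
    using part(2) unfolding g_def by simp
qed

lemma slot_bounds:
  assumes "w \<in> {1..n}"
  shows "0 \<le> slot_start p w" "slot_start p w + p w \<le> 1"
proof -
  have "slot_start p w \<in> {slot_start p w..<slot_start p w + p w}" using pos[OF assms] by simp
  then have "slot_start p w \<in> {0..<1}" using slot_partition(2) assms by blast
  then show "0 \<le> slot_start p w" by simp
  have w: "w = Suc (w - 1)" "w - 1 < n" using assms by auto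
  have "slot_start p w + p w = e_list p [1..<Suc n] (Suc (w - 1))"
    using w slot_start_eq[OF assms, of p] by (subst e_list_Suc) (auto simp del: upt_Suc)
  also have "\<dots> \<le> e_list p [1..<Suc n] n"
    by (rule e_list_mono) (use w in \<open>auto simp del: upt_Suc\<close>)
  also have "\<dots> = 1" using e_list_length[of "[1..<Suc n]" p] sum1 by (simp add: atLeastLessThanSuc_atLeastAtMost del: upt_Suc)
  finally show "slot_start p w + p w \<le> 1" .
qed

lemma slot_unique:
  assumes "w \<in> {1..n}" "w' \<in> {1..n}" "u \<in> slot p w" "u \<in> slot p w'"
  shows "w = w'"
proof (rule ccontr)
  assume "w \<noteq> w'"
  then have "{slot_start p w..<slot_start p w + p w} \<inter> {slot_start p w'..<slot_start p w' + p w'} = {}"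
    using slot_partition(1) assms(1,2) unfolding disjoint_family_on_def by blast
  then show False using assms(3,4) by (auto simp: slot_def)
qed

lemma emeasure_unif_slot: "w \<in> {1..n} \<Longrightarrow> emeasure unif (slot p w) = ennreal (p w)"
  using slot_bounds[of w] pos[of w] unfolding slot_def by (subst emeasure_unif_interval) auto

lemma distr_unif_to_slots:
  assumes ws: "distinct ws" "set ws = {1..n}"
  shows "distr unif unif (to_slots p ws) = unif"
proof (rule distr_unif_exchange[OF finite_lessThan e_list_partition[OF ws]])
  have bij: "bij_betw (\<lambda>k. ws ! k) {..<length ws} {1..n}"
    using bij_betw_nth[OF ws(1), of "{..<length ws}" "set ws"] ws(2) by simp
  show "disjoint_family_on (\<lambda>k. {slot_start p (ws ! k)..<slot_start p (ws ! k) + p (ws ! k)}) {..<length ws}"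
    unfolding disjoint_family_on_def
  proof (intro ballI impI)
    fix k k' assume k: "k \<in> {..<length ws}" "k' \<in> {..<length ws}" "k \<noteq> k'"
    then have "ws ! k \<in> {1..n}" "ws ! k' \<in> {1..n}" "ws ! k \<noteq> ws ! k'"
      using bij by (auto dest: bij_betw_apply bij_betw_imp_inj_on inj_onD)
    then show "{slot_start p (ws ! k)..<slot_start p (ws ! k) + p (ws ! k)} \<inter>
        {slot_start p (ws ! k')..<slot_start p (ws ! k') + p (ws ! k')} = {}"
      using slot_partition(1) unfolding disjoint_family_on_def by blast
  qed
  have "(\<Union>k<length ws. {slot_start p (ws ! k)..<slot_start p (ws ! k) + p (ws ! k)})
      = (\<Union>w\<in>(\<lambda>k. ws ! k) ` {..<length ws}. {slot_start p w..<slot_start p w + p w})" by blast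
  also have "(\<lambda>k. ws ! k) ` {..<length ws} = {1..n}" using bij by (simp add: bij_betw_def)
  finally show "(\<Union>k<length ws. {slot_start p (ws ! k)..<slot_start p (ws ! k) + p (ws ! k)}) = {0..<1}"
    using slot_partition(2) by simp
  show "to_slots p ws u = slot_start p (ws ! k) + (u - e_list p ws k)"
    if "k \<in> {..<length ws}" "e_list p ws k \<le> u" "u < e_list p ws k + p (ws ! k)" for k u
    using to_slots_eq[OF ws, of k u] that by (simp add: e_list_Suc)
qed simp

end

section \<open>Conditioning on the mark of the root, and the change of coordinates\<close>

lemma emeasure_uniform_marks_split:
  assumes r: "r \<in> {1..n}" and B: "B \<in> sets (uniform_marks n)"
  shows "emeasure (uniform_marks n) B =
    (\<integral>\<^sup>+t. emeasure (unif_prod ({1..n} - {r})) {x \<in> space (unif_prod ({1..n} - {r})). x(r := t) \<in> B} \<partial>unif)"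
proof -
  let ?V = "{1..n} - {r}"
  have ins: "insert r ?V = {1..n}" using r by auto
  have B' [measurable]: "B \<in> sets (\<Pi>\<^sub>M i\<in>insert r ?V. unif)"
    using B unfolding uniform_marks_eq unif_prod_def ins .
  have "emeasure (uniform_marks n) B = (\<integral>\<^sup>+x. indicator B x \<partial>(\<Pi>\<^sub>M i\<in>insert r ?V. unif))"
    using B unfolding uniform_marks_eq unif_prod_def ins by simp
  also have "\<dots> = (\<integral>\<^sup>+t. (\<integral>\<^sup>+x. indicator B (x(r := t)) \<partial>(\<Pi>\<^sub>M i\<in>?V. unif)) \<partial>unif)"
    by (rule unif_prod.product_nn_integral_insert_rev[OF _ _ borel_measurable_indicator[OF B']]) simp_all
  also have "\<dots> = (\<integral>\<^sup>+t. emeasure (unif_prod ?V) {x \<in> space (unif_prod ?V). x(r := t) \<in> B} \<partial>unif)"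
  proof (rule nn_integral_cong)
    fix t assume "t \<in> space unif"
    have [measurable]: "(\<lambda>x. x(r := t)) \<in> measurable (\<Pi>\<^sub>M i\<in>?V. unif) (\<Pi>\<^sub>M i\<in>insert r ?V. unif)"
      by (rule measurable_fun_upd[where J = ?V]) auto
    have "(\<integral>\<^sup>+x. indicator B (x(r := t)) \<partial>(\<Pi>\<^sub>M i\<in>?V. unif))
       = (\<integral>\<^sup>+x. indicator {x \<in> space (\<Pi>\<^sub>M i\<in>?V. unif). x(r := t) \<in> B} x \<partial>(\<Pi>\<^sub>M i\<in>?V. unif))"
      by (rule nn_integral_cong) (auto split: split_indicator)
    moreover have "{x \<in> space (\<Pi>\<^sub>M i\<in>?V. unif). x(r := t) \<in> B} \<in> sets (\<Pi>\<^sub>M i\<in>?V. unif)"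
      by measurable
    ultimately show "(\<integral>\<^sup>+x. indicator B (x(r := t)) \<partial>(\<Pi>\<^sub>M i\<in>?V. unif))
       = emeasure (unif_prod ?V) {x \<in> space (unif_prod ?V). x(r := t) \<in> B}"
      unfolding unif_prod_def by (simp only: nn_integral_indicator)
  qed
  finally show ?thesis .
qed

text \<open>\<open>r\<close> and \<open>ws\<close> are fixed candidates, not read off from the
  marks. Given the mark t of \<open>r\<close>, every other mark therefore undergoes the same
  rotation by t followed by the same interval exchange, and both preserve the uniform law.\<close>

lemma emeasure_transfer:
  assumes p: "\<And>i. i \<in> {1..n} \<Longrightarrow> 0 < p i" "(\<Sum>i=1..n. p i) = 1"
    and ws: "distinct ws" "set ws = {1..n}" and r: "r \<in> {1..n}"
    and B [measurable]: "B \<in> sets (unif_prod ({1..n} - {r}))"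
  shows "emeasure (uniform_marks n)
      {x \<in> space (uniform_marks n). (\<lambda>v\<in>{1..n} - {r}. to_slots p ws (frac (x v - x r))) \<in> B}
    = emeasure (unif_prod ({1..n} - {r})) B" (is "emeasure _ ?E = _")
    and "{x \<in> space (uniform_marks n). (\<lambda>v\<in>{1..n} - {r}. to_slots p ws (frac (x v - x r))) \<in> B}
      \<in> sets (uniform_marks n)"
proof -
  let ?V = "{1..n} - {r}"
  have frac_meas [measurable]: "frac \<in> borel_measurable (borel :: real measure)"
    unfolding frac_def[abs_def] by measurable
  have [measurable]: "(\<lambda>x. \<lambda>v\<in>?V. to_slots p ws (frac (x v - x r))) \<in> measurable (uniform_marks n) (unif_prod ?V)"
    unfolding unif_prod_def uniform_marks_eq
    by (rule measurable_restrict) (use r in measurable)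
  show E: "?E \<in> sets (uniform_marks n)" by measurable
  have "emeasure (uniform_marks n) ?E = (\<integral>\<^sup>+t. emeasure (unif_prod ?V) B \<partial>unif)"
    unfolding emeasure_uniform_marks_split[OF r E]
  proof (rule nn_integral_cong_AE, use AE_unif in eventually_elim)
    case (elim t)
    let ?f = "\<lambda>u. to_slots p ws (frac (u - t))"
    have "distr unif unif ?f = distr (distr unif unif (\<lambda>u. frac (u - t))) unif (to_slots p ws)"
      by (subst distr_distr) (auto simp: comp_def)
    also have "\<dots> = unif"
      using elim by (simp only: distr_unif_frac distr_unif_to_slots[OF p ws])
    finally have f: "distr unif unif ?f = unif" .
    have [measurable]: "?f \<in> measurable unif unif" by simp
    have comp [measurable]: "compose ?V ?f \<in> measurable (unif_prod ?V) (unif_prod ?V)"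
      unfolding compose_def unif_prod_def by measurable
    have "distr (unif_prod ?V) (unif_prod ?V) (compose ?V ?f) = unif_prod ?V"
      unfolding unif_prod_def
      by (subst distr_PiM_finite_prob_space') (auto simp: prob_space_unif f)
    then have "emeasure (unif_prod ?V) B
        = emeasure (unif_prod ?V) (compose ?V ?f -` B \<inter> space (unif_prod ?V))"
      using emeasure_distr[OF comp B] by simp
    also have "compose ?V ?f -` B \<inter> space (unif_prod ?V)
        = {x \<in> space (unif_prod ?V). x(r := t) \<in> ?E}"
    proof (intro set_eqI)
      fix x
      have "x(r := t) \<in> space (uniform_marks n)" if "x \<in> space (unif_prod ?V)"
        using that r unfolding uniform_marks_eq space_unif_prod by (auto simp: PiE_iff extensional_def)
      moreover have "compose ?V ?f x = (\<lambda>v\<in>?V. to_slots p ws (frac ((x(r := t)) v - (x(r := t)) r)))"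
        by (auto simp: compose_def)
      ultimately show "x \<in> compose ?V ?f -` B \<inter> space (unif_prod ?V) \<longleftrightarrow>
          x \<in> {x \<in> space (unif_prod ?V). x(r := t) \<in> ?E}" by auto
    qed
    finally show ?case by simp
  qed
  then show "emeasure (uniform_marks n) ?E = emeasure (unif_prod ?V) B"
    using unif.emeasure_space_1 by simp
qed

text \<open>Given the mark of i, each condition on a difference excludes only countably many values
  of the mark of j, and there are finitely many conditions.\<close>

lemma AE_generic_marks: "AE x in uniform_marks n. generic_marks n p x"
proof -
  have 1: "AE x in uniform_marks n. 0 < x i \<and> x i < 1" if "i \<in> {1..n}" for i
  proof -
    have "AE u in unif. u \<noteq> 0"
      by (rule AE_I[of _ _ "{0}"]) (auto simp: emeasure_unif_countable)
    then have "AE u in unif. 0 < u \<and> u < 1" using AE_unif by eventually_elim auto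
    then show ?thesis unfolding uniform_marks_eq unif_prod_def
      using that by (intro AE_PiM_component prob_space_unif)
  qed
  have 2: "AE x in uniform_marks n. x i - x j - c \<notin> \<int>" if ij: "i \<in> {1..n}" "j \<in> {1..n}" "i \<noteq> j" for i j c
  proof -
    let ?N = "{x \<in> space (uniform_marks n). x i - x j - c \<in> \<int>}" and ?V = "{1..n} - {i}"
    have Ints_borel: "\<int> \<in> sets (borel :: real measure)" by (simp add: borel_closed)
    have N: "?N \<in> sets (uniform_marks n)"
    proof -
      have "(\<lambda>x. x i - x j - c) \<in> borel_measurable (uniform_marks n)"
        unfolding uniform_marks_eq using ij
        by (intro borel_measurable_diff measurable_unif_prod_component) auto
      from measurable_sets[OF this Ints_borel] show ?thesis by (simp add: vimage_def Int_def conj_commute)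
    qed
    have "emeasure (unif_prod ?V) {x \<in> space (unif_prod ?V). x(i := t) \<in> ?N} = 0" for t
    proof -
      have "AE u in unif. t - u - c \<notin> \<int>"
      proof (rule AE_I)
        have "{u. t - u - c \<in> \<int>} \<subseteq> (\<lambda>z. t - c - z) ` \<int>" by (auto simp: image_iff algebra_simps intro!: bexI[of _ "t - _ - c"])
        moreover have "countable (\<int> :: real set)" by (simp add: countable_int Ints_def)
        ultimately have "countable {u. t - u - c \<in> \<int>}" by (meson countable_image countable_subset)
        then show "emeasure unif {u. t - u - c \<in> \<int>} = 0" "{u. t - u - c \<in> \<int>} \<in> sets unif"
          by (auto simp: emeasure_unif_countable intro: countable_imp_null_set_lborel[THEN null_setsD2, simplified])
      qed auto
      then have "AE x in unif_prod ?V. t - x j - c \<notin> \<int>"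
        unfolding unif_prod_def using ij by (intro AE_PiM_component prob_space_unif) auto
      then have "AE x in unif_prod ?V. \<not> (x(i := t) \<in> ?N)"
        by eventually_elim (use ij in auto)
      \<comment> \<open>No measurability of the section is at hand in this case distinction; outside
        \<open>sets\<close> the value of \<open>emeasure\<close> is 0 by convention.\<close>
      then show ?thesis
        by (cases "{x \<in> space (unif_prod ?V). x(i := t) \<in> ?N} \<in> sets (unif_prod ?V)")
          (auto simp: AE_iff_measurable[OF _ refl] emeasure_notin_sets)
    qed
    then have "emeasure (uniform_marks n) ?N = 0"
      unfolding emeasure_uniform_marks_split[OF ij(1) N] by simp
    then show ?thesis by (intro AE_I[of _ _ ?N]) (use N in auto)
  qed
  have "AE x in uniform_marks n. (\<forall>i\<in>{1..n}. 0 < x i \<and> x i < 1)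
    \<and> (\<forall>i\<in>{1..n}. \<forall>j\<in>{1..n}. \<forall>S\<in>Pow {1..n}. i \<noteq> j \<longrightarrow> x i - x j - sum p S \<notin> \<int>)"
    using 1 2 by (intro AE_conjI AE_ball_countable[THEN iffD2] ballI countable_finite AE_impI) auto
  then show ?thesis by eventually_elim (auto simp: generic_marks_def)
qed

subsection \<open>The exceptional events in slot coordinates\<close>

definition slot_rel :: "nat \<Rightarrow> (nat \<Rightarrow> real) \<Rightarrow> nat \<Rightarrow> (nat \<Rightarrow> real) \<Rightarrow> (nat \<times> nat) set" where
  "slot_rel n p r z = {(w, v). w \<in> {1..n} \<and> v \<in> {1..n} - {r} \<and> z v \<in> slot p w}"

definition less_rel :: "nat \<Rightarrow> nat \<Rightarrow> (nat \<Rightarrow> real) \<Rightarrow> (nat \<times> nat) set" where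
  "less_rel n r z = {(u, v). u \<in> {1..n} - {r} \<and> v \<in> {1..n} - {r} \<and> z u < z v}"

text \<open>The depth-first search depends on the marks only through the relation \<open>R\<close> between parents and
  children and the order \<open>L\<close> of the marks. Both can be read off from the slot coordinates, so these
  determine the depth-first order.\<close>

definition rel_pending :: "(nat \<times> nat) set \<Rightarrow> nat list \<Rightarrow> nat \<Rightarrow> nat set" where
  "rel_pending R ws m = {v. \<exists>a. (a, last ws) \<in> (R \<inter> set ws \<times> UNIV) ^^ m \<and> (a, v) \<in> R \<inter> set ws \<times> UNIV} - set ws"

definition rel_next :: "(nat \<times> nat) set \<Rightarrow> (nat \<times> nat) set \<Rightarrow> nat list \<Rightarrow> nat" where
  "rel_next R L ws = (let S = rel_pending R ws (LEAST m. rel_pending R ws m \<noteq> {})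
     in SOME v. v \<in> S \<and> (\<forall>u\<in>S. (u, v) \<notin> L))"

primrec rel_explore :: "(nat \<times> nat) set \<Rightarrow> (nat \<times> nat) set \<Rightarrow> nat \<Rightarrow> nat \<Rightarrow> nat list" where
  "rel_explore R L r 0 = []"
| "rel_explore R L r (Suc j) =
     (if j = 0 then [r] else rel_explore R L r j @ [rel_next R L (rel_explore R L r j)])"

section \<open>Recovering the tree and the order from the slot coordinates\<close>

locale slot_marks = marks +
  fixes z :: "nat \<Rightarrow> real"
  assumes z: "\<And>v. v \<in> {1..n} - {r} \<Longrightarrow> z v = to_slots p W (y v)"
begin

lemma z_eq:
  assumes "(W ! k, v) \<in> T" "k < n"
  shows "z v = slot_start p (W ! k) + (y v - e W k)"
proof -
  have "v \<in> {1..n} - {r}" using T_in[OF assms(1)] T_not_root[of "W ! k"] assms(1) by auto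
  then show ?thesis
    using z to_slots_eq[OF p_pos p_sum WD(3) W_set, of k "y v"] T_nth[OF assms] assms(2) W_length by simp
qed

lemma nth_W_ex: "a \<in> {1..n} \<Longrightarrow> \<exists>k<n. a = W ! k"
  using W_set W_length by (metis in_set_conv_nth)

lemma nth_W_in: "k < n \<Longrightarrow> W ! k \<in> {1..n}"
  using W_set W_length nth_mem by metis

lemma z_slot: "(a, v) \<in> T \<Longrightarrow> z v \<in> slot p a"
proof -
  assume av: "(a, v) \<in> T"
  then obtain k where k: "k < n" "a = W ! k" using T_in nth_W_ex by blast
  then show ?thesis using z_eq[of k v] T_nth[of k v] e_W_Suc[of k] av by (simp add: slot_def)
qed

lemma slot_rel_eq: "slot_rel n p r z = T"
proof (intro equalityI subrelI)
  fix a v assume av: "(a, v) \<in> slot_rel n p r z"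
  then have v: "a \<in> {1..n}" "v \<in> {1..n}" "v \<noteq> r" "z v \<in> slot p a" by (auto simp: slot_rel_def)
  then obtain a' where a': "(a', v) \<in> T" using T_ex by blast
  then have "a' = a" using slot_unique[OF p_pos p_sum, of a' a "z v"] v z_slot T_in by blast
  then show "(a, v) \<in> T" using a' by simp
next
  fix a v assume "(a, v) \<in> T"
  then show "(a, v) \<in> slot_rel n p r z" using T_in[of a v] z_slot T_not_root by (auto simp: slot_rel_def)
qed

text \<open>Siblings are moved by the same translation, so their order survives. The order of
  vertices with different parents may change, which is why only siblings are ever compared.\<close>

lemma sibling_less_iff:
  assumes "(a, u) \<in> T" "(a, v) \<in> T"
  shows "z u < z v \<longleftrightarrow> y u < y v"
proof -
  obtain k where "k < n" "a = W ! k" using assms T_in nth_W_ex by blast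
  then show ?thesis using assms z_eq[of k u] z_eq[of k v] by simp
qed

lemma sibling_less_rel_iff:
  assumes "(a, u) \<in> T" "(a, v) \<in> T"
  shows "(u, v) \<in> less_rel n r z \<longleftrightarrow> y u < y v"
  using sibling_less_iff[OF assms] assms T_in[OF assms(1)] T_in[OF assms(2)] T_not_root
  by (auto simp: less_rel_def)

lemma right_sibs_z: "spine T r l \<Longrightarrow> right_sibs n I T z l = right_sibs n I T y l"
  using sibling_less_iff unfolding right_sibs_def spine_def by blast

lemma leads: "v \<in> {1..n} \<Longrightarrow> (r, v) \<in> T\<^sup>*"
proof -
  assume "v \<in> {1..n}"
  then obtain k where "k < n" "v = W ! k" using nth_W_ex by blast
  then obtain l where l: "spine T r l" "hd l = v" using spine_ex by blast
  then have "r \<in> set l" by (auto simp: spine_def)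
  then show ?thesis using spine_rtrancl[OF l(1)] l(2) by simp
qed

lemma explore_eq_rel_explore:
  "j \<le> n \<Longrightarrow> explore n p y r j = rel_explore T (less_rel n r z) r j"
proof (induction j)
  case (Suc j)
  let ?L = "less_rel n r z"
  show ?case
  proof (cases "j = 0")
    case False
    define ws where "ws = explore n p y r j"
    have j: "1 \<le> j" "j \<le> n" using False Suc.prems by auto
    have ws_W: "ws = take j W" using explore_prefix[of j n] j by (simp add: ws_def W_def)
    have inv: "dfs_inv ws" and len: "length ws < n" using explore_inv[OF j] Suc.prems by (auto simp: ws_def)
    have R: "T \<inter> set ws \<times> UNIV = C ws" using C_take[OF j(2)] by (auto simp: ws_W)
    have pend: "rel_pending T ws m = pending n p y ws m" for m
      by (simp add: rel_pending_def R pending_def)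
    define S where "S = pending n p y ws (LEAST m. pending n p y ws m \<noteq> {})"
    obtain a where a: "\<And>v. v \<in> S \<Longrightarrow> (a, v) \<in> T"
    proof -
      define m where "m = (LEAST m. pending n p y ws m \<noteq> {})"
      have "S \<noteq> {}" unfolding S_def using pending_ex[OF inv len] by (rule LeastI_ex)
      then obtain v where "v \<in> S" by blast
      then obtain a where a: "(a, last ws) \<in> C ws ^^ m" unfolding S_def m_def pending_def by blast
      have "(a, v) \<in> T" if v: "v \<in> S" for v
      proof -
        obtain b where b: "(b, last ws) \<in> C ws ^^ m" "(b, v) \<in> C ws"
          using v unfolding S_def m_def pending_def by blast
        then have "b = a" using C_relpow_unique[OF dfs_invD(4)[OF inv] _ a] by blast
        then show ?thesis using b(2) R by blast
      qed
      then show ?thesis by (rule that)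
    qed
    \<comment> \<open>All members of \<open>S\<close> are children of \<open>a\<close>, so both
      orders have the same minimal elements on \<open>S\<close>. The two choices are then
      \<open>SOME\<close> of equivalent predicates, hence equal.\<close>
    have "is_arg_min y (\<lambda>x. x \<in> S) v \<longleftrightarrow> v \<in> S \<and> (\<forall>u\<in>S. (u, v) \<notin> ?L)" for v
      using sibling_less_rel_iff[OF a a] by (auto simp: is_arg_min_def)
    then have "next_vertex n p y ws = rel_next T ?L ws"
      by (simp add: next_vertex_def rel_next_def pend S_def[symmetric] arg_min_on_def arg_min_def Let_def)
    then show ?thesis using Suc False by (simp add: ws_def)
  qed simp
qed simp

lemma W_eq_rel_explore: "W = rel_explore (slot_rel n p r z) (less_rel n r z) r n"
  using explore_eq_rel_explore[of n] by (simp add: W_def[symmetric] slot_rel_eq)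

lemma window_eq:
  assumes "k < n"
  shows "{v. I < v \<and> (W ! k, v) \<in> T \<and> y v \<le> e W k + a}
    = {v. I < v \<and> (W ! k, v) \<in> slot_rel n p r z \<and> z v \<le> slot_start p (W ! k) + a}"
  using z_eq[OF _ assms] unfolding slot_rel_eq by auto

end

section \<open>The four exceptional events\<close>

definition spine_lists :: "nat \<Rightarrow> nat \<Rightarrow> nat \<Rightarrow> nat list set" where
  "spine_lists n r m = {l. length l = m \<and> distinct l \<and> set l \<subseteq> {1..n} \<and> last l = r}"

lemma finite_spine_lists: "finite (spine_lists n r m)"
  by (rule finite_subset[OF _ finite_lists_length_eq[of "{1..n}" m]]) (auto simp: spine_lists_def)

definition long_spine :: "nat \<Rightarrow> (nat \<Rightarrow> real) \<Rightarrow> nat \<Rightarrow> nat \<Rightarrow> (nat \<Rightarrow> real) \<Rightarrow> bool" where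
  "long_spine n p m r z \<longleftrightarrow> (\<exists>l\<in>spine_lists n r (Suc m). spine (slot_rel n p r z) r l)"

definition unbalanced ::
  "nat \<Rightarrow> nat \<Rightarrow> (nat \<Rightarrow> real) \<Rightarrow> nat \<Rightarrow> real \<Rightarrow> nat \<Rightarrow> (nat \<Rightarrow> real) \<Rightarrow> bool" where
  "unbalanced n I p m t r z \<longleftrightarrow> (\<exists>h\<in>{1..m}. \<exists>l\<in>spine_lists n r h. spine (slot_rel n p r z) r l \<and>
     t < \<bar>real (card (right_sibs n I (slot_rel n p r z) z l)) - small_ancestors I l / 2\<bar>)"

definition window_count ::
  "nat \<Rightarrow> nat \<Rightarrow> (nat \<Rightarrow> real) \<Rightarrow> nat \<Rightarrow> (nat \<Rightarrow> real) \<Rightarrow> nat \<Rightarrow> real \<Rightarrow> nat" where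
  "window_count n I p r z i a = card {v. I < v \<and> (i, v) \<in> slot_rel n p r z \<and> z v \<le> slot_start p i + a}"

definition uneven_window ::
  "nat \<Rightarrow> nat \<Rightarrow> (nat \<Rightarrow> real) \<Rightarrow> real \<Rightarrow> real \<Rightarrow> nat \<Rightarrow> (nat \<Rightarrow> real) \<Rightarrow> bool" where
  "uneven_window n I p s \<delta> r z \<longleftrightarrow> (\<exists>i\<in>{1..I}. \<exists>k\<in>{0..n}.
     \<delta> < \<bar>s * real (window_count n I p r z i (real k / real n * p i)) - real k / real n * p i\<bar>)"

text \<open>Edges between hubs are improbable only if the first clause, that the parent relation is a tree, is
  kept: without it the sum of the probabilities over all roots would carry a factor \<open>n\<close>.\<close>

definition hub_pair :: "nat \<Rightarrow> nat \<Rightarrow> (nat \<Rightarrow> real) \<Rightarrow> nat \<Rightarrow> (nat \<Rightarrow> real) \<Rightarrow> bool" where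
  "hub_pair n I p r z \<longleftrightarrow> (\<forall>v\<in>{1..n}. (r, v) \<in> (slot_rel n p r z)\<^sup>*) \<and>
     (\<exists>i\<in>{1..I}. \<exists>i'\<in>{1..I}. (i, i') \<in> slot_rel n p r z)"

lemma finite_window: "finite {v. I < v \<and> (i, v) \<in> slot_rel n p r z \<and> z v \<le> c}"
  by (rule finite_subset[of _ "{1..n}"]) (auto simp: slot_rel_def)

lemma window_count_mono: "a \<le> b \<Longrightarrow> window_count n I p r z i a \<le> window_count n I p r z i b"
  unfolding window_count_def by (rule card_mono[OF finite_window]) auto

text \<open>The count increases with the length of the window, so any length is sandwiched between
  two grid points. The spacing p_i / n of the grid is the price, at most 1 / n. This reduces a
  statement about all lengths to a finite union of events.\<close>

lemma even_window_between_grid: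
  assumes "\<not> uneven_window n I p s \<delta> r z" and i: "i \<in> {1..I}" and n: "1 \<le> n" and s: "0 \<le> s"
    and a: "0 \<le> a" "a \<le> p i" "0 < p i" "p i \<le> 1"
  shows "\<bar>s * real (window_count n I p r z i a) - a\<bar> \<le> \<delta> + 1 / real n"
proof -
  let ?N = "window_count n I p r z i"
  have grid: "\<bar>s * real (?N (real k / real n * p i)) - real k / real n * p i\<bar> \<le> \<delta>" if "k \<le> n" for k
    using assms(1) i that by (auto simp: uneven_window_def not_less)
  define k where "k = nat \<lfloor>a / p i * n\<rfloor>"
  have k0: "0 \<le> a / p i * real n" using a by simp
  have k: "real k \<le> a / p i * real n" "a / p i * real n < real k + 1"
    using k0 by (auto simp: k_def)
  have ap: "a / p i \<le> 1" using a by simp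
  have "a / p i * real n \<le> 1 * real n" by (rule mult_right_mono[OF ap]) simp
  then have kn: "k \<le> n" using k(1) by linarith
  have lower: "real k / real n * p i \<le> a"
  proof -
    have "real k / real n \<le> a / p i" using k(1) n by (simp add: field_simps)
    then show ?thesis using a(3) by (simp add: field_simps)
  qed
  have step: "real (k + 1) / real n * p i \<le> real k / real n * p i + 1 / real n"
  proof -
    have "1 / real n * p i \<le> 1 / real n * 1" by (rule mult_left_mono) (use a n in auto)
    moreover have "real (k + 1) / real n * p i = real k / real n * p i + 1 / real n * p i"
      by (simp add: add_divide_distrib distrib_right)
    ultimately show ?thesis by simp
  qed
  have upper: "a \<le> real (k + 1) / real n * p i"
  proof -
    have "a / p i \<le> real (k + 1) / real n" using k(2) n by (simp add: field_simps)
    then show ?thesis using a(3) by (simp add: field_simps)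
  qed
  have "s * real (?N (real k / real n * p i)) \<le> s * real (?N a)"
    using window_count_mono[OF lower] s by (intro mult_left_mono) auto
  then have low: "a - (\<delta> + 1 / real n) \<le> s * real (?N a)" using grid[OF kn] upper step by (auto simp: abs_le_iff)
  have high: "s * real (?N a) \<le> a + (\<delta> + 1 / real n)"
  proof (cases "k = n")
    case True
    then have ap: "a = p i" using lower a n by simp
    have "s * real (?N (p i)) - p i \<le> \<delta>" using grid[of n] n by (simp add: abs_le_iff)
    moreover have "0 \<le> 1 / real n" by simp
    ultimately show ?thesis unfolding ap by linarith
  next
    case False
    then have "k + 1 \<le> n" using kn by simp
    moreover have "s * real (?N a) \<le> s * real (?N (real (k + 1) / real n * p i))"
      using window_count_mono[OF upper] s by (intro mult_left_mono) auto
    ultimately show ?thesis using grid[of "k + 1"] lower step by (auto simp: abs_le_iff)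
  qed
  show ?thesis using low high by (simp add: abs_le_iff)
qed

locale slot_hub_tree = hub_tree + slot_marks
begin

text \<open>The upper end of a path that is too long is itself a path to the root with exactly m + 1
  vertices, so a single length has to be excluded.\<close>

lemma spine_length_le:
  assumes "\<not> long_spine n p m r z" and l: "spine T r l" "distinct l" "set l \<subseteq> {1..n}"
  shows "length l \<le> m"
proof (rule ccontr)
  assume "\<not> length l \<le> m"
  then have len: "Suc m \<le> length l" by simp
  define l' where "l' = drop (length l - Suc m) l"
  have "length l' = Suc m" "distinct l'" "set l' \<subseteq> {1..n}" "last l' = r"
    using len l set_drop_subset[of "length l - Suc m" l] by (auto simp: l'_def spine_def)
  then have "l' \<in> spine_lists n r (Suc m)" by (simp add: spine_lists_def)
  moreover have "spine T r l'"
    unfolding spine_def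
  proof (intro conjI allI impI)
    show "l' \<noteq> []" "last l' = r" using \<open>length l' = Suc m\<close> \<open>last l' = r\<close> by auto
    fix k assume "Suc k < length l'"
    then show "(l' ! Suc k, l' ! k) \<in> T" using l(1) len by (auto simp: l'_def spine_def)
  qed
  ultimately show False using assms(1) slot_rel_eq by (auto simp: long_spine_def)
qed

lemma good_treeI:
  assumes "\<not> long_spine n p m r z" "\<not> unbalanced n I p m t r z"
    "\<not> uneven_window n I p s \<delta> r z" "\<not> hub_pair n I p r z" "0 \<le> \<delta>"
  shows "good_tree n p y r x I s t (\<delta> + 1 / n)"
proof unfold_locales
  show "0 \<le> \<delta> + 1 / n" using assms(5) by simp
  show "I < i" if "(i, i') \<in> T" "i' \<le> I" for i i'
  proof (rule ccontr)
    assume "\<not> I < i"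
    then have "i \<in> {1..I}" "i' \<in> {1..I}" using T_in[OF that(1)] that(2) by auto
    moreover have "\<forall>v\<in>{1..n}. (r, v) \<in> T\<^sup>*" using leads by blast
    ultimately have "hub_pair n I p r z" using that(1) unfolding hub_pair_def slot_rel_eq by blast
    with assms(4) show False ..
  qed
  show "\<bar>s * real (card {v. I < v \<and> (W ! k, v) \<in> T \<and> y v \<le> e W k + a}) - a\<bar> \<le> \<delta> + 1 / n"
    if "k < n" "W ! k \<le> I" "0 \<le> a" "a \<le> p (W ! k)" for k a
  proof -
    have W: "W ! k \<in> {1..n}" using nth_W_in that by blast
    have "p (W ! k) \<le> sum p {1..n}"
      by (rule member_le_sum[OF W]) (use p_pos less_imp_le in blast)+
    then have "p (W ! k) \<le> 1" using p_sum by simp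
    moreover have "W ! k \<in> {1..I}" using W that(2) by simp
    ultimately have "\<bar>s * real (window_count n I p r z (W ! k) a) - a\<bar> \<le> \<delta> + 1 / n"
      by (intro even_window_between_grid[OF assms(3)] n_pos less_imp_le[OF s_pos] p_pos[OF W] that)
    then show ?thesis unfolding window_count_def window_eq[OF that(1)] .
  qed
  show "\<bar>real (card (right_sibs n I T y l)) - real (small_ancestors I l) / 2\<bar> \<le> t"
    if l: "spine T r l" "distinct l" "set l \<subseteq> {1..n}" for l
  proof -
    have "length l \<in> {1..m}"
      using spine_length_le[OF assms(1) l] l(1) by (cases l) (auto simp: spine_def)
    moreover have "l \<in> spine_lists n r (length l)" using l by (simp add: spine_lists_def spine_def)
    ultimately have "\<not> t < \<bar>real (card (right_sibs n I T z l)) - real (small_ancestors I l) / 2\<bar>"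
      using assms(2) l(1) unfolding unbalanced_def slot_rel_eq by blast
    then show ?thesis by (simp add: right_sibs_z[OF l(1)])
  qed
qed

end

subsection \<open>Measurability and transfer of probabilities\<close>

text \<open>A map into the subsets of a finite set takes finitely many values, and each value is
  decided by finitely many memberships. So \<open>Q\<close> may depend on the set in an arbitrary
  way, for instance through transitive closures, cardinalities or a whole exploration.\<close>

lemma pred_set_valued:
  assumes F: "finite F" and S: "\<And>z. z \<in> space M \<Longrightarrow> S z \<subseteq> F"
    and mem: "\<And>a. a \<in> F \<Longrightarrow> Measurable.pred M (\<lambda>z. a \<in> S z)"
    and Q: "\<And>A. A \<subseteq> F \<Longrightarrow> Measurable.pred M (\<lambda>z. Q A z)"
  shows "Measurable.pred M (\<lambda>z. Q (S z) z)"
proof -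
  have "Measurable.pred M (\<lambda>z. \<exists>A\<in>Pow F. Q A z \<and> (\<forall>a\<in>F. (a \<in> S z) = (a \<in> A)))"
    using F by (intro pred_intros_finite pred_intros_logic mem Q) auto
  also have "?this \<longleftrightarrow> Measurable.pred M (\<lambda>z. Q (S z) z)"
  proof (rule measurable_cong)
    fix z assume z: "z \<in> space M"
    have "(\<forall>a\<in>F. (a \<in> S z) = (a \<in> A)) \<longleftrightarrow> A = S z" if "A \<in> Pow F" for A
      using S[OF z] that by blast
    then show "(\<exists>A\<in>Pow F. Q A z \<and> (\<forall>a\<in>F. (a \<in> S z) = (a \<in> A))) = Q (S z) z"
      using S[OF z] by blast
  qed
  finally show ?thesis .
qed

context
  fixes n r :: nat and p :: "nat \<Rightarrow> real"
begin

abbreviation (input) "nonroot \<equiv> {1..n} - {r}"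
abbreviation (input) "coord_space \<equiv> unif_prod ({1..n} - {r})"

lemma pred_coordinate: "v \<in> nonroot \<Longrightarrow> Measurable.pred borel P \<Longrightarrow> Measurable.pred coord_space (\<lambda>z. P (z v))"
  by (rule measurable_compose[OF measurable_unif_prod_component])

lemma pred_coordinate_slot: "v \<in> nonroot \<Longrightarrow> Measurable.pred coord_space (\<lambda>z. z v \<in> slot p w)"
  by (rule pred_coordinate) (auto simp: slot_def)

lemma pred_coordinate_less:
  assumes "u \<in> nonroot" "v \<in> nonroot"
  shows "Measurable.pred coord_space (\<lambda>z. z u < z v)"
  using measurable_unif_prod_component[OF assms(1)] measurable_unif_prod_component[OF assms(2)]
  by measurable

lemma pred_slot_rel: "(\<And>R. Measurable.pred coord_space (\<lambda>z. Q R z)) \<Longrightarrow> Measurable.pred coord_space (\<lambda>z. Q (slot_rel n p r z) z)"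
proof (rule pred_set_valued[where F = "{1..n} \<times> nonroot" and S = "slot_rel n p r" and Q = Q])
  fix a :: "nat \<times> nat" assume "a \<in> {1..n} \<times> nonroot"
  then obtain w v where "a = (w, v)" "w \<in> {1..n}" "v \<in> nonroot" by blast
  then show "Measurable.pred coord_space (\<lambda>z. a \<in> slot_rel n p r z)"
    using pred_coordinate_slot[of v w] by (simp add: slot_rel_def)
qed (auto simp: slot_rel_def)

lemma pred_less_rel: "(\<And>L. Measurable.pred coord_space (\<lambda>z. Q L z)) \<Longrightarrow> Measurable.pred coord_space (\<lambda>z. Q (less_rel n r z) z)"
proof (rule pred_set_valued[where F = "nonroot \<times> nonroot" and S = "less_rel n r" and Q = Q])
  fix a :: "nat \<times> nat" assume "a \<in> nonroot \<times> nonroot"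
  then obtain u v where "a = (u, v)" "u \<in> nonroot" "v \<in> nonroot" by blast
  then show "Measurable.pred coord_space (\<lambda>z. a \<in> less_rel n r z)"
    using pred_coordinate_less[of u v] by (simp add: less_rel_def)
qed (auto simp: less_rel_def)

lemma pred_rel_explore: "Measurable.pred coord_space (\<lambda>z. rel_explore (slot_rel n p r z) (less_rel n r z) r n = ws)"
  by (rule pred_slot_rel[where Q = "\<lambda>R z. rel_explore R (less_rel n r z) r n = ws"],
      rule pred_less_rel[where Q = "\<lambda>L z. rel_explore _ L r n = ws"]) simp

lemma pred_long_spine: "Measurable.pred coord_space (long_spine n p m r)"
  unfolding long_spine_def
  by (rule pred_slot_rel[where Q = "\<lambda>R z. \<exists>l\<in>spine_lists n r (Suc m). spine R r l"]) simp

lemma pred_hub_pair: "Measurable.pred coord_space (hub_pair n I p r)"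
  unfolding hub_pair_def
  by (rule pred_slot_rel[where Q = "\<lambda>R z. (\<forall>v\<in>{1..n}. (r, v) \<in> R\<^sup>*) \<and> (\<exists>i\<in>{1..I}. \<exists>i'\<in>{1..I}. (i, i') \<in> R)"]) simp

lemma pred_right_sibs:
  assumes l: "l \<in> spine_lists n r h" and Q: "\<And>A. Measurable.pred coord_space (\<lambda>z. Q A z)"
  shows "Measurable.pred coord_space (\<lambda>z. Q (right_sibs n I R z l) z)"
proof (rule pred_set_valued[where F = "{1..n} - set l" and S = "\<lambda>z. right_sibs n I R z l" and Q = Q])
  have r: "r \<in> set l" if "l \<noteq> []" using l that by (auto simp: spine_lists_def)
  have nth: "l ! k \<in> nonroot" if "Suc k < length l" for k
  proof -
    have "l \<noteq> []" "k < length l" using that by auto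
    have "l ! k \<noteq> l ! (length l - 1)"
      using l that by (simp add: spine_lists_def nth_eq_iff_index_eq)
    moreover have "l ! (length l - 1) = r"
    proof -
      have "last l = r" using l unfolding spine_lists_def by blast
      then show ?thesis using last_conv_nth[OF \<open>l \<noteq> []\<close>] by simp
    qed
    ultimately have "l ! k \<noteq> r" by simp
    moreover have "l ! k \<in> {1..n}" using l nth_mem[OF \<open>k < length l\<close>] unfolding spine_lists_def by blast
    ultimately show ?thesis by simp
  qed
  fix v assume v: "v \<in> {1..n} - set l"
  show "Measurable.pred coord_space (\<lambda>z. v \<in> right_sibs n I R z l)"
  proof (cases "l = []")
    case False
    then have "v \<in> nonroot" using v r by auto
    define K where "K = {k. Suc k < length l \<and> I < l ! Suc k \<and> (l ! Suc k, v) \<in> R}"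
    have eq: "v \<in> right_sibs n I R z l \<longleftrightarrow> I < v \<and> (\<exists>k\<in>K. z (l ! k) < z v)" for z
      using v unfolding right_sibs_def K_def by blast
    have "finite K" by (rule finite_subset[of _ "{..<length l}"]) (auto simp: K_def)
    moreover have "Measurable.pred coord_space (\<lambda>z. z (l ! k) < z v)" if "k \<in> K" for k
      using that nth[of k] \<open>v \<in> nonroot\<close> by (intro pred_coordinate_less) (auto simp: K_def)
    ultimately have "Measurable.pred coord_space (\<lambda>z. \<exists>k\<in>K. z (l ! k) < z v)" by (rule pred_intros_finite)
    then show ?thesis unfolding eq by (intro pred_intros_logic) simp
  qed (simp add: right_sibs_def)
qed (use Q in \<open>auto simp: right_sibs_def\<close>)

lemma pred_unbalanced: "Measurable.pred coord_space (unbalanced n I p m t r)"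
  unfolding unbalanced_def
proof (rule pred_slot_rel[where Q = "\<lambda>R z. \<exists>h\<in>{1..m}. \<exists>l\<in>spine_lists n r h. spine R r l \<and>
     t < \<bar>real (card (right_sibs n I R z l)) - small_ancestors I l / 2\<bar>"])
  fix R
  show "Measurable.pred coord_space (\<lambda>z. \<exists>h\<in>{1..m}. \<exists>l\<in>spine_lists n r h. spine R r l \<and>
     t < \<bar>real (card (right_sibs n I R z l)) - small_ancestors I l / 2\<bar>)"
  proof (intro pred_intros_finite finite_spine_lists finite_atLeastAtMost pred_intros_logic)
    fix h l assume "l \<in> spine_lists n r h"
    then show "Measurable.pred coord_space (\<lambda>z. t < \<bar>real (card (right_sibs n I R z l)) - small_ancestors I l / 2\<bar>)"
      by (rule pred_right_sibs[where Q = "\<lambda>A z. t < \<bar>real (card A) - small_ancestors I l / 2\<bar>"]) simp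
  qed simp
qed

lemma pred_uneven_window: "Measurable.pred coord_space (uneven_window n I p s \<delta> r)"
  unfolding uneven_window_def window_count_def
proof (intro pred_intros_finite finite_atLeastAtMost)
  fix i k
  show "Measurable.pred coord_space (\<lambda>z. \<delta> < \<bar>s * real (card {v. I < v \<and> (i, v) \<in> slot_rel n p r z
      \<and> z v \<le> slot_start p i + real k / real n * p i}) - real k / real n * p i\<bar>)"
  proof (rule pred_set_valued[where F = nonroot and Q = "\<lambda>A z. \<delta> < \<bar>s * real (card A) - real k / real n * p i\<bar>"])
    fix v assume v: "v \<in> nonroot"
    have "Measurable.pred coord_space (\<lambda>z. z v \<le> slot_start p i + real k / real n * p i)"
      by (rule pred_coordinate[OF v]) simp
    then show "Measurable.pred coord_space (\<lambda>z. v \<in> {v. I < v \<and> (i, v) \<in> slot_rel n p r z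
        \<and> z v \<le> slot_start p i + real k / real n * p i})"
      using pred_coordinate_slot[OF v] v by (simp add: slot_rel_def)
  qed (auto simp: slot_rel_def)
qed

end

section \<open>Passing from the marks to the slot coordinates\<close>

definition slot_coords :: "nat \<Rightarrow> (nat \<Rightarrow> real) \<Rightarrow> (nat \<Rightarrow> real) \<Rightarrow> nat \<Rightarrow> real" where
  "slot_coords n p x = (\<lambda>v\<in>{1..n} - {root_vertex n p x}. to_slots p (dfs_order n p x) (shifted n p x v))"

lemma slot_marks_coords:
  assumes "1 \<le> n" "\<And>i. i \<in> {1..n} \<Longrightarrow> 0 < p i" "(\<Sum>i=1..n. p i) = 1" "generic_marks n p x"
  shows "slot_marks n p (shifted n p x) (root_vertex n p x) (slot_coords n p x)"
proof -
  interpret marks n p "shifted n p x" "root_vertex n p x" using assms by (rule marks_shifted)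
  have W: "W = dfs_order n p x" unfolding W_def dfs_order_def ..
  show ?thesis by unfold_locales (simp add: slot_coords_def W)
qed

text \<open>Cover the event by the pieces with prescribed root \<open>r\<close> and order
  \<open>ws\<close>. For fixed \<open>r\<close> the sets \<open>D r ws\<close> are disjoint because
  the slot coordinates determine the order, so the sum over the orders is at most the measure of
  \<open>B r\<close>. Marks that are not generic only add a null set.\<close>

lemma outer_measure_transfer:
  assumes n: "1 \<le> n" and p: "\<And>i. i \<in> {1..n} \<Longrightarrow> 0 < p i" "(\<Sum>i=1..n. p i) = 1"
    and B: "\<And>r. r \<in> {1..n} \<Longrightarrow> B r \<in> sets (unif_prod ({1..n} - {r}))"
  shows "outer_measure_of (uniform_marks n) {x \<in> space (uniform_marks n).
      generic_marks n p x \<longrightarrow> slot_coords n p x \<in> B (root_vertex n p x)}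
    \<le> (\<Sum>r=1..n. emeasure (unif_prod ({1..n} - {r})) (B r))"
proof -
  obtain N where N: "N \<in> null_sets (uniform_marks n)"
    "{x \<in> space (uniform_marks n). \<not> generic_marks n p x} \<subseteq> N"
    using AE_generic_marks[of n p] by (auto simp: eventually_ae_filter)
  define P where "P = {ws. distinct ws \<and> set ws = {1..n}}"
  have finP: "finite P"
    unfolding P_def by (rule finite_subset[OF _ finite_subset_distinct[of "{1..n}"]]) auto
  define D where "D r ws = {z \<in> B r. rel_explore (slot_rel n p r z) (less_rel n r z) r n = ws}" for r ws
  have D: "D r ws \<in> sets (unif_prod ({1..n} - {r}))" if "r \<in> {1..n}" for r ws
  proof -
    have "D r ws = B r \<inter> {z \<in> space (unif_prod ({1..n} - {r})).
        rel_explore (slot_rel n p r z) (less_rel n r z) r n = ws}"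
      using sets.sets_into_space[OF B[OF that]] by (auto simp: D_def)
    then show ?thesis using B[OF that] pred_rel_explore[where n = n and r = r and p = p and ws = ws] by (simp add: pred_def)
  qed
  define F where "F r ws = {x \<in> space (uniform_marks n).
      (\<lambda>v\<in>{1..n} - {r}. to_slots p ws (frac (x v - x r))) \<in> D r ws}" for r ws
  have F: "F r ws \<in> sets (uniform_marks n)" "emeasure (uniform_marks n) (F r ws)
      = emeasure (unif_prod ({1..n} - {r})) (D r ws)" if "r \<in> {1..n}" "ws \<in> P" for r ws
    using emeasure_transfer[OF p _ _ that(1) D[OF that(1)], of ws] that(2) by (auto simp: F_def P_def)
  let ?U = "N \<union> (\<Union>r\<in>{1..n}. \<Union>ws\<in>P. F r ws)"
  have "{x \<in> space (uniform_marks n). generic_marks n p x \<longrightarrow> slot_coords n p x \<in> B (root_vertex n p x)} \<subseteq> ?U"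
  proof
    fix x assume x: "x \<in> {x \<in> space (uniform_marks n). generic_marks n p x \<longrightarrow> slot_coords n p x \<in> B (root_vertex n p x)}"
    show "x \<in> ?U"
    proof (cases "generic_marks n p x")
      case True
      define r where "r = root_vertex n p x"
      define z where "z = slot_coords n p x"
      interpret slot_marks n p "shifted n p x" r z
        unfolding r_def z_def using n p True by (rule slot_marks_coords)
      have WP: "W \<in> P" using WD(3) W_set by (simp add: P_def)
      have W: "dfs_order n p x = W" by (simp only: W_def dfs_order_def) (simp only: r_def)
      have "z = (\<lambda>v\<in>{1..n} - {r}. to_slots p W (frac (x v - x r)))"
        by (auto simp: z_def slot_coords_def r_def[symmetric] shifted_def W)
      moreover have "z \<in> D r W" using x True W_eq_rel_explore by (simp add: D_def z_def r_def)
      ultimately have "x \<in> F r W" using x by (simp add: F_def)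
      then show ?thesis using r_in WP by blast
    qed (use x N in auto)
  qed
  then have "outer_measure_of (uniform_marks n) {x \<in> space (uniform_marks n).
      generic_marks n p x \<longrightarrow> slot_coords n p x \<in> B (root_vertex n p x)} \<le> outer_measure_of (uniform_marks n) ?U"
    by (rule outer_measure_of_mono)
  also have "\<dots> = emeasure (uniform_marks n) ?U"
    using N F finP by (intro outer_measure_of_eq sets.Un sets.finite_UN) auto
  also have "\<dots> = emeasure (uniform_marks n) (\<Union>r\<in>{1..n}. \<Union>ws\<in>P. F r ws)"
    using N F finP by (subst Un_commute) (intro emeasure_Un_null_set sets.finite_UN, auto)
  also have "\<dots> \<le> (\<Sum>r=1..n. emeasure (uniform_marks n) (\<Union>ws\<in>P. F r ws))"
    using F finP by (intro emeasure_subadditive_finite) auto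
  also have "\<dots> \<le> (\<Sum>r=1..n. \<Sum>ws\<in>P. emeasure (uniform_marks n) (F r ws))"
    using F finP by (intro sum_mono emeasure_subadditive_finite) auto
  also have "\<dots> = (\<Sum>r=1..n. \<Sum>ws\<in>P. emeasure (unif_prod ({1..n} - {r})) (D r ws))"
    using F by (intro sum.cong) auto
  also have "\<dots> = (\<Sum>r=1..n. emeasure (unif_prod ({1..n} - {r})) (\<Union>ws\<in>P. D r ws))"
    using D finP by (intro sum.cong sum_emeasure) (auto simp: disjoint_family_on_def D_def)
  also have "\<dots> \<le> (\<Sum>r=1..n. emeasure (unif_prod ({1..n} - {r})) (B r))"
    using B by (intro sum_mono emeasure_mono) (auto simp: D_def)
  finally show ?thesis .
qed

subsection \<open>Exponential moments\<close>

lemma exp_le_quadratic: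
  fixes x :: real
  assumes "\<bar>x\<bar> \<le> 1"
  shows "exp x \<le> 1 + x + x\<^sup>2"
proof (cases "0 \<le> x")
  case True
  then show ?thesis using exp_bound[of x] assms by simp
next
  case False
  have "1 \<le> (1 - x) * (1 + x + x\<^sup>2)"
  proof -
    have "(1 - x) * (1 + x + x\<^sup>2) = 1 - x ^ 3" by (simp add: algebra_simps power2_eq_square power3_eq_cube)
    moreover have "x ^ 3 \<le> 0" using False mult_nonneg_nonpos[of "x * x" x] by (simp add: power3_eq_cube)
    ultimately show ?thesis by simp
  qed
  also have "\<dots> \<le> exp (- x) * (1 + x + x\<^sup>2)"
  proof (rule mult_right_mono)
    show "1 - x \<le> exp (- x)" using exp_ge_add_one_self[of "- x"] by simp
    show "0 \<le> 1 + x + x\<^sup>2" using assms by (simp add: abs_le_iff)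
  qed
  finally have "exp x * 1 \<le> exp x * (exp (- x) * (1 + x + x\<^sup>2))" by (intro mult_left_mono) auto
  also have "\<dots> = 1 + x + x\<^sup>2" by (simp add: exp_minus field_simps)
  finally show ?thesis by simp
qed

lemma nn_integral_unif_prod_inj:
  fixes g :: "'k \<Rightarrow> real \<Rightarrow> ennreal"
  assumes V: "finite V" and K: "finite K" "inj_on q K" "q ` K \<subseteq> V"
    and g: "\<And>k. k \<in> K \<Longrightarrow> g k \<in> borel_measurable borel"
  shows "(\<integral>\<^sup>+z. (\<Prod>k\<in>K. g k (z (q k))) \<partial>unif_prod V) = (\<Prod>k\<in>K. \<integral>\<^sup>+u. g k u \<partial>unif)"
proof -
  define f where "f a = (if a \<in> q ` K then g (the_inv_into K q a) else (\<lambda>_. 1))" for a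
  have fq: "f (q k) = g k" if "k \<in> K" for k
    using that K by (simp add: f_def the_inv_into_f_f)
  have f_meas: "f a \<in> borel_measurable unif" for a
  proof (cases "a \<in> q ` K")
    case True
    then obtain k where "k \<in> K" "a = q k" by blast
    then show ?thesis using fq g by (simp cong: measurable_cong_sets)
  qed (simp add: f_def)
  have "(\<Prod>k\<in>K. g k (z (q k))) = (\<Prod>a\<in>V. f a (z a))" for z
  proof -
    have "(\<Prod>a\<in>V. f a (z a)) = (\<Prod>a\<in>q ` K. f a (z a))"
      by (rule prod.mono_neutral_right) (use V K in \<open>auto simp: f_def\<close>)
    also have "\<dots> = (\<Prod>k\<in>K. f (q k) (z (q k)))" by (simp add: prod.reindex[OF K(2)])
    also have "\<dots> = (\<Prod>k\<in>K. g k (z (q k)))" by (rule prod.cong) (simp_all add: fq)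
    finally show ?thesis by simp
  qed
  then have "(\<integral>\<^sup>+z. (\<Prod>k\<in>K. g k (z (q k))) \<partial>unif_prod V) = (\<Prod>a\<in>V. \<integral>\<^sup>+u. f a u \<partial>unif)"
    unfolding unif_prod_def using unif_prod.product_nn_integral_prod[OF V, of f] f_meas by simp
  also have "\<dots> = (\<Prod>a\<in>q ` K. \<integral>\<^sup>+u. f a u \<partial>unif)"
    by (rule prod.mono_neutral_right) (use V K unif.emeasure_space_1 in \<open>auto simp: f_def\<close>)
  also have "\<dots> = (\<Prod>k\<in>K. \<integral>\<^sup>+u. f (q k) u \<partial>unif)" by (simp add: prod.reindex[OF K(2)])
  also have "\<dots> = (\<Prod>k\<in>K. \<integral>\<^sup>+u. g k u \<partial>unif)" by (rule prod.cong) (simp_all add: fq)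
  finally show ?thesis .
qed

lemma nn_integral_exp_indicator:
  assumes J: "J \<in> sets borel" and q: "emeasure unif J = ennreal q" "0 \<le> q"
  shows "(\<integral>\<^sup>+u. ennreal (if u \<in> J then exp \<tau> else 1) \<partial>unif) \<le> ennreal (exp ((exp \<tau> - 1) * q))"
proof -
  have pq: "unif.prob J = q" using q by (simp add: measure_def)
  then have q1: "q \<le> 1" using unif.prob_le_1 by metis
  have comp: "emeasure unif (UNIV - J) = ennreal (1 - q)"
    using unif.prob_compl[of J] J pq by (simp add: unif.emeasure_eq_measure)
  have meas: "J \<in> sets unif" "UNIV - J \<in> sets unif" using J by auto
  have "(\<integral>\<^sup>+u. ennreal (if u \<in> J then exp \<tau> else 1) \<partial>unif)
     = (\<integral>\<^sup>+u. ennreal (exp \<tau>) * indicator J u + indicator (UNIV - J) u \<partial>unif)"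
    by (rule nn_integral_cong) (auto split: split_indicator)
  also have "\<dots> = ennreal (exp \<tau>) * ennreal q + ennreal (1 - q)"
    using meas by (subst nn_integral_add) (auto simp: nn_integral_cmult q comp)
  also have "\<dots> = ennreal (1 + (exp \<tau> - 1) * q)"
    using q q1 by (simp add: ennreal_mult[symmetric] ennreal_plus[symmetric] algebra_simps del: ennreal_plus)
  also have "\<dots> \<le> ennreal (exp ((exp \<tau> - 1) * q))"
    by (intro ennreal_leI exp_ge_add_one_self)
  finally show ?thesis .
qed

lemma nn_integral_exp_count:
  assumes V: "finite V" "B \<subseteq> V" and J: "J \<in> sets borel" "emeasure unif J = ennreal q" "0 \<le> q"
  shows "(\<integral>\<^sup>+z. (\<Prod>v\<in>B. ennreal (if z v \<in> J then exp \<tau> else 1)) \<partial>unif_prod V)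
    \<le> ennreal (exp ((exp \<tau> - 1) * q * card B))"
proof -
  have B: "finite B" using V finite_subset by blast
  have "(\<integral>\<^sup>+z. (\<Prod>v\<in>B. ennreal (if z v \<in> J then exp \<tau> else 1)) \<partial>unif_prod V)
     = (\<Prod>v\<in>B. \<integral>\<^sup>+u. ennreal (if u \<in> J then exp \<tau> else 1) \<partial>unif)"
    using V B J by (intro nn_integral_unif_prod_inj[where q = "\<lambda>v. v"]) auto
  also have "\<dots> \<le> (\<Prod>v\<in>B. ennreal (exp ((exp \<tau> - 1) * q)))"
    by (intro prod_mono_ennreal nn_integral_exp_indicator J)
  also have "\<dots> = ennreal (exp ((exp \<tau> - 1) * q * card B))"
    by (simp add: ennreal_power exp_of_nat_mult[symmetric] mult_ac)
  finally show ?thesis .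
qed

lemma prod_exp_indicator_eq:
  assumes "finite B"
  shows "(\<Prod>v\<in>B. ennreal (if P v then exp \<tau> else 1)) = ennreal (exp (\<tau> * card {v \<in> B. P v}))"
proof -
  have "(\<Prod>v\<in>B. ennreal (if P v then exp \<tau> else 1)) = (\<Prod>v\<in>{v \<in> B. P v}. ennreal (exp \<tau>))"
    using assms by (intro prod.mono_neutral_cong_right) auto
  also have "\<dots> = ennreal (exp (\<tau> * card {v \<in> B. P v}))"
    by (simp add: ennreal_power exp_of_nat_mult[symmetric] mult_ac)
  finally show ?thesis .
qed

text \<open>The offset is measured from the right end of the slot, since the part of the slot to the right of
  a child is where its right siblings lie.\<close>

lemma nn_integral_slot_exp:
  assumes a: "0 \<le> a" "0 < s" "a + s \<le> 1" and c: "\<bar>c\<bar> \<le> 2"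
  shows "(\<integral>\<^sup>+u. indicator {a<..<a + s} u * ennreal (exp (c * ((a + s - u) / s))) \<partial>unif)
    \<le> ennreal (s * exp (c / 2 + c\<^sup>2 / 4))"
proof -
  \<comment> \<open>The relative offset is expanded about its mean 1/2: the quadratic remainder is
    at most c^2 / 4, and the linear term integrates to 0 over the slot. \<open>F\<close> is the
    antiderivative.\<close>
  define f where "f u = exp (c / 2) * (1 + c\<^sup>2 / 4 + c * ((a + s - u) / s - 1 / 2))" for u
  define F where "F u = exp (c / 2) * ((1 + c\<^sup>2 / 4 - c / 2) * u - c / (2 * s) * (a + s - u)\<^sup>2)" for u
  have bound: "exp (c * ((a + s - u) / s)) \<le> f u" if "a \<le> u" "u \<le> a + s" for u
  proof -
    define x where "x = (a + s - u) / s - 1 / 2"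
    have "0 \<le> (a + s - u) / s" "(a + s - u) / s \<le> 1" using that a by (auto simp: field_simps)
    then have x: "\<bar>x\<bar> \<le> 1 / 2" unfolding x_def abs_le_iff by (intro conjI; linarith)
    have cx: "\<bar>c * x\<bar> \<le> \<bar>c\<bar> * (1 / 2)" unfolding abs_mult by (rule mult_left_mono[OF x]) simp
    then have "exp (c * x) \<le> 1 + c * x + (c * x)\<^sup>2" using c by (intro exp_le_quadratic) simp
    moreover have "(c * x)\<^sup>2 \<le> c\<^sup>2 / 4"
    proof -
      have "(c * x)\<^sup>2 \<le> (c / 2)\<^sup>2" using cx by (intro abs_le_square_iff[THEN iffD1]) (simp add: abs_mult)
      then show ?thesis by (simp add: power_divide)
    qed
    ultimately have "exp (c * x) \<le> 1 + c\<^sup>2 / 4 + c * x" by simp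
    then have "exp (c / 2) * exp (c * x) \<le> f u" by (simp add: f_def x_def)
    moreover have "c * ((a + s - u) / s) = c / 2 + c * x" by (simp add: x_def algebra_simps)
    ultimately show ?thesis by (simp add: exp_add)
  qed
  have f0: "0 \<le> f u" if "a \<le> u" "u \<le> a + s" for u
    using order.trans[OF exp_ge_zero bound[OF that]] .
  have "(\<integral>\<^sup>+u. indicator {a<..<a + s} u * ennreal (exp (c * ((a + s - u) / s))) \<partial>unif)
     = (\<integral>\<^sup>+u. indicator {a<..<a + s} u * ennreal (exp (c * ((a + s - u) / s))) * indicator {0..<1} u \<partial>lborel)"
    by (rule nn_integral_unif) measurable
  also have "\<dots> \<le> (\<integral>\<^sup>+u. ennreal (f u) * indicator {a..a + s} u \<partial>lborel)"
  proof (rule nn_integral_mono)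
    fix u
    show "indicator {a<..<a + s} u * ennreal (exp (c * ((a + s - u) / s))) * indicator {0..<1} u
      \<le> ennreal (f u) * indicator {a..a + s} u"
    proof (cases "u \<in> {a<..<a + s}")
      case True
      then have "ennreal (exp (c * ((a + s - u) / s))) \<le> ennreal (f u)" by (intro ennreal_leI bound) auto
      then show ?thesis using True by (simp split: split_indicator)
    qed simp
  qed
  also have "\<dots> = ennreal (F (a + s) - F a)"
  proof (rule nn_integral_FTC_Icc)
    show "f \<in> borel_measurable borel" unfolding f_def[abs_def] by measurable
    show "a \<le> a + s" using a by simp
    fix u assume u: "u \<in> {a..a + s}"
    show "0 \<le> f u" using f0 u by simp
    show "(F has_real_derivative f u) (at u)"
      unfolding F_def[abs_def] f_def using a
      by (auto intro!: derivative_eq_intros simp: field_simps power2_eq_square)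
  qed
  also have "F (a + s) - F a = s * (exp (c / 2) * (1 + c\<^sup>2 / 4))"
    using a by (simp add: F_def field_simps power2_eq_square)
  also have "ennreal \<dots> \<le> ennreal (s * (exp (c / 2) * exp (c\<^sup>2 / 4)))"
    using a by (intro ennreal_leI mult_left_mono exp_ge_add_one_self) auto
  finally show ?thesis by (simp add: exp_add)
qed

text \<open>Here \<open>x\<close> stands for the mass of the small vertices outside a path, which is
  nearly 1. The error has a part quadratic in \<tau> and a part |\<tau>| \<eta> for the missing
  mass. The last bound is the cost of one small ancestor once its mean contribution 1/2 has been
  subtracted.\<close>

lemma exponent_bound:
  fixes \<tau> \<eta> x :: real
  assumes \<tau>: "\<bar>\<tau>\<bar> \<le> 1 / 2" and x: "1 - \<eta> \<le> x" "0 \<le> x" "x \<le> 1"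
  defines "c \<equiv> (exp \<tau> - 1) * x"
  shows "c - \<tau> \<le> \<tau>\<^sup>2 + \<bar>\<tau>\<bar> * \<eta>" "\<bar>c\<bar> \<le> 2 * \<bar>\<tau>\<bar>" "c / 2 + c\<^sup>2 / 4 - \<tau> / 2 \<le> 2 * \<tau>\<^sup>2 + \<bar>\<tau>\<bar> * \<eta>"
proof -
  have \<eta>: "0 \<le> \<eta>" using x by simp
  have e: "exp \<tau> - 1 - \<tau> \<le> \<tau>\<^sup>2" "0 \<le> exp \<tau> - 1 - \<tau>"
    using exp_le_quadratic[of \<tau>] exp_ge_add_one_self[of \<tau>] \<tau> by linarith+
  have "c - \<tau> = (exp \<tau> - 1 - \<tau>) * x + \<tau> * (x - 1)" by (simp add: c_def algebra_simps)
  also have "\<dots> \<le> \<tau>\<^sup>2 + \<bar>\<tau>\<bar> * \<eta>"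
  proof (rule add_mono)
    have "(exp \<tau> - 1 - \<tau>) * x \<le> (exp \<tau> - 1 - \<tau>) * 1" using e x by (intro mult_left_mono) auto
    then show "(exp \<tau> - 1 - \<tau>) * x \<le> \<tau>\<^sup>2" using e by simp
    have "\<tau> * (x - 1) \<le> \<bar>\<tau> * (x - 1)\<bar>" by simp
    also have "\<dots> = \<bar>\<tau>\<bar> * \<bar>x - 1\<bar>" by (rule abs_mult)
    also have "\<dots> \<le> \<bar>\<tau>\<bar> * \<eta>" using x by (intro mult_left_mono) auto
    finally show "\<tau> * (x - 1) \<le> \<bar>\<tau>\<bar> * \<eta>" .
  qed
  finally show 1: "c - \<tau> \<le> \<tau>\<^sup>2 + \<bar>\<tau>\<bar> * \<eta>" .
  have "\<tau>\<^sup>2 \<le> \<bar>\<tau>\<bar> * 1"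
    unfolding power2_eq_square using \<tau> by (subst abs_mult_self_eq[symmetric]) (intro mult_left_mono, auto)
  then have "\<bar>exp \<tau> - 1\<bar> \<le> 2 * \<bar>\<tau>\<bar>" using e by (auto simp: abs_le_iff)
  then have "\<bar>exp \<tau> - 1\<bar> * \<bar>x\<bar> \<le> 2 * \<bar>\<tau>\<bar> * 1" using x by (intro mult_mono) auto
  then show 2: "\<bar>c\<bar> \<le> 2 * \<bar>\<tau>\<bar>" by (simp add: c_def abs_mult)
  have "c\<^sup>2 \<le> (2 * \<bar>\<tau>\<bar>)\<^sup>2" using 2 by (intro abs_le_square_iff[THEN iffD1]) simp
  then have "c\<^sup>2 / 4 \<le> \<tau>\<^sup>2" by (simp add: power_mult_distrib)
  moreover have "0 \<le> \<tau>\<^sup>2" "0 \<le> \<bar>\<tau>\<bar> * \<eta>" using \<eta> by auto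
  ultimately show "c / 2 + c\<^sup>2 / 4 - \<tau> / 2 \<le> 2 * \<tau>\<^sup>2 + \<bar>\<tau>\<bar> * \<eta>" using 1 by linarith
qed

text \<open>\<open>\<eta>\<close> bounds the mass that is lost when the hubs and up to
  \<open>H\<close> further vertices are discarded, \<open>H\<close> being the number of vertices
  allowed on a path. What remains can then be treated as if it had mass 1.\<close>

locale weights =
  fixes n I :: nat and p :: "nat \<Rightarrow> real" and s \<eta> :: real and H :: nat
  assumes n_pos: "1 \<le> n" and p_pos: "\<And>i. i \<in> {1..n} \<Longrightarrow> 0 < p i" and p_sum: "(\<Sum>i=1..n. p i) = 1"
    and I_le: "I \<le> n" and s_pos: "0 < s" and small: "\<And>i. i \<in> {1..n} \<Longrightarrow> I < i \<Longrightarrow> p i = s"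
    and s_le: "\<And>i. i \<in> {1..n} \<Longrightarrow> s \<le> p i"
    and H_pos: "1 \<le> H"
    and many_small: "1 - \<eta> \<le> s * (real n - real I - real H)"
begin

lemma small_mass_le: "s * (real n - real I) \<le> 1"
proof -
  have "s * (real n - real I) = (\<Sum>i\<in>{I<..n}. p i)"
    using small I_le by (simp add: of_nat_diff)
  also have "\<dots> \<le> (\<Sum>i=1..n. p i)"
    by (rule sum_mono2) (use p_pos less_imp_le in auto)
  finally show ?thesis using p_sum by simp
qed

lemma small_count:
  assumes "finite S" "card S \<le> H"
  shows "1 - \<eta> \<le> s * card ({I<..n} - S)" "s * card ({I<..n} - S) \<le> 1"
proof -
  have "card ({I<..n} - S) \<le> card {I<..n}" by (rule card_mono) auto
  then have "real (card ({I<..n} - S)) \<le> real n - real I" using I_le by (simp add: of_nat_diff)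
  then have "s * real (card ({I<..n} - S)) \<le> s * (real n - real I)" using s_pos by (simp add: mult_left_mono)
  then show "s * card ({I<..n} - S) \<le> 1" using small_mass_le by linarith
  have "card {I<..n} \<le> card ({I<..n} - S) + card S"
    using diff_card_le_card_Diff[OF assms(1), of "{I<..n}"] by simp
  then have "real n - real I - real H \<le> card ({I<..n} - S)" using assms(2) I_le by simp
  then have "s * (real n - real I - real H) \<le> s * real (card ({I<..n} - S))"
    using s_pos by (simp add: mult_left_mono)
  then show "1 - \<eta> \<le> s * card ({I<..n} - S)" using many_small by linarith
qed

lemma spine_slot_rel_iff:
  assumes l: "l \<in> spine_lists n r (Suc h)"
  shows "spine (slot_rel n p r z) r l \<longleftrightarrow> (\<forall>k<h. z (l ! k) \<in> slot p (l ! Suc k))"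
    and "k < h \<Longrightarrow> l ! k \<in> {1..n} - {r}" "k < h \<Longrightarrow> l ! Suc k \<in> {1..n}" "inj_on (\<lambda>k. l ! k) {..<h}"
proof -
  have len: "length l = Suc h" "distinct l" "set l \<subseteq> {1..n}" "last l = r"
    using l by (auto simp: spine_lists_def)
  have in_n: "l ! k \<in> {1..n}" if "k < Suc h" for k
    using that len nth_mem[of k l] by (simp add: subset_iff)
  have lh: "l ! h = r" using len last_conv_nth[of l] by (cases l) auto
  show 1: "l ! k \<in> {1..n} - {r}" if "k < h" for k
    using that in_n[of k] lh len by (auto simp: nth_eq_iff_index_eq)
  show 2: "l ! Suc k \<in> {1..n}" if "k < h" for k using that in_n by simp
  show "inj_on (\<lambda>k. l ! k) {..<h}" using len by (auto simp: inj_on_def nth_eq_iff_index_eq)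
  show "spine (slot_rel n p r z) r l \<longleftrightarrow> (\<forall>k<h. z (l ! k) \<in> slot p (l ! Suc k))"
    using 1 2 len unfolding spine_def slot_rel_def by auto
qed

text \<open>The vertices of the path below the root have distinct coordinates, which are
  independent, and each of these has to fall into the slot of the next vertex.\<close>

lemma emeasure_spine:
  assumes l: "l \<in> spine_lists n r (Suc h)"
  shows "emeasure (unif_prod ({1..n} - {r})) {z \<in> space (unif_prod ({1..n} - {r})). spine (slot_rel n p r z) r l}
    = (\<Prod>k<h. ennreal (p (l ! Suc k)))" (is "emeasure ?M ?E = _")
proof -
  note L = spine_slot_rel_iff[OF l]
  have E: "?E \<in> sets ?M"
    using pred_slot_rel[where Q = "\<lambda>R z. spine R r l" and n = n and r = r and p = p] by (simp add: pred_def)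
  have "emeasure ?M ?E = (\<integral>\<^sup>+z. indicator ?E z \<partial>?M)" using E by simp
  also have "\<dots> = (\<integral>\<^sup>+z. (\<Prod>k<h. indicator (slot p (l ! Suc k)) (z (l ! k))) \<partial>?M)"
    by (rule nn_integral_cong) (auto simp: L(1) split: split_indicator)
  also have "\<dots> = (\<Prod>k<h. \<integral>\<^sup>+u. indicator (slot p (l ! Suc k)) u \<partial>unif)"
    by (rule nn_integral_unif_prod_inj) (use L in \<open>auto simp: slot_def\<close>)
  also have "\<dots> = (\<Prod>k<h. ennreal (p (l ! Suc k)))"
    using emeasure_unif_slot[OF p_pos p_sum] L(3) by (intro prod.cong) (auto simp: slot_def)
  finally show ?thesis .
qed

end

lemma exp_abs_le: "exp (\<tau> * \<bar>d\<bar>) \<le> exp (\<tau> * d) + exp (- \<tau> * d)" for \<tau> d :: real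
  by (cases "0 \<le> d") simp_all

section \<open>The exponential moment for a single path\<close>

context weights begin

lemma slot_end_le_1: "w \<in> {1..n} \<Longrightarrow> slot_start p w + p w \<le> 1"
  and slot_start_nonneg: "w \<in> {1..n} \<Longrightarrow> 0 \<le> slot_start p w"
  using slot_bounds[OF p_pos p_sum] by auto

lemma small_ancestors_eq_card:
  assumes "length l = Suc h"
  shows "small_ancestors I l = card {k. k < h \<and> I < l ! Suc k}"
proof -
  have "tl l ! k = l ! Suc k" if "k < h" for k using that assms by (simp add: nth_tl)
  then have "{k. k < length (tl l) \<and> I < tl l ! k} = {k. k < h \<and> I < l ! Suc k}" using assms by auto
  then show ?thesis unfolding small_ancestors_def length_filter_conv_card by simp
qed

text \<open>Integrate over the coordinates outside the path first. Given the path, a small vertex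
  off it is a right sibling exactly if its coordinate falls into a set \<open>J\<close>, the union
  over the small ancestors of the part of the slot to the right of the path vertex. The bound for
  the conditional moment is exponential in the measure \<open>Q\<close> of \<open>J\<close>. As
  \<open>Q\<close> is a sum over ancestors, this bound is a product over ancestors, and the integral
  over the path coordinates factorises as well.\<close>

lemma spine_exp_moment:
  assumes l: "l \<in> spine_lists n r (Suc h)" and r: "r \<in> {1..n}" and h: "Suc h \<le> H" and \<tau>: "\<bar>\<tau>\<bar> \<le> 1 / 2"
  shows "(\<integral>\<^sup>+z. indicator {z. spine (slot_rel n p r z) r l} z
      * ennreal (exp (\<tau> * (card (right_sibs n I (slot_rel n p r z) z l) - small_ancestors I l / 2)))
      \<partial>unif_prod ({1..n} - {r}))
    \<le> (\<Prod>k<h. ennreal (p (l ! Suc k))) * ennreal (exp (h * (2 * \<tau>\<^sup>2 + \<bar>\<tau>\<bar> * \<eta>)))"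
    (is "?lhs \<le> _")
proof -
  note L = spine_slot_rel_iff[OF l]
  have len: "length l = Suc h" "distinct l" "set l \<subseteq> {1..n}" "last l = r"
    using l by (auto simp: spine_lists_def)
  have r_l: "r \<in> set l" using len by (cases l) auto
  define V where "V = {1..n} - {r}"
  define A where "A = (\<lambda>k. l ! k) ` {..<h}"
  define B where "B = {I<..n} - set l"
  define K where "K = {k. k < h \<and> I < l ! Suc k}"
  define en where "en k = slot_start p (l ! Suc k) + p (l ! Suc k)" for k
  \<comment> \<open>The conditional moment has the exponent
    \<open>(exp \<tau> - 1) * Q * card B\<close>. Since \<open>Q / s\<close> is the sum of the
    relative offsets in the slots, \<open>c\<close> is the coefficient of each of these
    offsets.\<close>
  define c where "c = (exp \<tau> - 1) * (s * card B)"
  define E where "E = ennreal (exp (- \<tau> * card K / 2))"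
  have finV: "finite V" and finA: "finite A" and finB: "finite B" and finK: "finite K"
    by (auto simp: V_def A_def B_def K_def)
  have AV: "A \<subseteq> V" using L(2) by (auto simp: A_def V_def)
  have AB: "A \<inter> B = {}" using len by (auto simp: A_def B_def)
  have BV: "B \<subseteq> V - A" using AB r_l by (auto simp: B_def V_def)
  have VA: "A \<union> (V - A) = V" using AV by blast
  have lA: "l ! k \<in> A" if "k < h" for k using that by (auto simp: A_def)
  have slot_k: "slot p (l ! Suc k) = {slot_start p (l ! Suc k)<..<en k}" for k by (simp add: slot_def en_def)
  have en01: "en k \<le> 1" "0 \<le> slot_start p (l ! Suc k)" if "k < h" for k
    using slot_end_le_1[OF L(3)[OF that]] slot_start_nonneg[OF L(3)[OF that]] by (auto simp: en_def)
  have pK: "p (l ! Suc k) = s" if "k \<in> K" for k using that small L(3) by (auto simp: K_def)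
  have sB: "1 - \<eta> \<le> s * card B" "s * card B \<le> 1"
    using small_count[of "set l"] h len distinct_card[of l] unfolding B_def by auto
  have cb: "\<bar>c\<bar> \<le> 2" "c / 2 + c\<^sup>2 / 4 - \<tau> / 2 \<le> 2 * \<tau>\<^sup>2 + \<bar>\<tau>\<bar> * \<eta>"
    using exponent_bound(2,3)[OF \<tau> sB(1) _ sB(2)] s_pos \<tau> by (auto simp: c_def)
  \<comment> \<open>The integrand in explicit form: on the event that the path is present, a right
    sibling is recognised by inequalities between coordinates and the right end \<open>en k\<close>
    of a slot. In this form it splits for the iterated integral.\<close>
  define g where "g z = (\<Prod>k<h. indicator (slot p (l ! Suc k)) (z (l ! k)))
    * (\<Prod>v\<in>B. ennreal (if \<exists>k\<in>K. z (l ! k) < z v \<and> z v < en k then exp \<tau> else 1)) * E"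
    for z :: "nat \<Rightarrow> real"
  have coord: "(\<lambda>z. z v) \<in> borel_measurable (unif_prod V)" if "v \<in> V" for v
    by (rule measurable_unif_prod_component[OF that])
  have g_meas: "g \<in> borel_measurable (unif_prod V)"
  proof -
    have 1: "(\<lambda>z. indicator (slot p (l ! Suc k)) (z (l ! k)) :: ennreal) \<in> borel_measurable (unif_prod V)"
      if "k < h" for k
    proof (rule measurable_compose[OF coord])
      show "l ! k \<in> V" using lA[OF that] AV by blast
    qed (simp add: slot_def)
    have 2: "(\<lambda>z. ennreal (if \<exists>k\<in>K. z (l ! k) < z v \<and> z v < en k then exp \<tau> else 1)) \<in> borel_measurable (unif_prod V)"
      if "v \<in> B" for v
    proof -
      have v: "v \<in> V" using that BV by blast
      have "Measurable.pred (unif_prod V) (\<lambda>z. \<exists>k\<in>K. z (l ! k) < z v \<and> z v < en k)"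
      proof (intro pred_intros_finite finK pred_intros_logic)
        fix k assume "k \<in> K"
        then have "l ! k \<in> V" using lA AV by (auto simp: K_def)
        then show "Measurable.pred (unif_prod V) (\<lambda>z. z (l ! k) < z v)"
          using coord[of "l ! k"] coord[OF v] by measurable
        show "Measurable.pred (unif_prod V) (\<lambda>z. z v < en k)" using coord[OF v] by measurable
      qed
      then show ?thesis by measurable
    qed
    have "(\<lambda>z. \<Prod>k<h. indicator (slot p (l ! Suc k)) (z (l ! k)) :: ennreal) \<in> borel_measurable (unif_prod V)"
      by (rule borel_measurable_prod_ennreal) (use 1 in auto)
    moreover have "(\<lambda>z. \<Prod>v\<in>B. ennreal (if \<exists>k\<in>K. z (l ! k) < z v \<and> z v < en k then exp \<tau> else 1))
        \<in> borel_measurable (unif_prod V)"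
      by (rule borel_measurable_prod_ennreal) (rule 2)
    ultimately show ?thesis unfolding g_def[abs_def] by measurable
  qed
  have right: "right_sibs n I (slot_rel n p r z) z l = {v \<in> B. \<exists>k\<in>K. z (l ! k) < z v \<and> z v < en k}"
    if chain: "\<forall>k<h. z (l ! k) \<in> slot p (l ! Suc k)" for z
  proof -
    have "(l ! Suc k, v) \<in> slot_rel n p r z \<and> z (l ! k) < z v \<longleftrightarrow> z (l ! k) < z v \<and> z v < en k"
      if "k < h" "v \<in> {1..n} - set l" for k v
    proof -
      have "z (l ! k) \<in> slot p (l ! Suc k)" using chain that by blast
      moreover have "v \<noteq> r" using that r_l by blast
      ultimately show ?thesis using that L(3)[OF that(1)] by (auto simp: slot_rel_def slot_k)
    qed
    moreover have "v \<in> B \<longleftrightarrow> v \<in> {1..n} - set l \<and> I < v" for v by (auto simp: B_def)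
    ultimately have "v \<in> right_sibs n I (slot_rel n p r z) z l \<longleftrightarrow> v \<in> {v \<in> B. \<exists>k\<in>K. z (l ! k) < z v \<and> z v < en k}" for v
      unfolding right_sibs_def K_def len(1) Suc_less_eq mem_Collect_eq by blast
    then show ?thesis by blast
  qed
  have g_eq: "indicator {z. spine (slot_rel n p r z) r l} z
      * ennreal (exp (\<tau> * (card (right_sibs n I (slot_rel n p r z) z l) - small_ancestors I l / 2))) = g z" for z
  proof (cases "\<forall>k<h. z (l ! k) \<in> slot p (l ! Suc k)")
    case True
    have "exp (\<tau> * (card (right_sibs n I (slot_rel n p r z) z l) - small_ancestors I l / 2))
       = exp (\<tau> * card {v \<in> B. \<exists>k\<in>K. z (l ! k) < z v \<and> z v < en k}) * exp (- \<tau> * card K / 2)"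
      unfolding right[OF True] small_ancestors_eq_card[OF len(1)] K_def[symmetric]
      by (simp add: exp_add[symmetric] algebra_simps)
    then show ?thesis using True
      by (simp add: g_def L(1) prod_exp_indicator_eq[OF finB] E_def ennreal_mult)
  next
    case False
    then obtain k where k: "k < h" "z (l ! k) \<notin> slot p (l ! Suc k)" by blast
    have "(\<Prod>k<h. indicator (slot p (l ! Suc k)) (z (l ! k)) :: ennreal) = 0"
      by (rule prod_zero) (use k in \<open>auto intro!: bexI[of _ k]\<close>)
    then show ?thesis using False by (simp add: g_def L(1))
  qed
  define G where "G k u = indicator (slot p (l ! Suc k)) u
    * (if k \<in> K then ennreal (exp (c * ((en k - u) / s))) * ennreal (exp (- \<tau> / 2)) else 1)" for k u
  have inner: "(\<integral>\<^sup>+y. g (merge A (V - A) (x, y)) \<partial>unif_prod (V - A)) \<le> (\<Prod>k<h. G k (x (l ! k)))" for x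
  proof (cases "\<forall>k<h. x (l ! k) \<in> slot p (l ! Suc k)")
    case False
    then obtain k where k: "k < h" "x (l ! k) \<notin> slot p (l ! Suc k)" by blast
    have "g (merge A (V - A) (x, y)) = 0" for y
    proof -
      have "(\<Prod>k<h. indicator (slot p (l ! Suc k)) (merge A (V - A) (x, y) (l ! k)) :: ennreal) = 0"
        by (rule prod_zero) (use k lA in \<open>auto intro!: bexI[of _ k]\<close>)
      then show ?thesis by (simp add: g_def)
    qed
    then show ?thesis by simp
  next
    case True
    define J where "J = (\<Union>k\<in>K. {x (l ! k)<..<en k})"
    define Q where "Q = (\<Sum>k\<in>K. en k - x (l ! k))"
    have xk: "slot_start p (l ! Suc k) < x (l ! k)" "x (l ! k) < en k" if "k < h" for k
      using True that by (auto simp: slot_k)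
    have J_meas: "J \<in> sets borel" unfolding J_def using finK by auto
    have Q0: "0 \<le> Q" unfolding Q_def using xk by (intro sum_nonneg) (auto simp: K_def less_imp_le)
    have disj: "disjoint_family_on (\<lambda>k. {x (l ! k)<..<en k}) K"
      unfolding disjoint_family_on_def
    proof (intro ballI impI)
      fix k k' assume k: "k \<in> K" "k' \<in> K" "k \<noteq> k'"
      then have kh: "k < h" "k' < h" by (auto simp: K_def)
      then have "l ! Suc k \<noteq> l ! Suc k'" using k len by (simp add: nth_eq_iff_index_eq)
      have "u \<notin> {x (l ! k')<..<en k'}" if "u \<in> {x (l ! k)<..<en k}" for u
      proof
        assume "u \<in> {x (l ! k')<..<en k'}"
        then have "u \<in> slot p (l ! Suc k)" "u \<in> slot p (l ! Suc k')"
          using that xk[OF kh(1)] xk[OF kh(2)] by (auto simp: slot_k)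
        then show False using slot_unique[OF p_pos p_sum L(3)[OF kh(1)] L(3)[OF kh(2)]]
          \<open>l ! Suc k \<noteq> l ! Suc k'\<close> by blast
      qed
      then show "{x (l ! k)<..<en k} \<inter> {x (l ! k')<..<en k'} = {}" by blast
    qed
    have "emeasure unif J = (\<Sum>k\<in>K. emeasure unif {x (l ! k)<..<en k})"
      unfolding J_def by (rule sum_emeasure[symmetric]) (use finK disj in auto)
    also have "\<dots> = (\<Sum>k\<in>K. ennreal (en k - x (l ! k)))"
    proof (rule sum.cong[OF refl])
      fix k assume "k \<in> K"
      then have "k < h" by (simp add: K_def)
      then show "emeasure unif {x (l ! k)<..<en k} = ennreal (en k - x (l ! k))"
        using xk[of k] en01[of k] by (intro emeasure_unif_interval) auto
    qed
    also have "\<dots> = ennreal Q" unfolding Q_def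
      by (rule sum_ennreal) (use xk in \<open>auto simp: K_def less_imp_le\<close>)
    finally have J: "emeasure unif J = ennreal Q" .
    have merge: "g (merge A (V - A) (x, y)) = (\<Prod>v\<in>B. ennreal (if y v \<in> J then exp \<tau> else 1)) * E" for y
    proof -
      have mk: "merge A (V - A) (x, y) (l ! k) = x (l ! k)" if "k < h" for k using lA[OF that] by simp
      have mv: "merge A (V - A) (x, y) v = y v" if "v \<in> B" for v using that BV by (auto simp: merge_def)
      have "(\<Prod>k<h. indicator (slot p (l ! Suc k)) (merge A (V - A) (x, y) (l ! k)) :: ennreal) = 1"
        by (rule prod.neutral) (use mk True in auto)
      moreover have "(\<exists>k\<in>K. merge A (V - A) (x, y) (l ! k) < merge A (V - A) (x, y) v
          \<and> merge A (V - A) (x, y) v < en k) \<longleftrightarrow> y v \<in> J" if "v \<in> B" for v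
        using mk mv[OF that] by (auto simp: J_def K_def)
      ultimately show ?thesis by (simp add: g_def cong: prod.cong)
    qed
    have "(\<integral>\<^sup>+y. g (merge A (V - A) (x, y)) \<partial>unif_prod (V - A))
       = (\<integral>\<^sup>+y. (\<Prod>v\<in>B. ennreal (if y v \<in> J then exp \<tau> else 1)) \<partial>unif_prod (V - A)) * E"
      unfolding merge
    proof (rule nn_integral_multc)
      show "(\<lambda>y. \<Prod>v\<in>B. ennreal (if y v \<in> J then exp \<tau> else 1)) \<in> borel_measurable (unif_prod (V - A))"
      proof (rule borel_measurable_prod_ennreal)
        fix v assume "v \<in> B"
        then have "v \<in> V - A" using BV by blast
        then show "(\<lambda>y. ennreal (if y v \<in> J then exp \<tau> else 1)) \<in> borel_measurable (unif_prod (V - A))"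
          by (rule measurable_compose[OF measurable_unif_prod_component]) (use J_meas in measurable)
      qed
    qed
    also have "\<dots> \<le> ennreal (exp ((exp \<tau> - 1) * Q * card B)) * E"
      by (intro mult_right_mono nn_integral_exp_count J_meas J Q0 BV) (use finV in auto)
    also have "\<dots> = (\<Prod>k\<in>K. ennreal (exp (c * ((en k - x (l ! k)) / s))) * ennreal (exp (- \<tau> / 2)))"
    proof -
      have "(\<Prod>k\<in>K. ennreal (exp (c * ((en k - x (l ! k)) / s))) * ennreal (exp (- \<tau> / 2)))
         = ennreal (\<Prod>k\<in>K. exp (c * ((en k - x (l ! k)) / s) + (- \<tau> / 2)))"
        by (simp only: prod_ennreal ennreal_mult[symmetric] exp_add exp_ge_zero mult_nonneg_nonneg)
      also have "(\<Prod>k\<in>K. exp (c * ((en k - x (l ! k)) / s) + (- \<tau> / 2)))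
         = exp (\<Sum>k\<in>K. c * ((en k - x (l ! k)) / s) + (- \<tau> / 2))"
        using finK by (simp only: exp_sum)
      also have "(\<Sum>k\<in>K. c * ((en k - x (l ! k)) / s) + (- \<tau> / 2)) = c / s * Q + (- \<tau> * card K / 2)"
        unfolding sum.distrib Q_def sum_distrib_left by simp
      also have "c / s * Q = (exp \<tau> - 1) * Q * card B" using s_pos by (simp add: c_def)
      finally show ?thesis by (simp only: exp_add ennreal_mult exp_ge_zero E_def)
    qed
    also have "\<dots> = (\<Prod>k\<in>K. G k (x (l ! k)))"
      by (rule prod.cong) (use True in \<open>auto simp: G_def K_def\<close>)
    also have "\<dots> = (\<Prod>k<h. G k (x (l ! k)))"
      by (rule prod.mono_neutral_left) (use True in \<open>auto simp: G_def K_def\<close>)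
    finally show ?thesis .
  qed
  have G_meas: "G k \<in> borel_measurable borel" for k
    unfolding G_def[abs_def] slot_def by (cases "k \<in> K") measurable
  have G_int: "(\<integral>\<^sup>+u. G k u \<partial>unif) \<le> ennreal (p (l ! Suc k)) * ennreal (exp (2 * \<tau>\<^sup>2 + \<bar>\<tau>\<bar> * \<eta>))"
    if k: "k < h" for k
  proof (cases "k \<in> K")
    case True
    let ?a = "slot_start p (l ! Suc k)"
    have en: "en k = ?a + s" using pK[OF True] by (simp add: en_def)
    have slot_eq: "slot p (l ! Suc k) = {?a<..<?a + s}" using slot_k en by simp
    have "(\<integral>\<^sup>+u. G k u \<partial>unif)
      = (\<integral>\<^sup>+u. indicator {?a<..<?a + s} u * ennreal (exp (c * ((?a + s - u) / s))) * ennreal (exp (- \<tau> / 2)) \<partial>unif)"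
      using True by (simp add: G_def slot_eq en mult.assoc)
    also have "\<dots> = (\<integral>\<^sup>+u. indicator {?a<..<?a + s} u * ennreal (exp (c * ((?a + s - u) / s))) \<partial>unif) * ennreal (exp (- \<tau> / 2))"
      by (rule nn_integral_multc) measurable
    also have "\<dots> \<le> ennreal (s * exp (c / 2 + c\<^sup>2 / 4)) * ennreal (exp (- \<tau> / 2))"
      by (intro mult_right_mono nn_integral_slot_exp) (use en01[OF k] en s_pos cb in auto)
    also have "\<dots> = ennreal (s * exp (c / 2 + c\<^sup>2 / 4 - \<tau> / 2))"
      using s_pos by (simp add: ennreal_mult[symmetric] exp_add[symmetric] exp_diff field_simps exp_minus)
    also have "\<dots> \<le> ennreal (s * exp (2 * \<tau>\<^sup>2 + \<bar>\<tau>\<bar> * \<eta>))"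
      using cb(2) s_pos by (intro ennreal_leI mult_left_mono) auto
    finally show ?thesis using pK[OF True] s_pos by (simp add: ennreal_mult)
  next
    case False
    have "0 \<le> \<eta>" using sB by linarith
    \<comment> \<open>A hub ancestor takes no part in the count. Its factor 1 is replaced by the
      larger exponential so that the bound is the same for every ancestor.\<close>
    then have ge1: "1 \<le> ennreal (exp (2 * \<tau>\<^sup>2 + \<bar>\<tau>\<bar> * \<eta>))"
      by (simp add: ennreal_1[symmetric] del: ennreal_1)
    have eq: "(\<integral>\<^sup>+u. G k u \<partial>unif) = ennreal (p (l ! Suc k))"
      using False emeasure_unif_slot[OF p_pos p_sum L(3)[OF k]] by (simp add: G_def slot_def)
    show ?thesis unfolding eq using mult_left_mono[OF ge1, of "ennreal (p (l ! Suc k))"] by simp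
  qed
  have g_meas': "g \<in> borel_measurable (\<Pi>\<^sub>M i\<in>A \<union> (V - A). unif)"
    using g_meas unfolding VA unif_prod_def .
  have "?lhs = (\<integral>\<^sup>+z. g z \<partial>(\<Pi>\<^sub>M i\<in>A \<union> (V - A). unif))"
    unfolding g_eq V_def[symmetric] VA unif_prod_def ..
  also have "\<dots> = (\<integral>\<^sup>+x. (\<integral>\<^sup>+y. g (merge A (V - A) (x, y)) \<partial>unif_prod (V - A)) \<partial>unif_prod A)"
    unfolding unif_prod_def
    by (rule unif_prod.product_nn_integral_fold[OF _ finA _ g_meas']) (use finV in auto)
  also have "\<dots> \<le> (\<integral>\<^sup>+x. (\<Prod>k<h. G k (x (l ! k))) \<partial>unif_prod A)"
    by (rule nn_integral_mono) (rule inner)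
  also have "\<dots> = (\<Prod>k<h. \<integral>\<^sup>+u. G k u \<partial>unif)"
    by (rule nn_integral_unif_prod_inj[OF finA _ L(4)]) (use G_meas A_def in auto)
  also have "\<dots> \<le> (\<Prod>k<h. ennreal (p (l ! Suc k)) * ennreal (exp (2 * \<tau>\<^sup>2 + \<bar>\<tau>\<bar> * \<eta>)))"
    by (rule prod_mono_ennreal) (use G_int in auto)
  also have "\<dots> = (\<Prod>k<h. ennreal (p (l ! Suc k))) * ennreal (exp (h * (2 * \<tau>\<^sup>2 + \<bar>\<tau>\<bar> * \<eta>)))"
    by (simp add: prod.distrib ennreal_power exp_of_nat_mult)
  finally show ?thesis .
qed

end

section \<open>Chernoff bounds for paths and for windows\<close>

context weights begin

text \<open>Markov's inequality with the exponential moments of parameters \<tau> and -\<tau>, whose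
  sum dominates that of the absolute deviation. The probability of the path stays as a separate
  factor, which is what makes the sum over all paths finite in the limit of many vertices.\<close>

lemma emeasure_spine_unbalanced:
  assumes l: "l \<in> spine_lists n r (Suc h)" and r: "r \<in> {1..n}" and h: "Suc h \<le> H"
    and \<tau>: "0 < \<tau>" "\<tau> \<le> 1 / 2"
  shows "emeasure (unif_prod ({1..n} - {r})) {z \<in> space (unif_prod ({1..n} - {r})). spine (slot_rel n p r z) r l \<and>
      t < \<bar>real (card (right_sibs n I (slot_rel n p r z) z l)) - small_ancestors I l / 2\<bar>}
    \<le> (\<Prod>k<h. ennreal (p (l ! Suc k))) * ennreal (2 * exp (H * (2 * \<tau>\<^sup>2 + \<tau> * \<eta>) - \<tau> * t))"
    (is "emeasure ?M ?E \<le> _")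
proof -
  let ?D = "\<lambda>z. real (card (right_sibs n I (slot_rel n p r z) z l)) - small_ancestors I l / 2"
  let ?S = "\<lambda>z. indicator {z. spine (slot_rel n p r z) r l} z :: ennreal"
  let ?P = "\<Prod>k<h. ennreal (p (l ! Suc k))"
  have S_pred: "Measurable.pred ?M (\<lambda>z. spine (slot_rel n p r z) r l)"
    by (rule pred_slot_rel[where Q = "\<lambda>R z. spine R r l"]) simp
  have D_pred: "Measurable.pred ?M (\<lambda>z. ?D z \<in> X)" for X
  proof (rule pred_slot_rel[where Q = "\<lambda>R z. real (card (right_sibs n I R z l)) - small_ancestors I l / 2 \<in> X"])
    fix R
    show "Measurable.pred ?M (\<lambda>z. real (card (right_sibs n I R z l)) - small_ancestors I l / 2 \<in> X)"
      by (rule pred_right_sibs[OF l, where Q = "\<lambda>A z. real (card A) - small_ancestors I l / 2 \<in> X"]) simp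
  qed
  have D_meas: "?D \<in> borel_measurable ?M"
  proof (rule measurableI)
    fix X
    have "?D -` X \<inter> space ?M = {z \<in> space ?M. ?D z \<in> X}" by blast
    then show "?D -` X \<inter> space ?M \<in> sets ?M" using D_pred[of X] by (simp only: pred_def)
  qed simp
  have S_meas: "?S \<in> borel_measurable ?M"
    using S_pred by (intro borel_measurable_indicator') (simp add: pred_def)
  have E: "?E \<in> sets ?M"
  proof -
    have "Measurable.pred ?M (\<lambda>z. t < \<bar>?D z\<bar>)" using D_pred[of "{d. t < \<bar>d\<bar>}"] by simp
    then have "Measurable.pred ?M (\<lambda>z. spine (slot_rel n p r z) r l \<and> t < \<bar>?D z\<bar>)"
      using S_pred by (intro pred_intros_logic)
    then show ?thesis by (simp add: pred_def)
  qed
  have exp_meas: "(\<lambda>z. ?S z * ennreal (exp (\<sigma> * ?D z))) \<in> borel_measurable ?M" for \<sigma>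
    using S_meas D_meas by measurable
  have bound: "(\<integral>\<^sup>+z. ?S z * ennreal (exp (\<sigma> * ?D z)) \<partial>?M) \<le> ?P * ennreal (exp (H * (2 * \<tau>\<^sup>2 + \<tau> * \<eta>)))"
    if "\<bar>\<sigma>\<bar> = \<tau>" for \<sigma>
  proof -
    have "(\<integral>\<^sup>+z. ?S z * ennreal (exp (\<sigma> * ?D z)) \<partial>?M) \<le> ?P * ennreal (exp (h * (2 * \<sigma>\<^sup>2 + \<bar>\<sigma>\<bar> * \<eta>)))"
      by (rule spine_exp_moment[OF l r h]) (use that \<tau> in simp)
    also have "\<dots> \<le> ?P * ennreal (exp (H * (2 * \<tau>\<^sup>2 + \<tau> * \<eta>)))"
    proof -
      have "0 \<le> \<eta>" using small_count[of "{}"] by simp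
      then have "h * (2 * \<tau>\<^sup>2 + \<tau> * \<eta>) \<le> H * (2 * \<tau>\<^sup>2 + \<tau> * \<eta>)"
        using h \<tau> by (intro mult_right_mono) auto
      moreover have "\<sigma>\<^sup>2 = \<tau>\<^sup>2" using that by (metis power2_abs)
      ultimately show ?thesis using that by (intro mult_left_mono ennreal_leI) auto
    qed
    finally show ?thesis .
  qed
  have "emeasure ?M ?E = (\<integral>\<^sup>+z. indicator ?E z \<partial>?M)" using E by simp
  also have "\<dots> \<le> (\<integral>\<^sup>+z. ennreal (exp (- \<tau> * t)) * (?S z * ennreal (exp (\<tau> * ?D z)) + ?S z * ennreal (exp (- \<tau> * ?D z))) \<partial>?M)"
  proof (rule nn_integral_mono)
    fix z
    show "indicator ?E z \<le> ennreal (exp (- \<tau> * t)) * (?S z * ennreal (exp (\<tau> * ?D z)) + ?S z * ennreal (exp (- \<tau> * ?D z)))"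
    proof (cases "z \<in> ?E")
      case True
      then have S1: "?S z = 1" and tD: "t < \<bar>?D z\<bar>" by auto
      have "1 \<le> exp (- \<tau> * t) * (exp (\<tau> * ?D z) + exp (- \<tau> * ?D z))"
      proof -
        have "\<tau> * t \<le> \<tau> * \<bar>?D z\<bar>" using tD \<tau> by (intro mult_left_mono) auto
        then have "exp (\<tau> * t) \<le> exp (\<tau> * \<bar>?D z\<bar>)" by simp
        also have "\<dots> \<le> exp (\<tau> * ?D z) + exp (- \<tau> * ?D z)" by (rule exp_abs_le)
        finally have "exp (- \<tau> * t) * exp (\<tau> * t) \<le> exp (- \<tau> * t) * (exp (\<tau> * ?D z) + exp (- \<tau> * ?D z))"
          by (intro mult_left_mono) auto
        then show ?thesis by (simp add: exp_minus)
      qed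
      then have "ennreal 1 \<le> ennreal (exp (- \<tau> * t) * (exp (\<tau> * ?D z) + exp (- \<tau> * ?D z)))" by (rule ennreal_leI)
      then show ?thesis using True S1 by (simp add: ennreal_mult ennreal_plus)
    qed simp
  qed
  also have "\<dots> = ennreal (exp (- \<tau> * t)) * ((\<integral>\<^sup>+z. ?S z * ennreal (exp (\<tau> * ?D z)) \<partial>?M)
      + (\<integral>\<^sup>+z. ?S z * ennreal (exp (- \<tau> * ?D z)) \<partial>?M))"
    using exp_meas[of \<tau>] exp_meas[of "- \<tau>"] by (simp add: nn_integral_cmult nn_integral_add)
  also have "\<dots> \<le> ennreal (exp (- \<tau> * t)) * (?P * ennreal (exp (H * (2 * \<tau>\<^sup>2 + \<tau> * \<eta>)))
      + ?P * ennreal (exp (H * (2 * \<tau>\<^sup>2 + \<tau> * \<eta>))))"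
    by (intro mult_left_mono add_mono bound) (use \<tau> in auto)
  also have "\<dots> = ?P * ennreal (2 * exp (H * (2 * \<tau>\<^sup>2 + \<tau> * \<eta>) - \<tau> * t))"
  proof -
    let ?X = "exp (H * (2 * \<tau>\<^sup>2 + \<tau> * \<eta>))"
    have "exp (- \<tau> * t) * (?X + ?X) = 2 * exp (H * (2 * \<tau>\<^sup>2 + \<tau> * \<eta>) - \<tau> * t)"
      by (simp add: exp_diff exp_minus divide_inverse)
    then have "ennreal (exp (- \<tau> * t)) * (ennreal ?X + ennreal ?X)
        = ennreal (2 * exp (H * (2 * \<tau>\<^sup>2 + \<tau> * \<eta>) - \<tau> * t))"
      by (simp only: ennreal_plus[symmetric] ennreal_mult[symmetric] exp_ge_zero add_nonneg_nonneg)
    moreover have "ennreal (exp (- \<tau> * t)) * (?P * ennreal ?X + ?P * ennreal ?X)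
        = ?P * (ennreal (exp (- \<tau> * t)) * (ennreal ?X + ennreal ?X))"
      by (simp only: distrib_left mult.left_commute)
    ultimately show ?thesis by simp
  qed
  finally show ?thesis .
qed

text \<open>The small vertices other than the root fall independently into a window of measure
  \<open>a\<close>. Their number has mean close to a / s, because \<open>s * card B\<close> is
  nearly 1. The division by \<open>s\<close> in the exponent appears because the deviation is
  measured in mass and the count in units of \<open>s\<close>.\<close>

lemma emeasure_uneven_window_single:
  assumes r: "r \<in> {1..n}" and i: "i \<in> {1..I}" and a: "0 \<le> a" "a \<le> p i"
    and \<tau>: "0 < \<tau>" "\<tau> \<le> 1 / 2"
  shows "emeasure (unif_prod ({1..n} - {r})) {z \<in> space (unif_prod ({1..n} - {r})).
      \<delta> < \<bar>s * real (window_count n I p r z i a) - a\<bar>}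
    \<le> ennreal (2 * exp ((p i * (\<tau>\<^sup>2 + \<tau> * \<eta>) - \<tau> * \<delta>) / s))"
    (is "emeasure ?M ?E \<le> _")
proof -
  define V where "V = {1..n} - {r}"
  define B where "B = {I<..n} - {r}"
  define J where "J = slot p i \<inter> {..slot_start p i + a}"
  have i_n: "i \<in> {1..n}" using i I_le by auto
  have BV: "B \<subseteq> V" "finite V" "finite B" by (auto simp: B_def V_def)
  have J_meas: "J \<in> sets borel" by (auto simp: J_def slot_def)
  have J: "emeasure unif J = ennreal a"
  proof -
    have "emeasure unif {slot_start p i<..<slot_start p i + a} \<le> emeasure unif J"
      using a J_meas by (intro emeasure_mono) (auto simp: J_def slot_def)
    moreover have "emeasure unif {slot_start p i<..<slot_start p i + a} = ennreal a"
      using slot_end_le_1[OF i_n] slot_start_nonneg[OF i_n] a by (subst emeasure_unif_interval) auto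
    moreover have "emeasure unif J \<le> emeasure unif ({slot_start p i<..<slot_start p i + a} \<union> {slot_start p i + a})"
      using a by (intro emeasure_mono) (auto simp: J_def slot_def)
    moreover have "\<dots> \<le> emeasure unif {slot_start p i<..<slot_start p i + a} + emeasure unif {slot_start p i + a}"
      by (rule emeasure_subadditive) auto
    moreover have "emeasure unif {slot_start p i + a} = 0" by (rule emeasure_unif_countable) simp
    ultimately show ?thesis by simp
  qed
  have count: "window_count n I p r z i a = card {v \<in> B. z v \<in> J}" for z
  proof -
    have "{v. I < v \<and> (i, v) \<in> slot_rel n p r z \<and> z v \<le> slot_start p i + a} = {v \<in> B. z v \<in> J}"
      using i_n by (auto simp: slot_rel_def B_def J_def)
    then show ?thesis by (simp add: window_count_def)
  qed
  have sB: "1 - \<eta> \<le> s * card B" "s * card B \<le> 1"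
    using small_count[of "{r}"] H_pos unfolding B_def by auto
  let ?N = "\<lambda>z. real (card {v \<in> B. z v \<in> J})"
  have pred_J: "Measurable.pred ?M (\<lambda>z. z v \<in> J)" if "v \<in> B" for v
  proof -
    have "v \<in> {1..n} - {r}" using that by (auto simp: B_def)
    then show ?thesis by (rule pred_coordinate) (use J_meas in measurable)
  qed
  have N_pred: "Measurable.pred ?M (\<lambda>z. ?N z \<in> X)" for X
    by (rule pred_set_valued[where F = B and S = "\<lambda>z. {v \<in> B. z v \<in> J}" and Q = "\<lambda>A z. real (card A) \<in> X"])
      (use BV pred_J in auto)
  have N_meas: "?N \<in> borel_measurable ?M"
  proof (rule measurableI)
    fix X
    have "?N -` X \<inter> space ?M = {z \<in> space ?M. ?N z \<in> X}" by blast
    then show "?N -` X \<inter> space ?M \<in> sets ?M" using N_pred[of X] by (simp only: pred_def)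
  qed simp
  have E: "?E \<in> sets ?M"
    using N_pred[of "{d. \<delta> < \<bar>s * d - a\<bar>}"] unfolding count by (simp add: pred_def)
  have exp_meas: "(\<lambda>z. ennreal (exp (\<sigma> * ?N z))) \<in> borel_measurable ?M" for \<sigma>
    using N_meas by measurable
  have bound: "(\<integral>\<^sup>+z. ennreal (exp (\<sigma> * ?N z)) \<partial>?M) * ennreal (exp (- \<sigma> * a / s))
      \<le> ennreal (exp (p i * (\<tau>\<^sup>2 + \<tau> * \<eta>) / s))" if "\<bar>\<sigma>\<bar> = \<tau>" for \<sigma>
  proof -
    have "(\<integral>\<^sup>+z. ennreal (exp (\<sigma> * ?N z)) \<partial>?M) \<le> ennreal (exp ((exp \<sigma> - 1) * a * card B))"
      using nn_integral_exp_count[OF BV(2,1) J_meas J a(1), of \<sigma>]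
      by (simp add: prod_exp_indicator_eq[OF BV(3)] V_def)
    then have "(\<integral>\<^sup>+z. ennreal (exp (\<sigma> * ?N z)) \<partial>?M) * ennreal (exp (- \<sigma> * a / s))
        \<le> ennreal (exp ((exp \<sigma> - 1) * a * card B)) * ennreal (exp (- \<sigma> * a / s))"
      by (rule mult_right_mono) simp
    also have "\<dots> = ennreal (exp ((exp \<sigma> - 1) * a * card B + (- \<sigma> * a / s)))"
      by (simp only: ennreal_mult[symmetric] exp_add exp_ge_zero)
    also have "(exp \<sigma> - 1) * a * card B + (- \<sigma> * a / s) = a / s * ((exp \<sigma> - 1) * (s * card B) - \<sigma>)"
      using s_pos by (simp add: field_simps)
    also have "ennreal (exp \<dots>) \<le> ennreal (exp (p i * (\<tau>\<^sup>2 + \<tau> * \<eta>) / s))"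
    proof (intro ennreal_leI, subst exp_le_cancel_iff)
      have "(exp \<sigma> - 1) * (s * card B) - \<sigma> \<le> \<sigma>\<^sup>2 + \<bar>\<sigma>\<bar> * \<eta>"
        by (rule exponent_bound(1)) (use that \<tau> sB s_pos in auto)
      also have "\<sigma>\<^sup>2 = \<tau>\<^sup>2" using that by (metis power2_abs)
      finally have "a / s * ((exp \<sigma> - 1) * (s * card B) - \<sigma>) \<le> a / s * (\<tau>\<^sup>2 + \<tau> * \<eta>)"
        using that a s_pos by (intro mult_left_mono) auto
      also have "\<dots> \<le> p i / s * (\<tau>\<^sup>2 + \<tau> * \<eta>)"
        using a s_pos \<tau> sB by (intro mult_right_mono divide_right_mono) auto
      finally show "a / s * ((exp \<sigma> - 1) * (s * card B) - \<sigma>) \<le> p i * (\<tau>\<^sup>2 + \<tau> * \<eta>) / s" by simp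
    qed
    finally show ?thesis .
  qed
  let ?f = "\<lambda>\<sigma> z. ennreal (exp (\<sigma> * ?N z)) * ennreal (exp (- \<sigma> * a / s))"
  have "emeasure ?M ?E = (\<integral>\<^sup>+z. indicator ?E z \<partial>?M)" using E by simp
  also have "\<dots> \<le> (\<integral>\<^sup>+z. ennreal (exp (- \<tau> * \<delta> / s)) * (?f \<tau> z + ?f (- \<tau>) z) \<partial>?M)"
  proof (rule nn_integral_mono)
    fix z
    show "indicator ?E z \<le> ennreal (exp (- \<tau> * \<delta> / s)) * (?f \<tau> z + ?f (- \<tau>) z)"
    proof (cases "z \<in> ?E")
      case True
      define d where "d = ?N z - a / s"
      have "\<delta> < \<bar>s * ?N z - a\<bar>" using True count by simp
      moreover have "s * ?N z - a = s * d" using s_pos by (simp add: d_def field_simps)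
      ultimately have "\<delta> / s < \<bar>d\<bar>" using s_pos by (simp add: abs_mult field_simps)
      then have "\<tau> * (\<delta> / s) \<le> \<tau> * \<bar>d\<bar>" using \<tau> by (intro mult_left_mono) auto
      then have "exp (\<tau> * (\<delta> / s)) \<le> exp (\<tau> * \<bar>d\<bar>)" by simp
      also have "\<dots> \<le> exp (\<tau> * d) + exp (- \<tau> * d)" by (rule exp_abs_le)
      finally have "exp (- \<tau> * \<delta> / s) * exp (\<tau> * (\<delta> / s)) \<le> exp (- \<tau> * \<delta> / s) * (exp (\<tau> * d) + exp (- \<tau> * d))"
        by (intro mult_left_mono) auto
      then have "1 \<le> exp (- \<tau> * \<delta> / s) * (exp (\<tau> * d) + exp (- \<tau> * d))" by (simp add: exp_minus)
      moreover have e: "exp (\<sigma> * d) = exp (\<sigma> * ?N z) * exp (- \<sigma> * a / s)" for \<sigma>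
        by (simp add: d_def exp_add[symmetric] algebra_simps)
      ultimately have "1 \<le> exp (- \<tau> * \<delta> / s) * (exp (\<tau> * ?N z) * exp (- \<tau> * a / s)
          + exp (- \<tau> * ?N z) * exp (- (- \<tau>) * a / s))" unfolding e by simp
      then have "ennreal 1 \<le> ennreal (exp (- \<tau> * \<delta> / s) * (exp (\<tau> * ?N z) * exp (- \<tau> * a / s)
          + exp (- \<tau> * ?N z) * exp (- (- \<tau>) * a / s)))" by (rule ennreal_leI)
      then show ?thesis using True by (simp add: ennreal_mult ennreal_plus)
    qed simp
  qed
  also have "\<dots> = ennreal (exp (- \<tau> * \<delta> / s)) * ((\<integral>\<^sup>+z. ennreal (exp (\<tau> * ?N z)) \<partial>?M) * ennreal (exp (- \<tau> * a / s))
      + (\<integral>\<^sup>+z. ennreal (exp (- \<tau> * ?N z)) \<partial>?M) * ennreal (exp (- (- \<tau>) * a / s)))"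
    using exp_meas[of \<tau>] exp_meas[of "- \<tau>"] by (simp add: nn_integral_cmult nn_integral_add nn_integral_multc)
  also have "\<dots> \<le> ennreal (exp (- \<tau> * \<delta> / s)) * (ennreal (exp (p i * (\<tau>\<^sup>2 + \<tau> * \<eta>) / s)) + ennreal (exp (p i * (\<tau>\<^sup>2 + \<tau> * \<eta>) / s)))"
    by (intro mult_left_mono add_mono bound) (use \<tau> in auto)
  also have "\<dots> = ennreal (2 * exp ((p i * (\<tau>\<^sup>2 + \<tau> * \<eta>) - \<tau> * \<delta>) / s))"
  proof -
    have "exp (- \<tau> * \<delta> / s) * (exp (p i * (\<tau>\<^sup>2 + \<tau> * \<eta>) / s) + exp (p i * (\<tau>\<^sup>2 + \<tau> * \<eta>) / s))
        = 2 * exp ((p i * (\<tau>\<^sup>2 + \<tau> * \<eta>) - \<tau> * \<delta>) / s)"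
      by (simp add: diff_divide_distrib exp_diff exp_minus field_simps)
    then show ?thesis by (simp only: ennreal_plus[symmetric] ennreal_mult[symmetric] exp_ge_zero add_nonneg_nonneg)
  qed
  finally show ?thesis .
qed

end

subsection \<open>Weighted arborescences\<close>

definition map_rel :: "'a set \<Rightarrow> ('a \<Rightarrow> 'a) \<Rightarrow> ('a \<times> 'a) set" where
  "map_rel Y g = {(g v, v) |v. v \<in> Y}"

text \<open>A rooted spanning tree is encoded by its parent map. Reachability of every vertex from
  \<open>r\<close> rules out cycles, and extensionality gives each tree exactly one code.\<close>

definition arborescences :: "'a set \<Rightarrow> 'a \<Rightarrow> ('a \<Rightarrow> 'a) set" where
  "arborescences X r = {g \<in> (X - {r}) \<rightarrow>\<^sub>E X. \<forall>v\<in>X. (r, v) \<in> (map_rel (X - {r}) g)\<^sup>*}"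

lemma finite_arborescences: "finite X \<Longrightarrow> finite (arborescences X r)"
  by (rule finite_subset[of _ "(X - {r}) \<rightarrow>\<^sub>E X"]) (auto simp: arborescences_def intro: finite_PiE)

lemma arborescence_in: "g \<in> arborescences X r \<Longrightarrow> v \<in> X - {r} \<Longrightarrow> g v \<in> X"
  unfolding arborescences_def by (blast dest: PiE_mem)

lemma no_self_loop:
  assumes "(r, v) \<in> R\<^sup>*" "v \<noteq> r" "\<And>a. (a, v) \<in> R \<Longrightarrow> a = v"
  shows False
proof -
  have "w \<noteq> v" if "(r, w) \<in> R\<^sup>*" for w
    using that
  proof (induction rule: rtrancl_induct)
    case base
    then show ?case using assms(2) by simp
  next
    case (step a w)
    then show ?case using assms(3) by blast
  qed
  then show False using assms(1) by blast
qed

lemma arborescence_no_loop: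
  assumes "g \<in> arborescences X r" "v \<in> X" "v \<noteq> r"
  shows "g v \<noteq> v"
proof
  assume "g v = v"
  then show False
    using no_self_loop[of r v "map_rel (X - {r}) g"] assms by (auto simp: arborescences_def map_rel_def)
qed

text \<open>Contracting the edge from \<open>b\<close> to its parent \<open>c\<close> gives a tree in which \<open>c\<close> carries the
  weight of both. This is the induction step of Cayley's formula for weighted trees.\<close>

lemma sum_arborescences_contract:
  fixes q :: "'a \<Rightarrow> real"
  assumes X: "finite X" "b \<in> X" "c \<in> X" "b \<noteq> c" "b \<noteq> r" and q: "\<And>x. x \<in> X \<Longrightarrow> 0 \<le> q x"
  shows "(\<Sum>g | g \<in> arborescences X r \<and> g b = c. \<Prod>v\<in>X - {r}. q (g v))
    \<le> q c * (\<Sum>g\<in>arborescences (X - {b}) r. \<Prod>v\<in>X - {b} - {r}. (q(c := q c + q b)) (g v))"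
proof -
  define Y where "Y = X - {b} - {r}"
  define X' where "X' = X - {b}"
  define q' where "q' = q(c := q c + q b)"
  define lump where "lump x = (if x = b then c else x)" for x
  define S where "S = {g. g \<in> arborescences X r \<and> g b = c}"
  define S' where "S' = {g \<in> Y \<rightarrow>\<^sub>E X. restrict (lump \<circ> g) Y \<in> arborescences X' r}"
  have XY: "X - {r} = insert b Y" "b \<notin> Y" and finY: "finite Y" using X by (auto simp: Y_def)
  have Y': "X' - {r} = Y" by (auto simp: X'_def Y_def)
  have finX': "finite X'" using X by (simp add: X'_def)
  have finS': "finite S'" by (rule finite_subset[of _ "Y \<rightarrow>\<^sub>E X"]) (auto simp: S'_def finY X(1) intro: finite_PiE)
  have S: "restrict g Y \<in> S'" if "g \<in> S" for g
  proof -
    have g: "g \<in> (X - {r}) \<rightarrow>\<^sub>E X" "\<And>v. v \<in> X \<Longrightarrow> (r, v) \<in> (map_rel (X - {r}) g)\<^sup>*" "g b = c"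
      using that by (auto simp: S_def arborescences_def)
    define h where "h = restrict (lump \<circ> restrict g Y) Y"
    have lump: "(r, lump v) \<in> (map_rel Y h)\<^sup>*" if "(r, v) \<in> (map_rel (X - {r}) g)\<^sup>*" for v
      using that
    proof (induction rule: rtrancl_induct)
      case base
      then show ?case using X by (simp add: lump_def)
    next
      case (step a v)
      then have av: "a = g v" "v \<in> insert b Y" unfolding XY(1) by (auto simp: map_rel_def)
      show ?case
      proof (cases "v = b")
        case True
        then have "lump a = lump v" using av g(3) X by (simp add: lump_def)
        then show ?thesis using step.IH by simp
      next
        case False
        then have "(lump a, v) \<in> map_rel Y h" "lump v = v"
          using av by (auto simp: map_rel_def h_def lump_def)
        then show ?thesis using step.IH by auto
      qed
    qed
    have "h \<in> Y \<rightarrow>\<^sub>E X'"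
    proof (rule PiE_I)
      fix v assume "v \<in> Y"
      then have "g v \<in> X" using g(1) XY by auto
      then show "h v \<in> X'" using \<open>v \<in> Y\<close> X by (auto simp: h_def lump_def X'_def)
    qed (simp add: h_def)
    moreover have "(r, v) \<in> (map_rel Y h)\<^sup>*" if "v \<in> X'" for v
      using lump[OF g(2), of v] that by (auto simp: X'_def lump_def)
    ultimately have "h \<in> arborescences X' r" by (simp add: arborescences_def Y')
    moreover have "restrict g Y \<in> Y \<rightarrow>\<^sub>E X" using g(1) XY by auto
    ultimately show ?thesis by (simp add: S'_def h_def)
  qed
  have inj: "inj_on (\<lambda>g. restrict g Y) S"
  proof (rule inj_onI)
    fix g g' assume h: "g \<in> S" "g' \<in> S" "restrict g Y = restrict g' Y"
    show "g = g'"
    proof (rule PiE_ext)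
      show "g \<in> insert b Y \<rightarrow>\<^sub>E X" "g' \<in> insert b Y \<rightarrow>\<^sub>E X"
        using h unfolding S_def arborescences_def XY(1) by auto
      fix v assume "v \<in> insert b Y"
      then show "g v = g' v" using h(1,2) fun_cong[OF h(3), of v] by (cases "v = b") (auto simp: S_def)
    qed
  qed
  have prod_nonneg: "0 \<le> (\<Prod>v\<in>Y. q (g v))" if "g \<in> Y \<rightarrow>\<^sub>E X" for g
    by (rule prod_nonneg) (use that q in auto)
  have "(\<Sum>g\<in>S. \<Prod>v\<in>X - {r}. q (g v)) = (\<Sum>g\<in>S. q c * (\<Prod>v\<in>Y. q (restrict g Y v)))"
    unfolding XY(1) using XY(2) finY by (intro sum.cong refl) (simp add: S_def)
  also have "\<dots> = q c * (\<Sum>g\<in>S. \<Prod>v\<in>Y. q (restrict g Y v))" by (simp only: sum_distrib_left)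
  also have "(\<Sum>g\<in>S. \<Prod>v\<in>Y. q (restrict g Y v)) = (\<Sum>g\<in>(\<lambda>g. restrict g Y) ` S. \<Prod>v\<in>Y. q (g v))"
    by (simp only: sum.reindex[OF inj] comp_def)
  also have "\<dots> \<le> (\<Sum>g\<in>S'. \<Prod>v\<in>Y. q (g v))"
  proof (rule sum_mono2[OF finS'])
    show "(\<lambda>g. restrict g Y) ` S \<subseteq> S'" using S by blast
    show "0 \<le> (\<Prod>v\<in>Y. q (g v))" if "g \<in> S' - (\<lambda>g. restrict g Y) ` S" for g
      by (rule prod_nonneg) (use that in \<open>simp add: S'_def\<close>)
  qed
  also have "\<dots> = (\<Sum>h\<in>arborescences X' r. \<Sum>g | g \<in> S' \<and> restrict (lump \<circ> g) Y = h. \<Prod>v\<in>Y. q (g v))"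
    by (rule sum.group[symmetric]) (use finS' finX' finite_arborescences in \<open>auto simp: S'_def\<close>)
  also have "\<dots> = (\<Sum>h\<in>arborescences X' r. \<Prod>v\<in>Y. q' (h v))"
  proof (rule sum.cong[OF refl])
    fix h assume h: "h \<in> arborescences X' r"
    then have h_Y: "h \<in> Y \<rightarrow>\<^sub>E X'" by (simp add: arborescences_def Y')
    \<comment> \<open>The trees that contract to \<open>h\<close> form a product set: each vertex
      with parent \<open>c\<close> in \<open>h\<close> chooses freely between \<open>b\<close> and
      \<open>c\<close>. Summing over this choice turns the weight of \<open>c\<close> into that of
      \<open>b\<close> and \<open>c\<close> together.\<close>
    have "{g. g \<in> S' \<and> restrict (lump \<circ> g) Y = h} = (\<Pi>\<^sub>E v\<in>Y. {x \<in> X. lump x = h v})"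
    proof (intro equalityI subsetI)
      fix g assume "g \<in> {g. g \<in> S' \<and> restrict (lump \<circ> g) Y = h}"
      then show "g \<in> (\<Pi>\<^sub>E v\<in>Y. {x \<in> X. lump x = h v})" by (auto simp: S'_def)
    next
      fix g assume g: "g \<in> (\<Pi>\<^sub>E v\<in>Y. {x \<in> X. lump x = h v})"
      then have "restrict (lump \<circ> g) Y = h"
        using h_Y by (intro PiE_ext[of _ Y "\<lambda>_. UNIV"]) (auto simp: PiE_iff)
      moreover have "g \<in> Y \<rightarrow>\<^sub>E X" using g by (auto simp: PiE_iff)
      ultimately show "g \<in> {g. g \<in> S' \<and> restrict (lump \<circ> g) Y = h}" using h by (simp add: S'_def)
    qed
    then have "(\<Sum>g | g \<in> S' \<and> restrict (lump \<circ> g) Y = h. \<Prod>v\<in>Y. q (g v))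
       = (\<Prod>v\<in>Y. \<Sum>x | x \<in> X \<and> lump x = h v. q x)"
      using prod_sum_PiE[OF finY, of "\<lambda>v. {x \<in> X. lump x = h v}" "\<lambda>v x. q x"] X(1) by simp
    also have "\<dots> = (\<Prod>v\<in>Y. q' (h v))"
    proof (rule prod.cong[OF refl])
      fix v assume "v \<in> Y"
      then have hv: "h v \<in> X" "h v \<noteq> b" using h_Y by (auto simp: X'_def)
      show "(\<Sum>x | x \<in> X \<and> lump x = h v. q x) = q' (h v)"
      proof (cases "h v = c")
        case True
        then have "{x \<in> X. lump x = h v} = {b, c}" using X by (auto simp: lump_def)
        then show ?thesis using True X(4) by (simp add: q'_def)
      next
        case False
        then have "{x \<in> X. lump x = h v} = {h v}" using hv by (auto simp: lump_def)
        then show ?thesis using False by (simp add: q'_def)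
      qed
    qed
    finally show "(\<Sum>g | g \<in> S' \<and> restrict (lump \<circ> g) Y = h. \<Prod>v\<in>Y. q (g v)) = (\<Prod>v\<in>Y. q' (h v))" .
  qed
  finally show ?thesis
    using q[OF X(3)] by (simp add: S_def X'_def Y_def q'_def mult_left_mono)
qed

lemma sum_upd_eq:
  fixes q :: "'a \<Rightarrow> real"
  assumes "finite X" "b \<in> X" "c \<in> X" "b \<noteq> c"
  shows "(\<Sum>x\<in>X - {b}. (q(c := q c + q b)) x) = sum q X"
proof -
  have "(\<Sum>x\<in>X - {b}. (q(c := q c + q b)) x) = (\<Sum>x\<in>X - {b} - {c}. q x) + (q c + q b)"
    using assms by (subst sum.remove[of _ c]) auto
  also have "\<dots> = sum q X" using assms by (simp add: sum_diff1)
  finally show ?thesis .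
qed

text \<open>The weighted Cayley formula as an inequality. Pick a vertex b other than the root and
  sum over its parent c: the contracted trees weigh at most q_r, and q_r + q_b if c is the root. The
  total is (1 - q_b) q_r + q_r q_b = q_r.\<close>

lemma sum_arborescences_le:
  fixes q :: "'a \<Rightarrow> real"
  assumes "finite X" "r \<in> X" "\<And>x. x \<in> X \<Longrightarrow> 0 \<le> q x" "sum q X = 1"
  shows "(\<Sum>g\<in>arborescences X r. \<Prod>v\<in>X - {r}. q (g v)) \<le> q r"
  using assms
proof (induction "card X" arbitrary: X q rule: less_induct)
  case less
  show ?case
  proof (cases "X = {r}")
    case True
    then have "arborescences X r = {\<lambda>_. undefined}" by (auto simp: arborescences_def)
    then show ?thesis using True less.prems by simp
  next
    case False
    then obtain b where b: "b \<in> X" "b \<noteq> r" using less.prems(2) by blast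
    let ?q' = "\<lambda>c. q(c := q c + q b)"
    have IH: "(\<Sum>g\<in>arborescences (X - {b}) r. \<Prod>v\<in>X - {b} - {r}. ?q' c (g v)) \<le> ?q' c r" if c: "c \<in> X - {b}" for c
    proof (rule less.hyps)
      show "card (X - {b}) < card X" by (rule card_Diff1_less[OF less.prems(1) b(1)])
      show "sum (?q' c) (X - {b}) = 1" using sum_upd_eq[of X b c q] less.prems b c by auto
    qed (use less.prems b c in auto)
    have arb: "arborescences X r = (\<Union>c\<in>X - {b}. {g. g \<in> arborescences X r \<and> g b = c})"
    proof -
      have "g b \<in> X - {b}" if "g \<in> arborescences X r" for g
        using arborescence_no_loop[OF that b] that b by (auto simp: arborescences_def)
      then show ?thesis by blast
    qed
    have "(\<Sum>g\<in>arborescences X r. \<Prod>v\<in>X - {r}. q (g v))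
        = (\<Sum>c\<in>X - {b}. \<Sum>g | g \<in> arborescences X r \<and> g b = c. \<Prod>v\<in>X - {r}. q (g v))"
      by (subst arb, rule sum.UNION_disjoint)
        (use less.prems finite_arborescences[of X r] in \<open>auto intro: finite_subset\<close>)
    also have "\<dots> \<le> (\<Sum>c\<in>X - {b}. q c * ?q' c r)"
    proof (rule sum_mono)
      fix c assume c: "c \<in> X - {b}"
      have "(\<Sum>g | g \<in> arborescences X r \<and> g b = c. \<Prod>v\<in>X - {r}. q (g v))
          \<le> q c * (\<Sum>g\<in>arborescences (X - {b}) r. \<Prod>v\<in>X - {b} - {r}. ?q' c (g v))"
        by (rule sum_arborescences_contract) (use less.prems b c in auto)
      also have "\<dots> \<le> q c * ?q' c r" by (rule mult_left_mono[OF IH[OF c]]) (use less.prems c in auto)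
      finally show "(\<Sum>g | g \<in> arborescences X r \<and> g b = c. \<Prod>v\<in>X - {r}. q (g v)) \<le> q c * ?q' c r" .
    qed
    also have "\<dots> = (\<Sum>c\<in>X - {b}. q c * q r + (if c = r then q r * q b else 0))"
      by (rule sum.cong) (auto simp: algebra_simps)
    also have "\<dots> = (1 - q b) * q r + q r * q b"
      using less.prems b by (simp add: sum.distrib sum_distrib_right[symmetric] sum_diff1)
    also have "\<dots> = q r" by (simp add: algebra_simps)
    finally show ?thesis .
  qed
qed

text \<open>Contracting the prescribed edge leaves a factor q_c and trees on the remaining vertices,
  whose merged weights again have sum 1. Summed over the possible roots, those trees weigh at most
  1.\<close>

lemma sum_arborescences_edge_le:
  fixes q :: "'a \<Rightarrow> real"
  assumes X: "finite X" "b \<in> X" "c \<in> X" "b \<noteq> c" and q: "\<And>x. x \<in> X \<Longrightarrow> 0 \<le> q x" "sum q X = 1"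
  shows "(\<Sum>r\<in>X - {b}. \<Sum>g | g \<in> arborescences X r \<and> g b = c. \<Prod>v\<in>X - {r}. q (g v)) \<le> q c"
proof -
  let ?q' = "q(c := q c + q b)"
  have q': "sum ?q' (X - {b}) = 1" using sum_upd_eq[OF X] q by simp
  have "(\<Sum>r\<in>X - {b}. \<Sum>g | g \<in> arborescences X r \<and> g b = c. \<Prod>v\<in>X - {r}. q (g v)) \<le> (\<Sum>r\<in>X - {b}. q c * ?q' r)"
  proof (rule sum_mono)
    fix r assume r: "r \<in> X - {b}"
    have "(\<Sum>g | g \<in> arborescences X r \<and> g b = c. \<Prod>v\<in>X - {r}. q (g v))
        \<le> q c * (\<Sum>g\<in>arborescences (X - {b}) r. \<Prod>v\<in>X - {b} - {r}. ?q' (g v))"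
      by (rule sum_arborescences_contract) (use X q r in auto)
    also have "\<dots> \<le> q c * ?q' r"
      by (intro mult_left_mono sum_arborescences_le q') (use X q r in auto)
    finally show "(\<Sum>g | g \<in> arborescences X r \<and> g b = c. \<Prod>v\<in>X - {r}. q (g v)) \<le> q c * ?q' r" .
  qed
  also have "\<dots> = q c" unfolding sum_distrib_left[symmetric] q' by simp
  finally show ?thesis .
qed

section \<open>The probability of an edge between hubs\<close>

context weights begin

text \<open>If every vertex can be reached from the root, each other vertex has a parent, unique
  because slots are disjoint, and the parent map is an arborescence. The event is covered by one box
  for each such map, whose probability is a product of weights.\<close>

lemma emeasure_tree_edge:
  assumes r: "r \<in> {1..n}" and i: "i \<in> {1..n}" "i' \<in> {1..n} - {r}"
  shows "emeasure (unif_prod ({1..n} - {r})) {z \<in> space (unif_prod ({1..n} - {r})).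
      (\<forall>v\<in>{1..n}. (r, v) \<in> (slot_rel n p r z)\<^sup>*) \<and> (i, i') \<in> slot_rel n p r z}
    \<le> ennreal (\<Sum>g | g \<in> arborescences {1..n} r \<and> g i' = i. \<Prod>v\<in>{1..n} - {r}. p (g v))"
    (is "emeasure ?M ?E \<le> _")
proof -
  let ?V = "{1..n} - {r}"
  define S where "S = {g. g \<in> arborescences {1..n} r \<and> g i' = i}"
  define box where "box g = {z \<in> space ?M. \<forall>v\<in>?V. z v \<in> slot p (g v)}" for g
  have finS: "finite S"
    by (rule finite_subset[OF _ finite_arborescences[of "{1..n}" r]]) (auto simp: S_def)
  have box_sets: "box g \<in> sets ?M" for g
  proof -
    have "Measurable.pred ?M (\<lambda>z. \<forall>v\<in>?V. z v \<in> slot p (g v))"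
    proof (rule pred_intros_finite)
      show "Measurable.pred ?M (\<lambda>z. z v \<in> slot p (g v))" if "v \<in> ?V" for v
        using that by (rule pred_coordinate_slot)
    qed simp
    then show ?thesis unfolding box_def pred_def .
  qed
  have box: "emeasure ?M (box g) = ennreal (\<Prod>v\<in>?V. p (g v))" if "g \<in> S" for g
  proof -
    have "g \<in> arborescences {1..n} r" using \<open>g \<in> S\<close> by (simp add: S_def)
    note g = arborescence_in[OF this]
    have "emeasure ?M (box g) = (\<integral>\<^sup>+z. indicator (box g) z \<partial>?M)"
      by (rule nn_integral_indicator[OF box_sets, symmetric])
    also have "\<dots> = (\<integral>\<^sup>+z. (\<Prod>v\<in>?V. indicator (slot p (g v)) (z v)) \<partial>?M)"
    proof (rule nn_integral_cong)
      fix z assume z: "z \<in> space ?M"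
      show "indicator (box g) z = (\<Prod>v\<in>?V. indicator (slot p (g v)) (z v) :: ennreal)"
      proof (cases "z \<in> box g")
        case True
        then have "(\<Prod>v\<in>?V. indicator (slot p (g v)) (z v) :: ennreal) = 1"
          by (intro prod.neutral) (simp add: box_def)
        then show ?thesis using True by simp
      next
        case False
        then obtain v where v: "v \<in> ?V" "z v \<notin> slot p (g v)" using z unfolding box_def mem_Collect_eq by blast
        have "(\<Prod>v\<in>?V. indicator (slot p (g v)) (z v) :: ennreal) = 0"
          by (rule prod_zero) (use v in \<open>auto intro!: bexI[of _ v]\<close>)
        then show ?thesis using False by simp
      qed
    qed
    also have "\<dots> = (\<Prod>v\<in>?V. \<integral>\<^sup>+u. indicator (slot p (g v)) u \<partial>unif)"
      by (rule nn_integral_unif_prod_inj[where q = "\<lambda>v. v"]) (auto simp: slot_def)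
    also have "\<dots> = (\<Prod>v\<in>?V. ennreal (p (g v)))"
    proof (rule prod.cong[OF refl])
      fix v assume "v \<in> ?V"
      have "(\<integral>\<^sup>+u. indicator (slot p (g v)) u \<partial>unif) = emeasure unif (slot p (g v))"
        by (rule nn_integral_indicator) (simp add: slot_def)
      then show "(\<integral>\<^sup>+u. indicator (slot p (g v)) u \<partial>unif) = ennreal (p (g v))"
        using emeasure_unif_slot[OF p_pos p_sum g[OF \<open>v \<in> ?V\<close>]] by simp
    qed
    also have "\<dots> = ennreal (\<Prod>v\<in>?V. p (g v))"
      by (rule prod_ennreal) (rule less_imp_le[OF p_pos[OF g]])
    finally show ?thesis .
  qed
  have cover: "?E \<subseteq> (\<Union>g\<in>S. box g)"
  proof
    fix z assume z: "z \<in> ?E"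
    then have lead: "(r, v) \<in> (slot_rel n p r z)\<^sup>*" if "v \<in> {1..n}" for v using that by blast
    have ex: "\<exists>w. (w, v) \<in> slot_rel n p r z" if "v \<in> ?V" for v
      using lead[of v] that by (auto elim: rtranclE)
    define w where "w v = (SOME w. (w, v) \<in> slot_rel n p r z)" for v
    define g where "g = restrict w ?V"
    have g: "(g v, v) \<in> slot_rel n p r z" if "v \<in> ?V" for v
      using someI_ex[OF ex[OF that]] that by (simp add: g_def w_def)
    have uniq: "w = g v" if "(w, v) \<in> slot_rel n p r z" for w v
    proof -
      have v: "v \<in> ?V" using that by (simp add: slot_rel_def)
      show ?thesis using slot_unique[OF p_pos p_sum, of w "g v" "z v"] that g[OF v] by (auto simp: slot_rel_def)
    qed
    have rel: "slot_rel n p r z = map_rel ?V g"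
    proof (intro equalityI subrelI)
      fix w v assume wv: "(w, v) \<in> slot_rel n p r z"
      then have "v \<in> ?V" by (simp add: slot_rel_def)
      then show "(w, v) \<in> map_rel ?V g" using uniq[OF wv] by (auto simp: map_rel_def)
    next
      fix w v assume "(w, v) \<in> map_rel ?V g"
      then show "(w, v) \<in> slot_rel n p r z" using g by (auto simp: map_rel_def)
    qed
    have "g \<in> ?V \<rightarrow>\<^sub>E {1..n}"
      unfolding g_def restrict_PiE_iff
    proof
      fix v assume "v \<in> ?V"
      then show "w v \<in> {1..n}" using g[of v] by (simp add: slot_rel_def g_def)
    qed
    moreover have "g i' = i" using uniq[of i i'] z by simp
    ultimately have "g \<in> S" using lead unfolding rel by (simp add: S_def arborescences_def)
    moreover have "z \<in> box g" using z g by (auto simp: box_def slot_rel_def)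
    ultimately show "z \<in> (\<Union>g\<in>S. box g)" by blast
  qed
  have "emeasure ?M ?E \<le> emeasure ?M (\<Union>g\<in>S. box g)"
    by (rule emeasure_mono[OF cover]) (use finS box_sets in auto)
  also have "\<dots> \<le> (\<Sum>g\<in>S. emeasure ?M (box g))"
    by (rule emeasure_subadditive_finite) (use finS box_sets in auto)
  also have "\<dots> = (\<Sum>g\<in>S. ennreal (\<Prod>v\<in>?V. p (g v)))" by (rule sum.cong[OF refl]) (rule box)
  also have "\<dots> = ennreal (\<Sum>g\<in>S. \<Prod>v\<in>?V. p (g v))"
  proof (rule sum_ennreal)
    fix g assume "g \<in> S"
    then show "0 \<le> (\<Prod>v\<in>?V. p (g v))"
    proof (intro prod_nonneg)
      fix v assume "v \<in> ?V"
      have "g \<in> arborescences {1..n} r" using \<open>g \<in> S\<close> by (simp add: S_def)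
      from arborescence_in[OF this \<open>v \<in> ?V\<close>] show "0 \<le> p (g v)" by (rule less_imp_le[OF p_pos])
    qed
  qed
  finally show ?thesis by (simp add: S_def)
qed

lemma sum_emeasure_hub_pair:
  "(\<Sum>r=1..n. emeasure (unif_prod ({1..n} - {r})) {z \<in> space (unif_prod ({1..n} - {r})). hub_pair n I p r z})
    \<le> ennreal (real I * (\<Sum>i=1..I. p i))"
proof -
  let ?M = "\<lambda>r. unif_prod ({1..n} - {r})"
  define E where "E r i i' = {z \<in> space (?M r). (\<forall>v\<in>{1..n}. (r, v) \<in> (slot_rel n p r z)\<^sup>*) \<and> (i, i') \<in> slot_rel n p r z}" for r i i'
  define w where "w r i i' = (\<Sum>g | g \<in> arborescences {1..n} r \<and> g i' = i. \<Prod>v\<in>{1..n} - {r}. p (g v))" for r i i'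
  \<comment> \<open>No edge leads into the root, and a vertex that is its own parent cannot be
    reached from the root. So these pairs contribute nothing.\<close>
  define f where "f r i i' = (if r = i' \<or> i = i' then 0 else w r i i')" for r i i'
  have f0: "0 \<le> f r i i'" for r i i'
  proof -
    have "0 \<le> (\<Prod>v\<in>{1..n} - {r}. p (g v))" if "g \<in> arborescences {1..n} r" for g
    proof (rule prod_nonneg)
      fix v assume "v \<in> {1..n} - {r}"
      then have "g v \<in> {1..n}" by (rule arborescence_in[OF that])
      then show "0 \<le> p (g v)" by (rule less_imp_le[OF p_pos])
    qed
    then show ?thesis unfolding f_def w_def by (auto intro!: sum_nonneg)
  qed
  have E_sets: "E r i i' \<in> sets (?M r)" for r i i'
  proof -
    have "Measurable.pred (?M r) (\<lambda>z. (\<forall>v\<in>{1..n}. (r, v) \<in> (slot_rel n p r z)\<^sup>*) \<and> (i, i') \<in> slot_rel n p r z)"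
      by (rule pred_slot_rel[where Q = "\<lambda>R z. (\<forall>v\<in>{1..n}. (r, v) \<in> R\<^sup>*) \<and> (i, i') \<in> R"]) simp
    then show ?thesis unfolding E_def pred_def .
  qed
  have E_le: "emeasure (?M r) (E r i i') \<le> ennreal (f r i i')"
    if "r \<in> {1..n}" "i \<in> {1..n}" "i' \<in> {1..n}" for r i i'
  proof (cases "r = i' \<or> i = i'")
    case True
    have False if z: "z \<in> E r i i'" for z
    proof -
      have z': "(i, i') \<in> slot_rel n p r z" "(r, i) \<in> (slot_rel n p r z)\<^sup>*"
        using z \<open>i \<in> {1..n}\<close> unfolding E_def by blast+
      then have "i' \<noteq> r" by (simp add: slot_rel_def)
      then have ii: "i = i'" using True by blast
      have "a = i" if "(a, i) \<in> slot_rel n p r z" for a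
        using that z'(1) slot_unique[OF p_pos p_sum, of a i "z i"] unfolding ii by (simp add: slot_rel_def)
      then show False using no_self_loop[OF z'(2)] \<open>i' \<noteq> r\<close> ii by blast
    qed
    then have "E r i i' = {}" by blast
    then show ?thesis by simp
  next
    case False
    then have "i' \<in> {1..n} - {r}" using that by blast
    then show ?thesis using emeasure_tree_edge[OF that(1,2)] False unfolding E_def f_def w_def by auto
  qed
  have "emeasure (?M r) {z \<in> space (?M r). hub_pair n I p r z} \<le> (\<Sum>i=1..I. \<Sum>i'=1..I. ennreal (f r i i'))"
    if r: "r \<in> {1..n}" for r
  proof -
    have "{z \<in> space (?M r). hub_pair n I p r z} = (\<Union>i\<in>{1..I}. \<Union>i'\<in>{1..I}. E r i i')"
      unfolding E_def hub_pair_def by blast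
    also have "emeasure (?M r) \<dots> \<le> (\<Sum>i=1..I. emeasure (?M r) (\<Union>i'\<in>{1..I}. E r i i'))"
      by (rule emeasure_subadditive_finite) (use E_sets in auto)
    also have "\<dots> \<le> (\<Sum>i=1..I. \<Sum>i'=1..I. emeasure (?M r) (E r i i'))"
      by (intro sum_mono emeasure_subadditive_finite) (use E_sets in auto)
    also have "\<dots> \<le> (\<Sum>i=1..I. \<Sum>i'=1..I. ennreal (f r i i'))"
      by (intro sum_mono E_le) (use r I_le in auto)
    finally show ?thesis .
  qed
  then have "(\<Sum>r=1..n. emeasure (?M r) {z \<in> space (?M r). hub_pair n I p r z})
      \<le> (\<Sum>r=1..n. \<Sum>i=1..I. \<Sum>i'=1..I. ennreal (f r i i'))"
    by (rule sum_mono)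
  also have "\<dots> = ennreal (\<Sum>r=1..n. \<Sum>i=1..I. \<Sum>i'=1..I. f r i i')"
    using f0 by (simp add: sum_nonneg)
  also have "\<dots> \<le> ennreal (real I * (\<Sum>i=1..I. p i))"
  proof (rule ennreal_leI)
    have "(\<Sum>r=1..n. \<Sum>i=1..I. \<Sum>i'=1..I. f r i i') = (\<Sum>i=1..I. \<Sum>r=1..n. \<Sum>i'=1..I. f r i i')"
      by (rule sum.swap)
    also have "\<dots> = (\<Sum>i=1..I. \<Sum>i'=1..I. \<Sum>r=1..n. f r i i')"
      by (rule sum.cong[OF refl]) (rule sum.swap)
    also have "\<dots> \<le> (\<Sum>i=1..I. \<Sum>i'=1..I. p i)"
    proof (intro sum_mono)
      fix i i' assume ii: "i \<in> {1..I}" "i' \<in> {1..I}"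
      then have n: "i \<in> {1..n}" "i' \<in> {1..n}" using I_le by auto
      show "(\<Sum>r=1..n. f r i i') \<le> p i"
      proof (cases "i = i'")
        case True
        then show ?thesis using less_imp_le[OF p_pos[OF n(1)]] by (simp add: f_def)
      next
        case False
        have "(\<Sum>r=1..n. f r i i') = (\<Sum>r\<in>{1..n} - {i'}. w r i i')"
          using False by (intro sum.mono_neutral_cong_right) (auto simp: f_def)
        also have "\<dots> \<le> p i" unfolding w_def
          by (rule sum_arborescences_edge_le) (use n False p_sum in \<open>auto intro!: less_imp_le[OF p_pos]\<close>)
        finally show ?thesis .
      qed
    qed
    also have "\<dots> = real I * (\<Sum>i=1..I. p i)" by (simp add: sum_distrib_left)
    finally show "(\<Sum>r=1..n. \<Sum>i=1..I. \<Sum>i'=1..I. f r i i') \<le> real I * (\<Sum>i=1..I. p i)" .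
  qed
  finally show ?thesis .
qed

end

subsection \<open>Summation over the paths\<close>

definition distinct_lists :: "nat \<Rightarrow> nat \<Rightarrow> nat list set" where
  "distinct_lists n m = {l. length l = m \<and> distinct l \<and> set l \<subseteq> {1..n}}"

lemma finite_distinct_lists: "finite (distinct_lists n m)"
  by (rule finite_subset[OF _ finite_lists_length_eq[of "{1..n}" m]]) (auto simp: distinct_lists_def)

lemma sum_distinct_lists_Suc:
  "(\<Sum>l\<in>distinct_lists n (Suc m). f l) = (\<Sum>l\<in>distinct_lists n m. \<Sum>x\<in>{1..n} - set l. f (x # l))"
proof -
  have eq: "distinct_lists n (Suc m) = (\<lambda>(l, x). x # l) ` (SIGMA l:distinct_lists n m. {1..n} - set l)"
  proof (intro equalityI subsetI)
    fix l assume l: "l \<in> distinct_lists n (Suc m)"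
    then obtain x k where "l = x # k" by (cases l) (auto simp: distinct_lists_def)
    then show "l \<in> (\<lambda>(l, x). x # l) ` (SIGMA l:distinct_lists n m. {1..n} - set l)"
      using l by (intro image_eqI[of _ _ "(k, x)"]) (auto simp: distinct_lists_def)
  qed (auto simp: distinct_lists_def)
  have "inj_on (\<lambda>(l, x). x # l) (SIGMA l:distinct_lists n m. {1..n} - set l)" by (auto simp: inj_on_def)
  then have "(\<Sum>l\<in>distinct_lists n (Suc m). f l) = (\<Sum>(l, x)\<in>(SIGMA l:distinct_lists n m. {1..n} - set l). f (x # l))"
    unfolding eq by (subst sum.reindex) (auto intro!: sum.cong)
  also have "\<dots> = (\<Sum>l\<in>distinct_lists n m. \<Sum>x\<in>{1..n} - set l. f (x # l))"
    by (rule sum.Sigma[symmetric]) (auto simp: finite_distinct_lists)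
  finally show ?thesis .
qed

lemma sum_spine_lists:
  assumes "1 \<le> m"
  shows "(\<Sum>r=1..n. \<Sum>l\<in>spine_lists n r m. f l) = (\<Sum>l\<in>distinct_lists n m. f l)"
proof -
  have "distinct_lists n m = (\<Union>r\<in>{1..n}. spine_lists n r m)"
  proof (intro equalityI subsetI)
    fix l assume l: "l \<in> distinct_lists n m"
    then have "l \<noteq> []" using assms by (auto simp: distinct_lists_def)
    then have "last l \<in> {1..n}" using l last_in_set[of l] unfolding distinct_lists_def by blast
    then show "l \<in> (\<Union>r\<in>{1..n}. spine_lists n r m)" using l by (auto simp: distinct_lists_def spine_lists_def)
  qed (auto simp: distinct_lists_def spine_lists_def)
  then show ?thesis
    by (simp only:) (rule sum.UNION_disjoint[symmetric], auto simp: finite_spine_lists, auto simp: spine_lists_def)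
qed

section \<open>The total weight of the paths of a given height\<close>

context weights begin

text \<open>The probability that m independent samples from \<open>p\<close> are distinct, as in the
  birthday problem.\<close>

definition path_weight :: "nat \<Rightarrow> real" where
  "path_weight m = (\<Sum>l\<in>distinct_lists n m. prod_list (map p l))"

lemma prod_list_nonneg_p: "set l \<subseteq> {1..n} \<Longrightarrow> 0 \<le> prod_list (map p l)"
  by (induction l) (auto intro!: mult_nonneg_nonneg less_imp_le[OF p_pos])

lemma path_weight_nonneg: "0 \<le> path_weight m"
  unfolding path_weight_def by (intro sum_nonneg prod_list_nonneg_p) (auto simp: distinct_lists_def)

text \<open>The next sample has to avoid m distinct values, each of weight at least
  \<open>s\<close>.\<close>

lemma path_weight_Suc: "path_weight (Suc m) \<le> path_weight m * (1 - m * s)"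
proof -
  have "path_weight (Suc m) = (\<Sum>l\<in>distinct_lists n m. prod_list (map p l) * (\<Sum>x\<in>{1..n} - set l. p x))"
    unfolding path_weight_def sum_distinct_lists_Suc by (simp add: sum_distrib_left mult.commute)
  also have "\<dots> \<le> (\<Sum>l\<in>distinct_lists n m. prod_list (map p l) * (1 - m * s))"
  proof (intro sum_mono mult_left_mono)
    fix l assume l: "l \<in> distinct_lists n m"
    then have sub: "set l \<subseteq> {1..n}" "card (set l) = m" by (auto simp: distinct_lists_def distinct_card)
    have "of_nat (card (set l)) * s \<le> sum p (set l)"
      by (rule sum_bounded_below) (use s_le sub in blast)
    then have "m * s \<le> sum p (set l)" using sub by simp
    moreover have "(\<Sum>x\<in>{1..n} - set l. p x) = 1 - sum p (set l)" using sum_diff[of "{1..n}" "set l" p] sub p_sum by simp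
    ultimately show "(\<Sum>x\<in>{1..n} - set l. p x) \<le> 1 - m * s" by simp
    show "0 \<le> prod_list (map p l)" by (rule prod_list_nonneg_p[OF sub(1)])
  qed
  finally show ?thesis by (simp add: path_weight_def sum_distrib_right)
qed

lemma path_weight_0: "path_weight 0 = 1"
proof -
  have "distinct_lists n 0 = {[]}" by (auto simp: distinct_lists_def)
  then show ?thesis by (simp add: path_weight_def)
qed

lemma path_weight_le_exp: "path_weight m \<le> exp (- s * (real m * (real m - 1) / 2))"
proof (induction m)
  case (Suc m)
  have "path_weight (Suc m) \<le> path_weight m * (1 - m * s)" by (rule path_weight_Suc)
  also have "\<dots> \<le> path_weight m * exp (- (m * s))"
    using exp_ge_add_one_self[of "- (m * s)"] by (intro mult_left_mono path_weight_nonneg) simp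
  also have "\<dots> \<le> exp (- s * (real m * (real m - 1) / 2)) * exp (- (m * s))"
    by (intro mult_right_mono Suc.IH) simp
  also have "\<dots> = exp (- s * (real (Suc m) * (real (Suc m) - 1) / 2))"
  proof -
    have "- s * (real m * (real m - 1) / 2) + - (m * s) = - s * (real (Suc m) * (real (Suc m) - 1) / 2)"
      by (simp add: field_simps)
    then show ?thesis by (simp only: exp_add[symmetric])
  qed
  finally show ?case .
qed (simp add: path_weight_0)

lemma path_weight_le_1: "path_weight m \<le> 1"
proof (cases m)
  case (Suc k)
  have "0 \<le> s * (real m * (real m - 1) / 2)" using s_pos Suc by simp
  then have "exp (- s * (real m * (real m - 1) / 2)) \<le> 1" by simp
  then show ?thesis using path_weight_le_exp[of m] by linarith
qed (simp add: path_weight_0)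

text \<open>The product runs over the ancestors only. The lowest vertex of the path is nobody's
  parent, so its choice is unweighted and contributes the factor \<open>n\<close>.\<close>

lemma sum_spine_weight_le:
  "(\<Sum>r=1..n. \<Sum>l\<in>spine_lists n r (Suc m). \<Prod>k<m. ennreal (p (l ! Suc k))) \<le> ennreal (n * path_weight m)"
proof -
  have eq: "(\<Prod>k<m. ennreal (p (l ! Suc k))) = ennreal (prod_list (map p (tl l)))"
    if l: "l \<in> distinct_lists n (Suc m)" for l
  proof -
    have len: "length l = Suc m" "set l \<subseteq> {1..n}" using l by (auto simp: distinct_lists_def)
    have nth: "tl l ! k = l ! Suc k" "l ! Suc k \<in> {1..n}" if "k < m" for k
    proof -
      show "tl l ! k = l ! Suc k" using that len by (simp add: nth_tl)
      have "l ! Suc k \<in> set l" using that len by (intro nth_mem) simp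
      then show "l ! Suc k \<in> {1..n}" using len by blast
    qed
    have "(\<Prod>k<m. ennreal (p (l ! Suc k))) = ennreal (\<Prod>k<m. p (l ! Suc k))"
      by (rule prod_ennreal) (use nth(2) in \<open>auto intro!: less_imp_le[OF p_pos] simp del: atLeastAtMost_iff\<close>)
    also have "(\<Prod>k<m. p (l ! Suc k)) = (\<Prod>k=0..<m. map p (tl l) ! k)"
      using nth l by (intro prod.cong) (auto simp: distinct_lists_def)
    also have "\<dots> = prod_list (map p (tl l))"
      using l by (simp add: prod.list_conv_set_nth distinct_lists_def)
    finally show ?thesis .
  qed
  have "1 \<le> Suc m" by simp
  have "(\<Sum>r=1..n. \<Sum>l\<in>spine_lists n r (Suc m). \<Prod>k<m. ennreal (p (l ! Suc k)))
      = (\<Sum>l\<in>distinct_lists n (Suc m). ennreal (prod_list (map p (tl l))))"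
    unfolding sum_spine_lists[OF \<open>1 \<le> Suc m\<close>] by (rule sum.cong) (simp_all add: eq)
  also have "\<dots> = (\<Sum>l\<in>distinct_lists n m. \<Sum>x\<in>{1..n} - set l. ennreal (prod_list (map p l)))"
    unfolding sum_distinct_lists_Suc by simp
  also have "\<dots> \<le> (\<Sum>l\<in>distinct_lists n m. ennreal (n * prod_list (map p l)))"
  proof (rule sum_mono)
    fix l assume "l \<in> distinct_lists n m"
    then have "0 \<le> prod_list (map p l)" by (intro prod_list_nonneg_p) (simp add: distinct_lists_def)
    moreover have "card ({1..n} - set l) \<le> n" using card_mono[of "{1..n}" "{1..n} - set l"] by simp
    then have "(of_nat (card ({1..n} - set l)) :: ennreal) \<le> of_nat n" by simp
    then have "of_nat (card ({1..n} - set l)) * ennreal (prod_list (map p l)) \<le> of_nat n * ennreal (prod_list (map p l))"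
      by (rule mult_right_mono) simp
    ultimately show "(\<Sum>x\<in>{1..n} - set l. ennreal (prod_list (map p l))) \<le> ennreal (n * prod_list (map p l))"
      by (simp add: ennreal_mult ennreal_of_nat_eq_real_of_nat)
  qed
  also have "\<dots> = ennreal (n * path_weight m)"
    unfolding path_weight_def sum_distrib_left
    by (rule sum_ennreal) (auto simp: distinct_lists_def intro!: mult_nonneg_nonneg prod_list_nonneg_p)
  finally show ?thesis .
qed

section \<open>Union bounds over roots and paths\<close>

abbreviation (input) coords :: "nat \<Rightarrow> (nat \<Rightarrow> real) measure" where
  "coords r \<equiv> unif_prod ({1..n} - {r})"

lemma sum_emeasure_long_spine:
  "(\<Sum>r=1..n. emeasure (coords r) {z \<in> space (coords r). long_spine n p H r z})
    \<le> ennreal (n * exp (- s * (real H * (real H - 1) / 2)))"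
proof -
  have "emeasure (coords r) {z \<in> space (coords r). long_spine n p H r z}
      \<le> (\<Sum>l\<in>spine_lists n r (Suc H). \<Prod>k<H. ennreal (p (l ! Suc k)))" for r
  proof -
    have E: "{z \<in> space (coords r). spine (slot_rel n p r z) r l} \<in> sets (coords r)" for l
    proof -
      have "Measurable.pred (coords r) (\<lambda>z. spine (slot_rel n p r z) r l)"
        by (rule pred_slot_rel[where Q = "\<lambda>R z. spine R r l"]) simp
      then show ?thesis unfolding pred_def .
    qed
    have "{z \<in> space (coords r). long_spine n p H r z}
        = (\<Union>l\<in>spine_lists n r (Suc H). {z \<in> space (coords r). spine (slot_rel n p r z) r l})"
      unfolding long_spine_def by blast
    also have "emeasure (coords r) \<dots> \<le> (\<Sum>l\<in>spine_lists n r (Suc H). emeasure (coords r) {z \<in> space (coords r). spine (slot_rel n p r z) r l})"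
      by (rule emeasure_subadditive_finite) (use E finite_spine_lists in auto)
    also have "\<dots> = (\<Sum>l\<in>spine_lists n r (Suc H). \<Prod>k<H. ennreal (p (l ! Suc k)))"
      by (rule sum.cong[OF refl]) (rule emeasure_spine)
    finally show ?thesis .
  qed
  then have "(\<Sum>r=1..n. emeasure (coords r) {z \<in> space (coords r). long_spine n p H r z})
      \<le> (\<Sum>r=1..n. \<Sum>l\<in>spine_lists n r (Suc H). \<Prod>k<H. ennreal (p (l ! Suc k)))" by (rule sum_mono)
  also have "\<dots> \<le> ennreal (n * path_weight H)" by (rule sum_spine_weight_le)
  also have "\<dots> \<le> ennreal (n * exp (- s * (real H * (real H - 1) / 2)))"
    by (intro ennreal_leI mult_left_mono path_weight_le_exp) simp
  finally show ?thesis .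
qed

text \<open>For each of the \<open>H\<close> heights the path probabilities, summed over paths and
  roots, amount to at most \<open>n\<close>. So the number of paths never enters, only their total
  weight.\<close>

lemma sum_emeasure_unbalanced:
  assumes \<tau>: "0 < \<tau>" "\<tau> \<le> 1 / 2"
  shows "(\<Sum>r=1..n. emeasure (coords r) {z \<in> space (coords r). unbalanced n I p H t r z})
    \<le> ennreal (H * n * (2 * exp (H * (2 * \<tau>\<^sup>2 + \<tau> * \<eta>) - \<tau> * t)))"
proof -
  define X where "X = 2 * exp (H * (2 * \<tau>\<^sup>2 + \<tau> * \<eta>) - \<tau> * t)"
  have X0: "0 \<le> X" by (simp add: X_def)
  define E where "E r l = {z \<in> space (coords r). spine (slot_rel n p r z) r l \<and>
      t < \<bar>real (card (right_sibs n I (slot_rel n p r z) z l)) - small_ancestors I l / 2\<bar>}" for r l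
  have E_sets: "E r l \<in> sets (coords r)" if l: "l \<in> spine_lists n r h" for r l h
  proof -
    have "Measurable.pred (coords r) (\<lambda>z. spine (slot_rel n p r z) r l \<and>
      t < \<bar>real (card (right_sibs n I (slot_rel n p r z) z l)) - small_ancestors I l / 2\<bar>)"
    proof (rule pred_slot_rel[where Q = "\<lambda>R z. spine R r l \<and> t < \<bar>real (card (right_sibs n I R z l)) - small_ancestors I l / 2\<bar>"])
      fix R
      have "Measurable.pred (coords r) (\<lambda>z. t < \<bar>real (card (right_sibs n I R z l)) - small_ancestors I l / 2\<bar>)"
        by (rule pred_right_sibs[OF l, where Q = "\<lambda>A z. t < \<bar>real (card A) - small_ancestors I l / 2\<bar>"]) simp
      then show "Measurable.pred (coords r) (\<lambda>z. spine R r l \<and> t < \<bar>real (card (right_sibs n I R z l)) - small_ancestors I l / 2\<bar>)"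
        by (intro pred_intros_logic) simp
    qed
    then show ?thesis unfolding E_def pred_def .
  qed
  have "emeasure (coords r) {z \<in> space (coords r). unbalanced n I p H t r z}
      \<le> (\<Sum>h<H. \<Sum>l\<in>spine_lists n r (Suc h). (\<Prod>k<h. ennreal (p (l ! Suc k))) * ennreal X)"
    if r: "r \<in> {1..n}" for r
  proof -
    have "{z \<in> space (coords r). unbalanced n I p H t r z} = (\<Union>h\<in>{1..H}. \<Union>l\<in>spine_lists n r h. E r l)"
      unfolding unbalanced_def E_def by blast
    also have "{1..H} = Suc ` {..<H}" by (simp only: image_Suc_lessThan)
    also have "(\<Union>h\<in>Suc ` {..<H}. \<Union>l\<in>spine_lists n r h. E r l) = (\<Union>h\<in>{..<H}. \<Union>l\<in>spine_lists n r (Suc h). E r l)"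
      by simp
    also have "emeasure (coords r) \<dots> \<le> (\<Sum>h<H. emeasure (coords r) (\<Union>l\<in>spine_lists n r (Suc h). E r l))"
      by (rule emeasure_subadditive_finite) (use E_sets finite_spine_lists in auto)
    also have "\<dots> \<le> (\<Sum>h<H. \<Sum>l\<in>spine_lists n r (Suc h). emeasure (coords r) (E r l))"
      by (intro sum_mono emeasure_subadditive_finite) (use E_sets finite_spine_lists in auto)
    also have "\<dots> \<le> (\<Sum>h<H. \<Sum>l\<in>spine_lists n r (Suc h). (\<Prod>k<h. ennreal (p (l ! Suc k))) * ennreal X)"
      unfolding E_def X_def by (intro sum_mono emeasure_spine_unbalanced) (use r \<tau> in auto)
    finally show ?thesis .
  qed
  then have "(\<Sum>r=1..n. emeasure (coords r) {z \<in> space (coords r). unbalanced n I p H t r z})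
      \<le> (\<Sum>r=1..n. \<Sum>h<H. \<Sum>l\<in>spine_lists n r (Suc h). (\<Prod>k<h. ennreal (p (l ! Suc k))) * ennreal X)"
    by (rule sum_mono)
  also have "\<dots> = (\<Sum>h<H. (\<Sum>r=1..n. \<Sum>l\<in>spine_lists n r (Suc h). \<Prod>k<h. ennreal (p (l ! Suc k))) * ennreal X)"
    unfolding sum_distrib_right by (rule sum.swap)
  also have "\<dots> \<le> (\<Sum>h<H. ennreal n * ennreal X)"
  proof (intro sum_mono mult_right_mono)
    fix h
    have "(\<Sum>r=1..n. \<Sum>l\<in>spine_lists n r (Suc h). \<Prod>k<h. ennreal (p (l ! Suc k))) \<le> ennreal (n * path_weight h)"
      by (rule sum_spine_weight_le)
    also have "\<dots> \<le> ennreal n" using path_weight_le_1[of h] by (intro ennreal_leI) (simp add: mult_left_le)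
    finally show "(\<Sum>r=1..n. \<Sum>l\<in>spine_lists n r (Suc h). \<Prod>k<h. ennreal (p (l ! Suc k))) \<le> ennreal n" .
  qed simp
  also have "\<dots> = ennreal (H * n * X)"
    using X0 by (simp add: ennreal_mult ennreal_of_nat_eq_real_of_nat mult.assoc)
  finally show ?thesis by (simp add: X_def)
qed

lemma sum_emeasure_uneven_window:
  assumes \<tau>: "0 < \<tau>" "\<tau> \<le> 1 / 2" and P: "\<And>i. i \<in> {1..I} \<Longrightarrow> p i \<le> P"
  shows "(\<Sum>r=1..n. emeasure (coords r) {z \<in> space (coords r). uneven_window n I p s \<delta> r z})
    \<le> ennreal (n * (I * ((n + 1) * (2 * exp ((P * (\<tau>\<^sup>2 + \<tau> * \<eta>) - \<tau> * \<delta>) / s)))))"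
proof -
  define X where "X = 2 * exp ((P * (\<tau>\<^sup>2 + \<tau> * \<eta>) - \<tau> * \<delta>) / s)"
  have X0: "0 \<le> X" by (simp add: X_def)
  have \<eta>: "0 \<le> \<eta>" using small_count[of "{}"] by simp
  define E where "E r i k = {z \<in> space (coords r).
      \<delta> < \<bar>s * real (window_count n I p r z i (real k / real n * p i)) - real k / real n * p i\<bar>}" for r i k
  have E_sets: "E r i k \<in> sets (coords r)" if "i \<in> {1..I}" for r i k
  proof -
    have "Measurable.pred (coords r) (\<lambda>z. \<delta> < \<bar>s * real (card {v. I < v \<and> (i, v) \<in> slot_rel n p r z
      \<and> z v \<le> slot_start p i + real k / real n * p i}) - real k / real n * p i\<bar>)"
    proof (rule pred_set_valued[where F = "{1..n} - {r}" and Q = "\<lambda>A z. \<delta> < \<bar>s * real (card A) - real k / real n * p i\<bar>"])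
      fix v assume v: "v \<in> {1..n} - {r}"
      have "Measurable.pred (coords r) (\<lambda>z. z v \<le> slot_start p i + real k / real n * p i)"
        by (rule pred_coordinate[OF v]) simp
      then show "Measurable.pred (coords r) (\<lambda>z. v \<in> {v. I < v \<and> (i, v) \<in> slot_rel n p r z
          \<and> z v \<le> slot_start p i + real k / real n * p i})"
        using pred_coordinate_slot[OF v] v by (simp add: slot_rel_def)
    qed (auto simp: slot_rel_def)
    then show ?thesis unfolding E_def window_count_def pred_def .
  qed
  have E_le: "emeasure (coords r) (E r i k) \<le> ennreal X" if "r \<in> {1..n}" "i \<in> {1..I}" "k \<in> {0..n}" for r i k
  proof -
    have i_n: "i \<in> {1..n}" using that I_le by auto
    have k: "0 \<le> real k / real n * p i" "real k / real n * p i \<le> p i"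
      using that p_pos[OF i_n] n_pos by (auto simp: field_simps)
    have "emeasure (coords r) (E r i k) \<le> ennreal (2 * exp ((p i * (\<tau>\<^sup>2 + \<tau> * \<eta>) - \<tau> * \<delta>) / s))"
      unfolding E_def by (rule emeasure_uneven_window_single[OF that(1,2) k \<tau>])
    also have "\<dots> \<le> ennreal X"
    proof -
      have "p i * (\<tau>\<^sup>2 + \<tau> * \<eta>) \<le> P * (\<tau>\<^sup>2 + \<tau> * \<eta>)" using P[OF that(2)] \<tau> \<eta> by (intro mult_right_mono) auto
      then show ?thesis unfolding X_def using s_pos by (intro ennreal_leI) (simp add: divide_right_mono)
    qed
    finally show ?thesis .
  qed
  have "emeasure (coords r) {z \<in> space (coords r). uneven_window n I p s \<delta> r z} \<le> of_nat (I * (n + 1)) * ennreal X"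
    if r: "r \<in> {1..n}" for r
  proof -
    have "{z \<in> space (coords r). uneven_window n I p s \<delta> r z} = (\<Union>i\<in>{1..I}. \<Union>k\<in>{0..n}. E r i k)"
      unfolding uneven_window_def E_def by blast
    also have "emeasure (coords r) \<dots> \<le> (\<Sum>i=1..I. emeasure (coords r) (\<Union>k\<in>{0..n}. E r i k))"
      by (rule emeasure_subadditive_finite) (use E_sets in auto)
    also have "\<dots> \<le> (\<Sum>i=1..I. \<Sum>k=0..n. emeasure (coords r) (E r i k))"
      by (intro sum_mono emeasure_subadditive_finite) (use E_sets in auto)
    also have "\<dots> \<le> (\<Sum>i=1..I. \<Sum>k=0..n. ennreal X)" by (intro sum_mono E_le r)
    also have "\<dots> = of_nat (I * (n + 1)) * ennreal X" by (simp add: algebra_simps)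
    finally show ?thesis .
  qed
  then have "(\<Sum>r=1..n. emeasure (coords r) {z \<in> space (coords r). uneven_window n I p s \<delta> r z})
      \<le> (\<Sum>r=1..n. of_nat (I * (n + 1)) * ennreal X)" by (rule sum_mono)
  also have "\<dots> = of_nat (n * (I * (n + 1))) * ennreal X" by (simp add: mult.assoc)
  also have "\<dots> = ennreal (n * (I * ((n + 1) * X)))"
    unfolding ennreal_of_nat_eq_real_of_nat using X0 by (subst ennreal_mult[symmetric]) (simp_all add: algebra_simps)
  finally show ?thesis by (simp add: X_def)
qed

section \<open>The exceptional set and the comparison outside it\<close>

definition bad :: "real \<Rightarrow> real \<Rightarrow> nat \<Rightarrow> (nat \<Rightarrow> real) \<Rightarrow> bool" where
  "bad t \<delta> r z \<longleftrightarrow> long_spine n p H r z \<or> unbalanced n I p H t r z \<or> uneven_window n I p s \<delta> r z \<or> hub_pair n I p r z"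

lemma outer_measure_bad:
  assumes \<tau>: "0 < \<tau>" "\<tau> \<le> 1 / 2" and P: "\<And>i. i \<in> {1..I} \<Longrightarrow> p i \<le> P"
  shows "outer_measure_of (uniform_marks n) {x \<in> space (uniform_marks n).
      generic_marks n p x \<longrightarrow> bad t \<delta> (root_vertex n p x) (slot_coords n p x)}
    \<le> ennreal (n * exp (- s * (real H * (real H - 1) / 2)))
      + ennreal (H * n * (2 * exp (H * (2 * \<tau>\<^sup>2 + \<tau> * \<eta>) - \<tau> * t)))
      + ennreal (n * (I * ((n + 1) * (2 * exp ((P * (\<tau>\<^sup>2 + \<tau> * \<eta>) - \<tau> * \<delta>) / s)))))
      + ennreal (real I * (\<Sum>i=1..I. p i))"
proof -
  let ?S = "\<lambda>Q r. {z \<in> space (coords r). Q r z}"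
  have sets: "?S (long_spine n p H) r \<in> sets (coords r)" "?S (unbalanced n I p H t) r \<in> sets (coords r)"
    "?S (uneven_window n I p s \<delta>) r \<in> sets (coords r)" "?S (hub_pair n I p) r \<in> sets (coords r)" for r
    using pred_long_spine pred_unbalanced pred_uneven_window pred_hub_pair unfolding pred_def by blast+
  have split: "?S (bad t \<delta>) r = ?S (long_spine n p H) r \<union> (?S (unbalanced n I p H t) r
      \<union> (?S (uneven_window n I p s \<delta>) r \<union> ?S (hub_pair n I p) r))" for r
    unfolding bad_def by blast
  have bad_sets: "?S (bad t \<delta>) r \<in> sets (coords r)" for r
    unfolding split using sets by (intro sets.Un)
  have bad_le: "emeasure (coords r) (?S (bad t \<delta>) r) \<le> emeasure (coords r) (?S (long_spine n p H) r)
      + (emeasure (coords r) (?S (unbalanced n I p H t) r) + (emeasure (coords r) (?S (uneven_window n I p s \<delta>) r)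
      + emeasure (coords r) (?S (hub_pair n I p) r)))" for r
    unfolding split using sets[of r]
    by (intro order_trans[OF emeasure_subadditive] add_left_mono sets.Un order_refl)
  have sub: "{x \<in> space (uniform_marks n). generic_marks n p x \<longrightarrow> bad t \<delta> (root_vertex n p x) (slot_coords n p x)}
    \<subseteq> {x \<in> space (uniform_marks n). generic_marks n p x \<longrightarrow> slot_coords n p x \<in> ?S (bad t \<delta>) (root_vertex n p x)}"
    by (auto simp: space_unif_prod slot_coords_def)
  have "outer_measure_of (uniform_marks n) {x \<in> space (uniform_marks n).
      generic_marks n p x \<longrightarrow> bad t \<delta> (root_vertex n p x) (slot_coords n p x)}
    \<le> (\<Sum>r=1..n. emeasure (coords r) (?S (bad t \<delta>) r))"
    by (rule order_trans[OF outer_measure_of_mono[OF sub]],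
      rule outer_measure_transfer[OF n_pos p_pos p_sum bad_sets])
  also have "\<dots> \<le> (\<Sum>r=1..n. emeasure (coords r) (?S (long_spine n p H) r)
      + (emeasure (coords r) (?S (unbalanced n I p H t) r) + (emeasure (coords r) (?S (uneven_window n I p s \<delta>) r)
      + emeasure (coords r) (?S (hub_pair n I p) r))))"
    by (rule sum_mono) (rule bad_le)
  also have "\<dots> \<le> ennreal (n * exp (- s * (real H * (real H - 1) / 2)))
      + (ennreal (H * n * (2 * exp (H * (2 * \<tau>\<^sup>2 + \<tau> * \<eta>) - \<tau> * t)))
      + (ennreal (n * (I * ((n + 1) * (2 * exp ((P * (\<tau>\<^sup>2 + \<tau> * \<eta>) - \<tau> * \<delta>) / s)))))
      + ennreal (real I * (\<Sum>i=1..I. p i))))"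
    unfolding sum.distrib
    by (intro add_mono sum_emeasure_long_spine sum_emeasure_unbalanced[OF \<tau>]
      sum_emeasure_uneven_window[OF \<tau> P] sum_emeasure_hub_pair)
  finally show ?thesis by (simp only: add.assoc)
qed

lemma not_bad_close:
  fixes t \<delta> :: real
  assumes gen: "generic_marks n p x" and good: "\<not> bad t \<delta> (root_vertex n p x) (slot_coords n p x)"
    and \<delta>: "0 \<le> \<delta>" and u: "0 \<le> u" "u \<le> 1"
  shows "0 \<le> H_proc n p x u" "H_proc n p x u \<le> H"
    "\<bar>s / 2 * H_proc n p x u - G_proc I n p x u\<bar> \<le> (I + 2) * (\<delta> + 1 / n) + s * (3 * t + I + 3)"
proof -
  define r where "r = root_vertex n p x"
  define y where "y = shifted n p x"
  define z where "z = slot_coords n p x"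
  have M: "marks n p y r" unfolding y_def r_def by (rule marks_shifted[OF n_pos p_pos p_sum gen])
  have HT: "hub_tree n p y r x I s"
    by (rule hub_tree.intro[OF M]) (unfold_locales, use I_le s_pos small in \<open>auto simp: y_def r_def\<close>)
  have SM: "slot_marks n p y r z" unfolding y_def r_def z_def by (rule slot_marks_coords[OF n_pos p_pos p_sum gen])
  interpret slot_hub_tree n p y r x I s z using HT SM by (rule slot_hub_tree.intro)
  have nb: "\<not> long_spine n p H r z" "\<not> unbalanced n I p H t r z" "\<not> uneven_window n I p s \<delta> r z" "\<not> hub_pair n I p r z"
    using good unfolding bad_def r_def z_def by blast+
  interpret good_tree n p y r x I s t "\<delta> + 1 / n" by (rule good_treeI[OF nb \<delta>])
  obtain j where j: "in_step j u" using in_step_ex[OF u] by blast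
  note jn = in_step_D(1)[OF j]
  obtain l where l: "spine T r l" "hd l = W ! j" "distinct l" "set l \<subseteq> set (take (Suc j) W)"
    using spine_ex[OF jn] by blast
  have sub: "set l \<subseteq> {1..n}" using l(4) set_take_subset[of "Suc j" W] W_set by blast
  have len: "1 \<le> length l" using l(1) by (cases l) (auto simp: spine_def)
  have H_eq: "H_proc n p x u = real (length l - 1)" using H_proc_eq[OF j l(1,2)] .
  then show "0 \<le> H_proc n p x u" by simp
  have "length l \<le> H" by (rule spine_length_le[OF nb(1) l(1,3) sub])
  then show "H_proc n p x u \<le> H" using H_eq by simp
  define R where "R = real (card (right_sibs n I T y l))"
  have G: "\<bar>G_proc I n p x u - s * R\<bar> \<le> (I + 2) * (\<delta> + 1 / n) + s * (2 * t + 3)"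
    unfolding R_def by (rule G_proc_close[OF j l])
  have "\<bar>R - small_ancestors I l / 2\<bar> \<le> t" unfolding R_def by (rule balance[OF l(1,3) sub])
  \<comment> \<open>\<open>balance\<close> refers to the small ancestors, whereas the height counts
    all of them; the two numbers differ by at most \<open>I\<close>.\<close>
  then have "\<bar>H_proc n p x u / 2 - R\<bar> \<le> t + I"
    using small_ancestors_bounds[OF l(3) sub, of I] unfolding H_eq by (auto simp: abs_le_iff)
  then have "s * \<bar>H_proc n p x u / 2 - R\<bar> \<le> s * (t + I)" using s_pos by (intro mult_left_mono) auto
  then have "\<bar>s / 2 * H_proc n p x u - s * R\<bar> \<le> s * (t + I)"
  proof -
    have "s / 2 * H_proc n p x u - s * R = s * (H_proc n p x u / 2 - R)" by (simp add: algebra_simps)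
    then show ?thesis using \<open>s * \<bar>H_proc n p x u / 2 - R\<bar> \<le> s * (t + I)\<close> s_pos by (simp add: abs_mult)
  qed
  moreover have "s * (3 * t + I + 3) = s * (2 * t + 3) + s * (t + I)" by (simp add: algebra_simps)
  ultimately show "\<bar>s / 2 * H_proc n p x u - G_proc I n p x u\<bar> \<le> (I + 2) * (\<delta> + 1 / n) + s * (3 * t + I + 3)"
    using G unfolding abs_le_iff by linarith
qed

end

subsection \<open>The asymptotics of the witness\<close>

locale theta_finite =
  fixes \<theta> :: "nat \<Rightarrow> real" and I :: nat
  assumes theta: "\<theta> \<in> Theta_finite" and I: "I = theta_length \<theta>"
begin

lemma theta_0_pos: "0 < \<theta> 0"
  using theta by (simp add: Theta_finite_def)

lemma theta_nonneg: "1 \<le> i \<Longrightarrow> 0 \<le> \<theta> i"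
  using theta by (simp add: Theta_finite_def)

lemma theta_antimono:
  assumes "1 \<le> i" "i \<le> j"
  shows "\<theta> j \<le> \<theta> i"
  using assms(2)
proof (induction j rule: dec_induct)
  case (step j)
  have "\<theta> (Suc j) \<le> \<theta> j" using theta step assms(1) by (simp add: Theta_finite_def)
  then show ?case using step by simp
qed simp

lemma theta_eq_0: "I < i \<Longrightarrow> \<theta> i = 0"
proof -
  assume i: "I < i"
  have "finite {i. \<theta> i \<noteq> 0}" using theta by (simp add: Theta_finite_def)
  then obtain m where m: "\<forall>i\<in>{i. \<theta> i \<noteq> 0}. i \<le> m" using finite_nat_set_iff_bounded_le by blast
  have "\<forall>i>m. \<theta> i = 0" using m by (auto simp: not_le[symmetric])
  then have "\<forall>i>I. \<theta> i = 0" unfolding I theta_length_def by (rule LeastI)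
  then show ?thesis using i by blast
qed

text \<open>This is the minimality of the length. It makes the lightest hub of order n^(-1/2), hence
  eventually heavier than the small vertices of order 1 / n, so that the weights come out
  ranked.\<close>

lemma theta_I_pos: "1 \<le> I \<Longrightarrow> 0 < \<theta> I"
proof (rule ccontr)
  assume 1: "1 \<le> I" and "\<not> 0 < \<theta> I"
  then have I0: "\<theta> I = 0" using theta_nonneg[of I] by simp
  have "\<theta> i = 0" if "I - 1 < i" for i
  proof (cases "i = I")
    case False
    then have "I < i" using that by linarith
    then show ?thesis by (rule theta_eq_0)
  qed (simp add: I0)
  then have "\<forall>i>I - 1. \<theta> i = 0" by blast
  then have "I \<le> I - 1" unfolding I theta_length_def by (rule Least_le)
  then show False using 1 by simp
qed

lemma sum_theta_sq: "(\<Sum>i=1..I. (\<theta> i)\<^sup>2) = 1 - (\<theta> 0)\<^sup>2"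
proof -
  have "(\<lambda>i. (\<theta> i)\<^sup>2) sums (\<Sum>i\<in>{0..I}. (\<theta> i)\<^sup>2)" by (rule sums_finite) (auto simp: theta_eq_0)
  moreover have "(\<lambda>i. (\<theta> i)\<^sup>2) sums 1" using theta by (simp add: Theta_finite_def)
  ultimately have "(\<Sum>i\<in>{0..I}. (\<theta> i)\<^sup>2) = 1" by (rule sums_unique2)
  then show ?thesis by (simp add: sum.atLeast_Suc_atMost)
qed

section \<open>The weights and their standard deviation\<close>

definition hub_sum :: real where "hub_sum = (\<Sum>i=1..I. \<theta> i) / \<theta> 0"

definition small_weight :: "nat \<Rightarrow> real" where
  "small_weight n = (1 - hub_sum / sqrt n) / (real n - real I)"

definition large_enough :: "nat \<Rightarrow> bool" where
  "large_enough n \<longleftrightarrow> I < n \<and> hub_sum / sqrt n < 1 \<and> (1 \<le> I \<longrightarrow> small_weight n \<le> \<theta> I / (\<theta> 0 * sqrt n))"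

text \<open>As \<sigma> is asymptotic to 1 / (\<theta>_0 sqrt n), the hub weights have ratio
  \<theta>_i to it in the limit. For the finitely many \<open>n\<close> at which this choice is not
  yet a ranked distribution, the uniform one is taken.\<close>

definition weight :: "nat \<Rightarrow> nat \<Rightarrow> real" where
  "weight n i = (if \<not> large_enough n then 1 / n
     else if i \<le> I then \<theta> i / (\<theta> 0 * sqrt n) else small_weight n)"

lemma hub_sum_nonneg: "0 \<le> hub_sum"
  unfolding hub_sum_def using theta_0_pos theta_nonneg by (intro divide_nonneg_pos sum_nonneg) auto

lemma theta_le_hub_sum: "i \<in> {1..I} \<Longrightarrow> \<theta> i / \<theta> 0 \<le> hub_sum"
  unfolding hub_sum_def using theta_0_pos theta_nonneg
  by (intro divide_right_mono member_le_sum) auto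

lemma large_enoughD:
  assumes "large_enough n"
  shows "I < n" "0 < sqrt n" "0 < small_weight n" "i \<in> {1..n} \<Longrightarrow> small_weight n \<le> weight n i"
    "i \<in> {1..I} \<Longrightarrow> weight n i = \<theta> i / (\<theta> 0 * sqrt n)" "I < i \<Longrightarrow> weight n i = small_weight n"
proof -
  show n: "I < n" using assms by (simp add: large_enough_def)
  then show "0 < sqrt n" by simp
  show s: "0 < small_weight n" using assms n by (simp add: large_enough_def small_weight_def)
  show hub: "i \<in> {1..I} \<Longrightarrow> weight n i = \<theta> i / (\<theta> 0 * sqrt n)" for i using assms by (simp add: weight_def)
  show sm: "I < i \<Longrightarrow> weight n i = small_weight n" for i using assms by (simp add: weight_def)
  show "small_weight n \<le> weight n i" if i: "i \<in> {1..n}" for i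
  proof (cases "i \<le> I")
    case True
    then have "small_weight n \<le> \<theta> I / (\<theta> 0 * sqrt n)" using assms i by (auto simp: large_enough_def)
    also have "\<dots> \<le> \<theta> i / (\<theta> 0 * sqrt n)"
      using theta_antimono[of i I] True i theta_0_pos by (intro divide_right_mono) auto
    finally show ?thesis using hub[of i] True i by simp
  qed (simp add: sm)
qed

lemma split_interval: "I \<le> n \<Longrightarrow> (\<Sum>i=1..n. f i) = (\<Sum>i=1..I. f i) + (\<Sum>i\<in>{I<..n}. f i :: real)"
proof -
  assume "I \<le> n"
  then have "{1..n} = {1..I} \<union> {I<..n}" by auto
  then show ?thesis by (simp only:) (rule sum.union_disjoint, auto)
qed

lemma sum_hub_weight: "large_enough n \<Longrightarrow> (\<Sum>i=1..I. weight n i) = hub_sum / sqrt n"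
  using large_enoughD(5)[of n] by (simp add: hub_sum_def sum_divide_distrib)

lemma sum_weight:
  assumes n: "large_enough n"
  shows "(\<Sum>i=1..n. weight n i) = 1"
proof -
  have nI: "I < n" using large_enoughD(1)[OF n] .
  have "(\<Sum>i\<in>{I<..n}. weight n i) = (real n - real I) * small_weight n"
    using large_enoughD(6)[OF n] nI by (simp add: of_nat_diff)
  also have "\<dots> = 1 - hub_sum / sqrt n" using nI by (simp add: small_weight_def)
  finally show ?thesis using split_interval[of n "weight n"] sum_hub_weight[OF n] nI by simp
qed

lemma ranked_weight:
  assumes "1 \<le> n"
  shows "ranked_distribution n (weight n)"
proof (cases "large_enough n")
  case False
  then show ?thesis using assms by (auto simp: ranked_distribution_def weight_def monotone_on_def)
next
  case True
  note L = large_enoughD[OF True]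
  have "antimono_on {1..n} (weight n)"
  proof (rule monotone_onI)
    fix i j assume ij: "i \<in> {1..n}" "j \<in> {1..n}" "i \<le> j"
    show "weight n j \<le> weight n i"
    proof (cases "j \<le> I")
      case True
      then show ?thesis using L(5)[of i] L(5)[of j] ij theta_antimono[of i j] theta_0_pos
        by (auto intro!: divide_right_mono)
    next
      case False
      then show ?thesis using L(6)[of j] L(4)[OF ij(1)] by simp
    qed
  qed
  moreover have "0 < weight n i" if "i \<in> {1..n}" for i using L(3) L(4)[OF that] by simp
  ultimately show ?thesis using sum_weight[OF True] by (simp add: ranked_distribution_def)
qed

text \<open>This is \<open>n\<close> times the sum of the squared weights. The first term comes from
  the hubs, whose \<theta>_i^2 add up to 1 - \<theta>_0^2, and the second from the small
  vertices.\<close>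

definition variance_ratio :: "nat \<Rightarrow> real" where
  "variance_ratio n = (1 - (\<theta> 0)\<^sup>2) / (\<theta> 0)\<^sup>2 + real n * (1 - hub_sum / sqrt n)\<^sup>2 / (real n - real I)"

lemma sigma_weight_sq:
  assumes n: "large_enough n"
  shows "(sigma_p n (weight n))\<^sup>2 = variance_ratio n / n" "0 < variance_ratio n"
    "sigma_p n (weight n) = sqrt (variance_ratio n) / sqrt n"
proof -
  note L = large_enoughD[OF n]
  have "(\<Sum>i=1..I. (weight n i)\<^sup>2) = (\<Sum>i=1..I. (\<theta> i)\<^sup>2 / ((\<theta> 0)\<^sup>2 * n))"
    using L(5) by (intro sum.cong) (auto simp: power_divide power_mult_distrib)
  also have "\<dots> = (1 - (\<theta> 0)\<^sup>2) / (\<theta> 0)\<^sup>2 / n" 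
    unfolding sum_divide_distrib[symmetric] sum_theta_sq by simp
  finally have hub: "(\<Sum>i=1..I. (weight n i)\<^sup>2) = (1 - (\<theta> 0)\<^sup>2) / (\<theta> 0)\<^sup>2 / n" .
  have "(\<Sum>i\<in>{I<..n}. (weight n i)\<^sup>2) = (real n - real I) * (small_weight n)\<^sup>2"
    using L(1,6) by (simp add: of_nat_diff)
  also have "\<dots> = (1 - hub_sum / sqrt n)\<^sup>2 / (real n - real I)"
    using L(1) by (simp add: small_weight_def power_divide) (simp add: power2_eq_square)
  finally have small: "(\<Sum>i\<in>{I<..n}. (weight n i)\<^sup>2) = (1 - hub_sum / sqrt n)\<^sup>2 / (real n - real I)" .
  have sum: "(\<Sum>i=1..n. (weight n i)\<^sup>2) = variance_ratio n / n"
    using split_interval[of n "\<lambda>i. (weight n i)\<^sup>2"] hub small L(1)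
    by (simp add: variance_ratio_def add_divide_distrib)
  have "0 < (\<Sum>i=1..n. (weight n i)\<^sup>2)"
  proof (rule sum_pos)
    show "0 < (weight n i)\<^sup>2" if "i \<in> {1..n}" for i using L(3) L(4)[OF that] by simp
  qed (use L(1) in auto)
  then have "0 < variance_ratio n / n" using sum by simp
  then show "0 < variance_ratio n" using L(1) by (simp add: zero_less_divide_iff)
  show "(sigma_p n (weight n))\<^sup>2 = variance_ratio n / n"
    using \<open>0 < variance_ratio n / n\<close> unfolding sigma_p_def sum by simp
  show "sigma_p n (weight n) = sqrt (variance_ratio n) / sqrt n"
    unfolding sigma_p_def sum by (simp add: real_sqrt_divide)
qed

lemma ratio_tendsto_1: "(\<lambda>n. real n / (real n - real I)) \<longlonglongrightarrow> 1"
  by real_asymp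

lemma hub_sum_sqrt_tendsto_0: "(\<lambda>n. hub_sum / sqrt (real n)) \<longlonglongrightarrow> 0"
proof -
  have "(\<lambda>n. 1 / sqrt (real n)) \<longlonglongrightarrow> 0" by real_asymp
  then have "(\<lambda>n. hub_sum * (1 / sqrt (real n))) \<longlonglongrightarrow> hub_sum * 0" by (rule tendsto_mult_left)
  then show ?thesis by simp
qed

lemma small_weight_tendsto: "(\<lambda>n. real n * small_weight n) \<longlonglongrightarrow> 1"
proof -
  have "(\<lambda>n. (1 - hub_sum / sqrt (real n)) * (real n / (real n - real I))) \<longlonglongrightarrow> (1 - 0) * 1"
    by (intro tendsto_intros hub_sum_sqrt_tendsto_0 ratio_tendsto_1)
  then show ?thesis by (simp add: small_weight_def mult.commute)
qed

lemma variance_ratio_tendsto: "variance_ratio \<longlonglongrightarrow> 1 / (\<theta> 0)\<^sup>2"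
proof -
  have "(\<lambda>n. (1 - (\<theta> 0)\<^sup>2) / (\<theta> 0)\<^sup>2 + (1 - hub_sum / sqrt (real n))\<^sup>2 * (real n / (real n - real I)))
      \<longlonglongrightarrow> (1 - (\<theta> 0)\<^sup>2) / (\<theta> 0)\<^sup>2 + (1 - 0)\<^sup>2 * 1"
    by (intro tendsto_add tendsto_mult tendsto_power tendsto_diff tendsto_const
      hub_sum_sqrt_tendsto_0 ratio_tendsto_1)
  moreover have "(1 - (\<theta> 0)\<^sup>2) / (\<theta> 0)\<^sup>2 + (1 - 0)\<^sup>2 * 1 = 1 / (\<theta> 0)\<^sup>2"
    using theta_0_pos by (simp add: diff_divide_distrib)
  moreover have "variance_ratio = (\<lambda>n. (1 - (\<theta> 0)\<^sup>2) / (\<theta> 0)\<^sup>2 + (1 - hub_sum / sqrt (real n))\<^sup>2 * (real n / (real n - real I)))"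
    by (rule ext) (simp add: variance_ratio_def)
  ultimately show ?thesis by (simp only:)
qed

lemma eventually_small_weight:
  "\<forall>\<^sub>F n in sequentially. 1 / 2 \<le> real n * small_weight n \<and> real n * small_weight n \<le> 2"
proof -
  have "\<forall>\<^sub>F n in sequentially. 1 / 2 < real n * small_weight n"
    by (rule order_tendstoD(1)[OF small_weight_tendsto]) simp
  moreover have "\<forall>\<^sub>F n in sequentially. real n * small_weight n < 2"
    by (rule order_tendstoD(2)[OF small_weight_tendsto]) simp
  ultimately show ?thesis by eventually_elim linarith
qed

lemma eventually_large_enough: "\<forall>\<^sub>F n in sequentially. large_enough n"
proof -
  have 1: "\<forall>\<^sub>F n in sequentially. I < n" by (rule eventually_gt_at_top)
  have 2: "\<forall>\<^sub>F n in sequentially. hub_sum / sqrt (real n) < 1"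
    using order_tendstoD(2)[OF hub_sum_sqrt_tendsto_0] by simp
  have 3: "\<forall>\<^sub>F n in sequentially. 1 \<le> I \<longrightarrow> small_weight n \<le> \<theta> I / (\<theta> 0 * sqrt n)"
  proof (cases "1 \<le> I")
    case True
    then have pos: "0 < \<theta> I / \<theta> 0" using theta_I_pos theta_0_pos by simp
    have "(\<lambda>n. 2 / sqrt (real n)) \<longlonglongrightarrow> 0" by real_asymp
    then have "\<forall>\<^sub>F n in sequentially. 2 / sqrt (real n) < \<theta> I / \<theta> 0" by (rule order_tendstoD(2)[OF _ pos])
    then show ?thesis using eventually_small_weight 1
    proof eventually_elim
      case (elim n)
      have n: "0 < sqrt (real n)" using elim(3) by simp
      have "small_weight n * sqrt n * sqrt n = real n * small_weight n"
        by (simp add: mult.assoc)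
      also have "\<dots> \<le> 2" using elim by blast
      finally have "small_weight n * sqrt n * sqrt n \<le> 2" .
      then have "small_weight n * sqrt n \<le> 2 / sqrt n" using n by (simp add: pos_le_divide_eq)
      also have "\<dots> \<le> \<theta> I / \<theta> 0" using elim(1) by (rule less_imp_le)
      finally have "small_weight n \<le> \<theta> I / \<theta> 0 / sqrt n" using n by (simp only: pos_le_divide_eq)
      then show ?case by simp
    qed
  qed simp
  show ?thesis using 1 2 3 by eventually_elim (simp add: large_enough_def)
qed

lemma sigma_tendsto_0: "(\<lambda>n. sigma_p n (weight n)) \<longlonglongrightarrow> 0"
proof -
  have "(\<lambda>n. 1 / sqrt (real n)) \<longlonglongrightarrow> 0" by real_asymp
  then have "(\<lambda>n. sqrt (variance_ratio n) * (1 / sqrt (real n))) \<longlonglongrightarrow> sqrt (1 / (\<theta> 0)\<^sup>2) * 0"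
    by (rule tendsto_mult[OF tendsto_real_sqrt[OF variance_ratio_tendsto]])
  then have "(\<lambda>n. sqrt (variance_ratio n) * (1 / sqrt (real n))) \<longlonglongrightarrow> 0" by (simp only: mult_zero_right)
  then show ?thesis
  proof (rule Lim_transform_eventually)
    show "\<forall>\<^sub>F n in sequentially. sqrt (variance_ratio n) * (1 / sqrt (real n)) = sigma_p n (weight n)"
      using eventually_large_enough by eventually_elim (simp only: sigma_weight_sq(3) times_divide_eq_right mult_1_right)
  qed
qed

lemma inverse_sqrt_variance_tendsto: "(\<lambda>n. 1 / sqrt (variance_ratio n)) \<longlonglongrightarrow> \<theta> 0"
proof -
  have eq: "sqrt (1 / (\<theta> 0)\<^sup>2) = 1 / \<theta> 0"
    by (rule real_sqrt_unique) (use theta_0_pos in \<open>simp_all add: power_divide\<close>)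
  have "(\<lambda>n. 1 / sqrt (variance_ratio n)) \<longlonglongrightarrow> 1 / sqrt (1 / (\<theta> 0)\<^sup>2)"
    by (rule tendsto_divide[OF tendsto_const tendsto_real_sqrt[OF variance_ratio_tendsto]])
      (use theta_0_pos in simp)
  then show ?thesis by (simp only: eq divide_divide_eq_right mult_1_left div_by_1)
qed

lemma hub_ratio_tendsto:
  assumes "i \<in> {1..I}"
  shows "(\<lambda>n. weight n i / sigma_p n (weight n)) \<longlonglongrightarrow> \<theta> i"
proof -
  have "(\<lambda>n. \<theta> i / \<theta> 0 * (1 / sqrt (variance_ratio n))) \<longlonglongrightarrow> \<theta> i / \<theta> 0 * \<theta> 0"
    by (intro tendsto_intros inverse_sqrt_variance_tendsto)
  then have "(\<lambda>n. \<theta> i / \<theta> 0 * (1 / sqrt (variance_ratio n))) \<longlonglongrightarrow> \<theta> i" using theta_0_pos by simp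
  then show ?thesis
  proof (rule Lim_transform_eventually)
    show "\<forall>\<^sub>F n in sequentially. \<theta> i / \<theta> 0 * (1 / sqrt (variance_ratio n)) = weight n i / sigma_p n (weight n)"
      using eventually_large_enough
    proof eventually_elim
      case (elim n)
      have "sqrt (real n) \<noteq> 0" using large_enoughD(2)[OF elim] by simp
      then show ?case using large_enoughD(5)[OF elim assms] by (simp add: sigma_weight_sq(3)[OF elim])
    qed
  qed
qed

lemma small_ratio_tendsto:
  assumes "I < i"
  shows "(\<lambda>n. weight n i / sigma_p n (weight n)) \<longlonglongrightarrow> 0"
proof -
  have "(\<lambda>n. (real n * small_weight n) * (1 / sqrt (real n)) * (1 / sqrt (variance_ratio n))) \<longlonglongrightarrow> 1 * 0 * \<theta> 0"
  proof (intro tendsto_intros inverse_sqrt_variance_tendsto small_weight_tendsto)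
    show "(\<lambda>n. 1 / sqrt (real n)) \<longlonglongrightarrow> 0" by real_asymp
  qed
  then have "(\<lambda>n. (real n * small_weight n) * (1 / sqrt (real n)) * (1 / sqrt (variance_ratio n))) \<longlonglongrightarrow> 0" by simp
  then show ?thesis
  proof (rule Lim_transform_eventually)
    show "\<forall>\<^sub>F n in sequentially. (real n * small_weight n) * (1 / sqrt (real n)) * (1 / sqrt (variance_ratio n))
        = weight n i / sigma_p n (weight n)"
      using eventually_large_enough
    proof eventually_elim
      case (elim n)
      have n: "0 < sqrt (real n)" using large_enoughD(2)[OF elim] .
      have "real n * small_weight n * (1 / sqrt (real n)) = (real n / sqrt (real n)) * small_weight n" by simp
      also have "\<dots> = sqrt (real n) * small_weight n" by (simp only: real_div_sqrt of_nat_0_le_iff)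
      finally show ?case using large_enoughD(6)[OF elim assms] n
        by (simp add: sigma_weight_sq(3)[OF elim] mult.commute)
    qed
  qed
qed

text \<open>The height is cut off above its typical order \<open>n\<^sup>1\<^sup>/\<^sup>2\<close>, at \<open>m = n\<^sup>3\<^sup>/\<^sup>5\<close>. With exponential
  moments of parameter \<open>\<tau> = n\<^sup>-\<^sup>1\<^sup>/\<^sup>5\<close> the variance term \<open>m \<tau>\<^sup>2 = n\<^sup>1\<^sup>/\<^sup>5\<close> in the Chernoff bound for a
  deviation \<open>t = \<kappa> n\<^sup>1\<^sup>/\<^sup>2\<close> is negligible against \<open>\<tau> t = \<kappa> n\<^sup>3\<^sup>/\<^sup>1\<^sup>0\<close>.\<close>

definition cutoff :: "nat \<Rightarrow> nat" where "cutoff n = nat \<lceil>real n powr (3/5)\<rceil>"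
text \<open>The mass of the hubs is at most hub_sum n^(-1/2), and a path up to the cutoff takes at
  most (2 / n) times 2 n^(3/5) from the small vertices. Both are covered by multiples of
  n^(-2/5).\<close>

definition eta :: "nat \<Rightarrow> real" where "eta n = (hub_sum + 4) * real n powr (- 2/5)"

lemma cutoff_bounds: "real n powr (3/5) \<le> cutoff n" "cutoff n \<le> real n powr (3/5) + 1"
proof -
  have "- 1 < real n powr (3/5)" by (rule less_le_trans[OF _ powr_ge_zero]) simp
  then have "0 \<le> \<lceil>real n powr (3/5)\<rceil>" by simp
  then have "real (cutoff n) = of_int \<lceil>real n powr (3/5)\<rceil>" by (simp add: cutoff_def)
  then show "real n powr (3/5) \<le> cutoff n" "cutoff n \<le> real n powr (3/5) + 1" by linarith+
qed

lemma eventually_weights: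
  "\<forall>\<^sub>F n in sequentially. weights n I (weight n) (small_weight n) (eta n) (cutoff n)"
  using eventually_large_enough eventually_small_weight eventually_ge_at_top[of 1]
proof eventually_elim
  case (elim n)
  note L = large_enoughD[OF elim(1)]
  have n: "1 \<le> real n" using elim(3) by simp
  show ?case
  proof unfold_locales
    show "0 < weight n i" if "i \<in> {1..n}" for i using L(3) L(4)[OF that] by simp
    show "(\<Sum>i=1..n. weight n i) = 1" by (rule sum_weight[OF elim(1)])
    have "1 \<le> real n powr (3/5)" using n by (simp add: ge_one_powr_ge_zero)
    then show "1 \<le> cutoff n" using cutoff_bounds(1)[of n] by linarith
    have s: "small_weight n * (real n - real I) = 1 - hub_sum / sqrt n" using L(1) by (simp add: small_weight_def)
    have s_le: "small_weight n \<le> 2 / real n"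
      using elim(2) n by (simp add: pos_le_divide_eq mult.commute)
    have "small_weight n * cutoff n \<le> small_weight n * (real n powr (3/5) + 1)"
      using L(3) cutoff_bounds(2) by (intro mult_left_mono) auto
    also have "\<dots> \<le> 2 / real n * (real n powr (3/5) + 1)"
      using s_le by (intro mult_right_mono) auto
    also have "\<dots> \<le> 2 / real n * (2 * real n powr (3/5))"
      using \<open>1 \<le> real n powr (3/5)\<close> by (intro mult_left_mono) auto
    also have "\<dots> = 4 * (real n powr (3/5) / real n powr 1)" using n by simp
    also have "real n powr (3/5) / real n powr 1 = real n powr (- 2/5)"
      by (subst powr_diff[symmetric]) simp
    finally have cut: "small_weight n * cutoff n \<le> 4 * real n powr (- 2/5)" .
    have "hub_sum / sqrt n = hub_sum * real n powr (- 1/2)"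
      using n by (simp add: powr_half_sqrt[symmetric] powr_minus_divide)
    also have "\<dots> \<le> hub_sum * real n powr (- 2/5)"
      using n by (intro mult_left_mono powr_mono hub_sum_nonneg) auto
    finally have "hub_sum / sqrt n \<le> hub_sum * real n powr (- 2/5)" .
    then show "1 - eta n \<le> small_weight n * (real n - real I - real (cutoff n))"
      using cut s unfolding eta_def by (simp add: algebra_simps)
  qed (use elim(3) L in auto)
qed

lemma powr_three_halves: "real n powr (3/2) = sqrt n * sqrt n * sqrt n"
proof -
  have "real n powr (3/2) = real n powr 1 * real n powr (1/2)" by (subst powr_add[symmetric]) simp
  then show ?thesis by (simp add: powr_half_sqrt)
qed

text \<open>The terms of order 1 / n cancel. At the next order the small mass 1 - hub_sum / sqrt n
  enters squared in \<theta>_0^2 \<sigma>^2 and linearly in \<open>s\<close>, which gives the limit.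
  The rate n^(-3/2) suffices because H / \<sigma> is at most of order n^(3/5 + 1/2).\<close>

lemma scaled_difference_tendsto:
  "(\<lambda>n. real n powr (3/2) * ((\<theta> 0)\<^sup>2 * (variance_ratio n / n) - small_weight n)) \<longlonglongrightarrow> hub_sum * (1 - 2 * (\<theta> 0)\<^sup>2)"
proof -
  define a where "a = (\<theta> 0)\<^sup>2"
  have a: "0 < a" using theta_0_pos by (simp add: a_def)
  have "(\<lambda>n. (a - 1) * (sqrt (real n) * real I / (real n - real I))
      + real n / (real n - real I) * (hub_sum * (1 - 2 * a) + a * hub_sum * (hub_sum / sqrt (real n))))
    \<longlonglongrightarrow> (a - 1) * 0 + 1 * (hub_sum * (1 - 2 * a) + a * hub_sum * 0)"
  proof (intro tendsto_intros ratio_tendsto_1 hub_sum_sqrt_tendsto_0)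
    show "(\<lambda>n. sqrt (real n) * real I / (real n - real I)) \<longlonglongrightarrow> 0" by real_asymp
  qed
  then have "(\<lambda>n. (a - 1) * (sqrt (real n) * real I / (real n - real I))
      + real n / (real n - real I) * (hub_sum * (1 - 2 * a) + a * hub_sum * (hub_sum / sqrt (real n))))
    \<longlonglongrightarrow> hub_sum * (1 - 2 * a)" by simp
  then show ?thesis unfolding a_def[symmetric]
  proof (rule Lim_transform_eventually)
    show "\<forall>\<^sub>F n in sequentially. (a - 1) * (sqrt (real n) * real I / (real n - real I))
      + real n / (real n - real I) * (hub_sum * (1 - 2 * a) + a * hub_sum * (hub_sum / sqrt (real n)))
      = real n powr (3/2) * (a * (variance_ratio n / n) - small_weight n)"
      using eventually_gt_at_top[of I]
    proof eventually_elim
      case (elim n)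
      \<comment> \<open>In terms of q = sqrt n, d = n - I and k = hub_sum / q, the identity is one
        between rational functions.\<close>
      define q where "q = sqrt (real n)"
      define d where "d = real n - real I"
      define k where "k = hub_sum / q"
      have q12: "0 < q" "q * q = real n" using elim by (auto simp: q_def)
      have q: "0 < q" "q * q = real n" "real n powr (3/2) = q * q * q"
        using q12 by (auto simp: powr_three_halves q_def)
      have d: "0 < d" "real I = q * q - d" using elim q by (auto simp: d_def)
      have k: "hub_sum = k * q" using q(1) by (simp add: k_def)
      have v: "a * variance_ratio n = (1 - a) + a * (q * q) * (1 - k)\<^sup>2 / d"
        using a by (simp add: variance_ratio_def a_def[symmetric] q_def[symmetric] d_def[symmetric] k_def[symmetric] q(2)
            distrib_left)
      have s: "small_weight n = (1 - k) / d"
        by (simp add: small_weight_def q_def[symmetric] d_def[symmetric] k_def[symmetric])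
      have "(a - 1) * (q * (q * q - d) / d) + q * q / d * (k * q * (1 - 2 * a) + a * (k * q) * k)
        = q * q * q * (((1 - a) + a * (q * q) * (1 - k)\<^sup>2 / d) / (q * q) - (1 - k) / d)"
        using q(1) d(1) by (simp add: field_simps power2_eq_square)
      then show ?case
        unfolding times_divide_eq_right v s q_def[symmetric] q(3) d_def[symmetric] k_def[symmetric]
        unfolding q(2)[symmetric] d(2) k .
    qed
  qed
qed

text \<open>The terms of the deterministic comparison with \<delta> = \<kappa> / sqrt n and t =
  \<kappa> sqrt n, divided by \<sigma>. The last one is the error from replacing \<theta>_0^2
  \<sigma>^2 by \<open>s\<close>, the height being bounded by the cutoff.\<close>

definition error_bound :: "real \<Rightarrow> nat \<Rightarrow> real" where
  "error_bound \<kappa> n = 1 / sqrt (variance_ratio n) * ((real I + 2) * (\<kappa> + 1 / sqrt n)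
     + (real n * small_weight n * (3 * \<kappa>) + real n * small_weight n * ((real I + 3) / sqrt n))
     + \<bar>real n powr (3/2) * ((\<theta> 0)\<^sup>2 * (variance_ratio n / n) - small_weight n)\<bar> * ((real n powr (3/5) + 1) / (2 * n)))"

lemma error_bound_tendsto:
  fixes \<kappa> :: real
  shows "error_bound \<kappa> \<longlonglongrightarrow> \<theta> 0 * ((I + 5) * \<kappa>)"
proof -
  have 1: "(\<lambda>n. 1 / sqrt (real n)) \<longlonglongrightarrow> 0" by real_asymp
  have 2: "(\<lambda>n. (real I + 3) / sqrt (real n)) \<longlonglongrightarrow> 0" by real_asymp
  have 3: "(\<lambda>n. (real n powr (3/5) + 1) / real (2 * n)) \<longlonglongrightarrow> 0" by real_asymp
  have "(\<lambda>n. error_bound \<kappa> n) \<longlonglongrightarrow> \<theta> 0 * ((real I + 2) * (\<kappa> + 0) + (1 * (3 * \<kappa>) + 1 * 0) + \<bar>hub_sum * (1 - 2 * (\<theta> 0)\<^sup>2)\<bar> * 0)"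
    unfolding error_bound_def
    by (rule tendsto_mult[OF inverse_sqrt_variance_tendsto tendsto_add[OF tendsto_add[OF
      tendsto_mult[OF tendsto_const tendsto_add[OF tendsto_const 1]]
      tendsto_add[OF tendsto_mult[OF small_weight_tendsto tendsto_const] tendsto_mult[OF small_weight_tendsto 2]]]
      tendsto_mult[OF tendsto_rabs[OF scaled_difference_tendsto] 3]]])
  then show ?thesis by (simp add: algebra_simps)
qed

text \<open>The four summands dominate those of \<open>outer_measure_bad\<close> for \<tau> =
  n^(-1/5), once \<open>s\<close> is compared with 1 / n up to factors of 2. The leading exponents
  are -n^(1/5) / 4, then 2 n^(1/5) - \<kappa> n^(3/10), then a multiple of n^(1/10) minus (\<kappa>
  / 2) n^(3/10). The last summand, for edges between hubs, decays only like n^(-1/2).\<close>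

definition prob_bound :: "real \<Rightarrow> nat \<Rightarrow> real" where
  "prob_bound \<kappa> n = n * exp (- (real n powr (3/5) * (real n powr (3/5) - 1) / (4 * n)))
    + (real n powr (3/5) + 1) * n * (2 * exp ((real n powr (3/5) + 1)
        * (2 * real n powr (- 2/5) + real n powr (- 1/5) * ((hub_sum + 4) * real n powr (- 2/5))) - \<kappa> * real n powr (3/10)))
    + n * (I * ((n + 1) * (2 * exp ((2 * hub_sum + 1) * sqrt n
        * (real n powr (- 2/5) + real n powr (- 1/5) * ((hub_sum + 4) * real n powr (- 2/5))) - \<kappa> / 2 * real n powr (3/10)))))
    + I * (hub_sum / sqrt n)"

lemma prob_bound_tendsto_0:
  assumes "0 < \<kappa>"
  shows "prob_bound \<kappa> \<longlonglongrightarrow> 0"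
proof -
  define K where "K = hub_sum + 4"
  define C where "C = 2 * hub_sum + 1"
  have K: "0 < K" "0 < C" using hub_sum_nonneg by (auto simp: K_def C_def)
  have 1: "(\<lambda>n. real n * exp (- (real n powr (3/5) * (real n powr (3/5) - 1) / (4 * real n)))) \<longlonglongrightarrow> 0"
    by real_asymp
  have 2: "(\<lambda>n. (real n powr (3/5) + 1) * real n * (2 * exp ((real n powr (3/5) + 1)
        * (2 * real n powr (- 2/5) + real n powr (- 1/5) * (K * real n powr (- 2/5))) - \<kappa> * real n powr (3/10)))) \<longlonglongrightarrow> 0"
    using K assms by real_asymp
  have 3: "(\<lambda>n. real n * ((real n + 1) * (2 * exp (C * sqrt (real n)
        * (real n powr (- 2/5) + real n powr (- 1/5) * (K * real n powr (- 2/5))) - \<kappa> / 2 * real n powr (3/10))))) \<longlonglongrightarrow> 0"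
    using K assms by real_asymp
  have 4: "(\<lambda>n. real I * (real n * ((real n + 1) * (2 * exp (C * sqrt (real n)
        * (real n powr (- 2/5) + real n powr (- 1/5) * (K * real n powr (- 2/5))) - \<kappa> / 2 * real n powr (3/10)))))
      + real I * (hub_sum / sqrt (real n))) \<longlonglongrightarrow> real I * 0 + real I * 0"
    by (intro tendsto_intros 3 hub_sum_sqrt_tendsto_0)
  have "(\<lambda>n. prob_bound \<kappa> n) \<longlonglongrightarrow> 0 + 0 + 0"
    using tendsto_add[OF tendsto_add[OF 1 2] 4]
    by (simp add: prob_bound_def K_def C_def algebra_simps)
  then show ?thesis by simp
qed

section \<open>Convergence in probability\<close>

definition bad_marks :: "real \<Rightarrow> nat \<Rightarrow> (nat \<Rightarrow> real) \<Rightarrow> bool" where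
  "bad_marks \<kappa> n x \<longleftrightarrow> weights.bad n I (weight n) (small_weight n) (cutoff n) (\<kappa> * sqrt n) (\<kappa> / sqrt n)
     (root_vertex n (weight n) x) (slot_coords n (weight n) x)"

lemma eventually_outer_measure_le:
  assumes \<kappa>: "0 < \<kappa>"
  shows "\<forall>\<^sub>F n in sequentially. outer_measure_of (uniform_marks n)
    {x \<in> space (uniform_marks n). generic_marks n (weight n) x \<longrightarrow> bad_marks \<kappa> n x} \<le> ennreal (prob_bound \<kappa> n)"
  \<comment> \<open>From 32 = 2^5 on, the parameter \<tau> = n^(-1/5) is at most 1/2, as the
    exponential moments require.\<close>
  using eventually_weights eventually_large_enough eventually_small_weight eventually_ge_at_top[of 32]
proof eventually_elim
  case (elim n)
  note L = large_enoughD[OF elim(2)]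
  have n: "32 \<le> real n" using elim(4) by simp
  interpret weights n I "weight n" "small_weight n" "eta n" "cutoff n" by (rule elim(1))
  define q x X \<tau> s P where "q = sqrt (real n)" and "x = real n powr (3/5)" and "X = real (cutoff n)"
    and "\<tau> = real n powr (- 1/5)" and "s = small_weight n" and "P = hub_sum / q"
  have q: "0 < q" "q * q = real n" using n by (simp_all add: q_def)
  have x: "1 \<le> x" using n unfolding x_def by (intro ge_one_powr_ge_zero) auto
  have X: "x \<le> X" "X \<le> x + 1" unfolding x_def X_def by (rule cutoff_bounds)+
  have \<tau>0: "0 < \<tau>" using n by (simp add: \<tau>_def)
  have "\<tau> \<le> 32 powr (- 1/5)" unfolding \<tau>_def using n by (intro powr_mono2') auto
  also have "(32::real) powr (- 1/5) = (2 powr 5) powr (- 1/5)" by simp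
  also have "\<dots> = 1 / 2" by (subst powr_powr) (simp add: powr_minus_divide)
  finally have \<tau>: "\<tau> \<le> 1 / 2" .
  have \<tau>2: "\<tau>\<^sup>2 = real n powr (- 2/5)" using n by (simp add: \<tau>_def powr_power)
  have \<tau>q: "\<tau> * q = real n powr (3/10)"
    using n by (simp add: \<tau>_def q_def powr_half_sqrt[symmetric] powr_add[symmetric])
  have eta: "0 \<le> eta n" using hub_sum_nonneg by (simp add: eta_def)
  have s: "1 / (2 * real n) \<le> s" "1 / s \<le> 2 * real n" "real n / 2 \<le> 1 / s" "0 < s"
    using elim(3) n L(3) by (auto simp: s_def pos_divide_le_eq pos_le_divide_eq mult.commute mult.left_commute)
  have P: "weight n i \<le> P" if "i \<in> {1..I}" for i
    using L(5)[OF that] theta_le_hub_sum[OF that] q(1)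
    by (simp add: P_def q_def divide_right_mono flip: divide_divide_eq_left)
  have "n * exp (- s * (X * (X - 1) / 2)) \<le> n * exp (- (x * (x - 1) / (4 * n)))"
  proof -
    have "x * (x - 1) \<le> X * (X - 1)" using x X by (intro mult_mono) auto
    then have "1 / (2 * real n) * (x * (x - 1) / 2) \<le> s * (X * (X - 1) / 2)"
      using s x n by (intro mult_mono) auto
    then show ?thesis by (intro mult_left_mono) auto
  qed
  note 1 = this
  have "X * n * (2 * exp (X * (2 * \<tau>\<^sup>2 + \<tau> * eta n) - \<tau> * (\<kappa> * q)))
    \<le> (x + 1) * n * (2 * exp ((x + 1) * (2 * \<tau>\<^sup>2 + \<tau> * eta n) - \<kappa> * (\<tau> * q)))"
  proof -
    have "X * (2 * \<tau>\<^sup>2 + \<tau> * eta n) \<le> (x + 1) * (2 * \<tau>\<^sup>2 + \<tau> * eta n)"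
      using X \<tau>0 eta by (intro mult_right_mono) auto
    then show ?thesis using X x by (intro mult_mono) (auto simp: mult.left_commute)
  qed
  note 2 = this
  have "n * (I * ((n + 1) * (2 * exp ((P * (\<tau>\<^sup>2 + \<tau> * eta n) - \<tau> * (\<kappa> / q)) / s))))
    \<le> n * (I * ((n + 1) * (2 * exp ((2 * hub_sum + 1) * q * (\<tau>\<^sup>2 + \<tau> * eta n) - \<kappa> / 2 * (\<tau> * q)))))"
  proof -
    define B where "B = \<tau>\<^sup>2 + \<tau> * eta n"
    have B: "0 \<le> B" using \<tau>0 eta by (simp add: B_def)
    have "P * B * (1 / s) \<le> P * B * (2 * real n)"
      using s(2) B q(1) hub_sum_nonneg by (intro mult_left_mono) (auto simp: P_def)
    also have "\<dots> = 2 * hub_sum * q * B" using q(1) by (simp add: P_def q(2)[symmetric])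
    also have "\<dots> \<le> (2 * hub_sum + 1) * q * B" using q(1) B by (intro mult_right_mono) auto
    finally have PB: "P * B * (1 / s) \<le> (2 * hub_sum + 1) * q * B" .
    have "\<kappa> / 2 * (\<tau> * q) = \<tau> * (\<kappa> / q) * (real n / 2)" using q(1) by (simp add: q(2)[symmetric])
    also have "\<dots> \<le> \<tau> * (\<kappa> / q) * (1 / s)"
      using s(3) \<tau>0 \<kappa> q(1) by (intro mult_left_mono) auto
    finally have "P * B * (1 / s) - \<tau> * (\<kappa> / q) * (1 / s) \<le> (2 * hub_sum + 1) * q * B - \<kappa> / 2 * (\<tau> * q)"
      using PB by linarith
    moreover have "(P * B - \<tau> * (\<kappa> / q)) / s = P * B * (1 / s) - \<tau> * (\<kappa> / q) * (1 / s)"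
      by (simp add: diff_divide_distrib)
    ultimately have "(P * B - \<tau> * (\<kappa> / q)) / s \<le> (2 * hub_sum + 1) * q * B - \<kappa> / 2 * (\<tau> * q)"
      by (simp only:)
    then show ?thesis unfolding B_def by (intro mult_left_mono) auto
  qed
  note 3 = this
  have "outer_measure_of (uniform_marks n)
      {x \<in> space (uniform_marks n). generic_marks n (weight n) x \<longrightarrow> bad_marks \<kappa> n x}
    \<le> ennreal (n * exp (- s * (X * (X - 1) / 2)))
      + ennreal (X * n * (2 * exp (X * (2 * \<tau>\<^sup>2 + \<tau> * eta n) - \<tau> * (\<kappa> * q))))
      + ennreal (n * (I * ((n + 1) * (2 * exp ((P * (\<tau>\<^sup>2 + \<tau> * eta n) - \<tau> * (\<kappa> / q)) / s)))))
      + ennreal (real I * (\<Sum>i=1..I. weight n i))"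
    using outer_measure_bad[OF \<tau>0 \<tau> P, of "\<kappa> * sqrt n" "\<kappa> / sqrt n"]
    unfolding bad_marks_def X_def s_def q_def of_nat_mult of_nat_add of_nat_1 by simp
  also have "\<dots> \<le> ennreal (n * exp (- (x * (x - 1) / (4 * n))))
      + ennreal ((x + 1) * n * (2 * exp ((x + 1) * (2 * \<tau>\<^sup>2 + \<tau> * eta n) - \<kappa> * (\<tau> * q))))
      + ennreal (n * (I * ((n + 1) * (2 * exp ((2 * hub_sum + 1) * q * (\<tau>\<^sup>2 + \<tau> * eta n) - \<kappa> / 2 * (\<tau> * q))))))
      + ennreal (real I * (hub_sum / q))"
    unfolding q_def sum_hub_weight[OF elim(2)] unfolding q_def[symmetric]
    by (intro add_mono ennreal_leI 1 2 3 order_refl)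
  also have "\<dots> = ennreal (prob_bound \<kappa> n)"
    unfolding prob_bound_def \<tau>2 \<tau>q eta_def x_def[symmetric] q_def[symmetric] \<tau>_def[symmetric]
    using x q(1) hub_sum_nonneg by (simp add: ennreal_plus[symmetric] del: ennreal_plus)
  finally show ?case .
qed

lemma eventually_difference_le:
  assumes \<kappa>: "0 < \<kappa>"
  shows "\<forall>\<^sub>F n in sequentially. \<forall>x u. generic_marks n (weight n) x \<longrightarrow> \<not> bad_marks \<kappa> n x \<longrightarrow> u \<in> {0..1} \<longrightarrow>
    \<bar>(\<theta> 0)\<^sup>2 / 2 * sigma_p n (weight n) * H_proc n (weight n) x u
      - inverse (sigma_p n (weight n)) * G_proc I n (weight n) x u\<bar> \<le> error_bound \<kappa> n"
  using eventually_weights eventually_large_enough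
proof eventually_elim
  case (elim n)
  note L = large_enoughD[OF elim(2)]
  interpret weights n I "weight n" "small_weight n" "eta n" "cutoff n" by (rule elim(1))
  define q v s where "q = sqrt (real n)" and "v = sqrt (variance_ratio n)" and "s = small_weight n"
  have q: "0 < q" "q * q = real n" using L(2) by (simp_all add: q_def)
  have v: "0 < v" "v * v = variance_ratio n" using sigma_weight_sq(2)[OF elim(2)] by (simp_all add: v_def)
  have \<sigma>: "sigma_p n (weight n) = v / q" unfolding v_def q_def by (rule sigma_weight_sq(3)[OF elim(2)])
  define D where "D = (\<theta> 0)\<^sup>2 * (variance_ratio n / n) - s"
  define E where "E = (I + 2) * (\<kappa> / q + 1 / n) + s * (3 * (\<kappa> * q) + I + 3)"
  have bound: "q / v * (E + \<bar>D\<bar> * ((real n powr (3/5) + 1) / 2)) = error_bound \<kappa> n"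
  proof -
    have "q * E = (real I + 2) * (\<kappa> + 1 / q) + (real n * s * (3 * \<kappa>) + real n * s * ((real I + 3) / q))"
      unfolding E_def q(2)[symmetric] using q(1) by (simp add: field_simps)
    moreover have "\<bar>real n powr (3/2) * D\<bar> * ((real n powr (3/5) + 1) / (2 * real n))
        = q * (\<bar>D\<bar> * ((real n powr (3/5) + 1) / 2))"
    proof -
      have "real n powr (3/2) = q * q * q" by (simp add: powr_three_halves q_def)
      then have "\<bar>real n powr (3/2) * D\<bar> = q * q * q * \<bar>D\<bar>" using q(1) by (simp add: abs_mult)
      then have "\<bar>real n powr (3/2) * D\<bar> * (1 / real n) = q * \<bar>D\<bar>" unfolding q(2)[symmetric] using q(1) by simp
      then have "\<bar>real n powr (3/2) * D\<bar> * (1 / real n) * ((real n powr (3/5) + 1) / 2) = q * \<bar>D\<bar> * ((real n powr (3/5) + 1) / 2)"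
        by (simp only:)
      then show ?thesis by (simp add: mult.assoc)
    qed
    moreover have "q / v * (E + F) = 1 / v * (q * E + q * F)" for F by (simp add: distrib_left)
    ultimately show ?thesis
      by (simp only: error_bound_def q_def[symmetric] v_def[symmetric] s_def[symmetric] D_def[symmetric]
        of_nat_mult of_nat_numeral)
  qed
  have "\<bar>(\<theta> 0)\<^sup>2 / 2 * sigma_p n (weight n) * H_proc n (weight n) x u
      - inverse (sigma_p n (weight n)) * G_proc I n (weight n) x u\<bar> \<le> error_bound \<kappa> n"
    if gen: "generic_marks n (weight n) x" and good: "\<not> bad_marks \<kappa> n x" and u: "u \<in> {0..1}" for x u
  proof -
    define h g where "h = H_proc n (weight n) x u" and "g = G_proc I n (weight n) x u"
    have u': "0 \<le> u" "u \<le> 1" using u by auto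
    have \<delta>: "0 \<le> \<kappa> / sqrt n" using \<kappa> by simp
    note close = not_bad_close[OF gen good[unfolded bad_marks_def] \<delta> u']
    have h: "0 \<le> h" "h \<le> real n powr (3/5) + 1"
      using close(1,2) cutoff_bounds(2)[of n] unfolding h_def by linarith+
    have E: "\<bar>s / 2 * h - g\<bar> \<le> E"
      using close(3) unfolding E_def h_def g_def s_def q_def .
    \<comment> \<open>With \<sigma> = v / q, the factor 1 / \<sigma> is taken out and \<theta>_0^2
      \<sigma>^2 is written as s + D.\<close>
    have "(\<theta> 0)\<^sup>2 / 2 * (v / q) * h - inverse (v / q) * g = q / v * ((s / 2 * h - g) + D * (h / 2))"
      unfolding D_def v(2)[symmetric] q(2)[symmetric] using q(1) v(1) by (simp add: field_simps)
    then have "\<bar>(\<theta> 0)\<^sup>2 / 2 * (v / q) * h - inverse (v / q) * g\<bar> = q / v * \<bar>(s / 2 * h - g) + D * (h / 2)\<bar>"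
      using q(1) v(1) by (simp add: abs_mult)
    also have "\<dots> \<le> q / v * (E + \<bar>D\<bar> * ((real n powr (3/5) + 1) / 2))"
    proof (intro mult_left_mono)
      have "\<bar>D * (h / 2)\<bar> = \<bar>D\<bar> * (h / 2)" using h by (simp add: abs_mult)
      also have "\<dots> \<le> \<bar>D\<bar> * ((real n powr (3/5) + 1) / 2)" using h by (intro mult_left_mono) auto
      finally show "\<bar>(s / 2 * h - g) + D * (h / 2)\<bar> \<le> E + \<bar>D\<bar> * ((real n powr (3/5) + 1) / 2)" using E by linarith
    qed (use q(1) v(1) in simp)
    finally show ?thesis unfolding \<sigma> h_def g_def bound .
  qed
  then show ?case by blast
qed

lemma conv_in_prob:
  "conv_in_prob_0 uniform_marks
     (\<lambda>n x. SUP u\<in>{0..1}.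
        \<bar>(\<theta> 0)\<^sup>2 / 2 * sigma_p n (weight n) * H_proc n (weight n) x u
          - inverse (sigma_p n (weight n)) * G_proc I n (weight n) x u\<bar>)"
  unfolding conv_in_prob_0_def
proof (intro allI impI)
  fix \<epsilon> :: real assume \<epsilon>: "0 < \<epsilon>"
  \<comment> \<open>With this choice the limit of \<open>error_bound\<close> is \<epsilon> / 2, so
    the bound is eventually below \<epsilon>.\<close>
  define \<kappa> where "\<kappa> = \<epsilon> / (2 * \<theta> 0 * (I + 5))"
  have \<kappa>: "0 < \<kappa>" using \<epsilon> theta_0_pos by (simp add: \<kappa>_def)
  have I5: "real I + 5 \<noteq> 0" by linarith
  have "\<theta> 0 * ((I + 5) * \<kappa>) = \<epsilon> / 2" using theta_0_pos I5 by (simp add: \<kappa>_def)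
  then have "\<forall>\<^sub>F n in sequentially. error_bound \<kappa> n < \<epsilon>"
    using order_tendstoD(2)[OF error_bound_tendsto[of \<kappa>], of \<epsilon>] \<epsilon> by simp
  then have le: "\<forall>\<^sub>F n in sequentially. outer_measure_of (uniform_marks n) {x \<in> space (uniform_marks n).
      \<epsilon> < \<bar>SUP u\<in>{0..1}. \<bar>(\<theta> 0)\<^sup>2 / 2 * sigma_p n (weight n) * H_proc n (weight n) x u
          - inverse (sigma_p n (weight n)) * G_proc I n (weight n) x u\<bar>\<bar>} \<le> ennreal (prob_bound \<kappa> n)"
    using eventually_outer_measure_le[OF \<kappa>] eventually_difference_le[OF \<kappa>]
  proof eventually_elim
    case (elim n)
    let ?f = "\<lambda>x u. \<bar>(\<theta> 0)\<^sup>2 / 2 * sigma_p n (weight n) * H_proc n (weight n) x u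
          - inverse (sigma_p n (weight n)) * G_proc I n (weight n) x u\<bar>"
    have "bad_marks \<kappa> n x" if gen: "generic_marks n (weight n) x" and large: "\<epsilon> < \<bar>SUP u\<in>{0..1}. ?f x u\<bar>" for x
    proof (rule ccontr)
      assume "\<not> bad_marks \<kappa> n x"
      then have "?f x u \<le> error_bound \<kappa> n" if "u \<in> {0..1}" for u using elim(3) gen that by blast
      then have "(SUP u\<in>{0..1}. ?f x u) \<le> error_bound \<kappa> n" by (intro cSUP_least) auto
      \<comment> \<open>The value at u = 0 shows that the supremum is nonnegative, so its absolute
        value is the supremum itself. Boundedness enters because the supremum of an unbounded set of
        reals has no meaning.\<close>
      moreover have "?f x 0 \<le> (SUP u\<in>{0..1}. ?f x u)"
        by (rule cSUP_upper[OF _ bdd_above_difference]) simp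
      ultimately show False using large elim(1) by linarith
    qed
    then have "{x \<in> space (uniform_marks n). \<epsilon> < \<bar>SUP u\<in>{0..1}. ?f x u\<bar>}
      \<subseteq> {x \<in> space (uniform_marks n). generic_marks n (weight n) x \<longrightarrow> bad_marks \<kappa> n x}" by blast
    then show ?case using elim(2) by (rule order_trans[OF outer_measure_of_mono])
  qed
  show "(\<lambda>n. outer_measure_of (uniform_marks n) {x \<in> space (uniform_marks n).
      \<epsilon> < \<bar>SUP u\<in>{0..1}. \<bar>(\<theta> 0)\<^sup>2 / 2 * sigma_p n (weight n) * H_proc n (weight n) x u
          - inverse (sigma_p n (weight n)) * G_proc I n (weight n) x u\<bar>\<bar>}) \<longlonglongrightarrow> 0"
  proof (rule tendsto_sandwich[OF _ le tendsto_const])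
    show "(\<lambda>n. ennreal (prob_bound \<kappa> n)) \<longlonglongrightarrow> 0"
      using tendsto_ennrealI[OF prob_bound_tendsto_0[OF \<kappa>]] by simp
  qed simp
qed

end

theorem proposition3:
  fixes \<theta> :: "nat \<Rightarrow> real" and I :: nat
  assumes "\<theta> \<in> Theta_finite" and "I = theta_length \<theta>"
  shows "\<exists>p :: nat \<Rightarrow> nat \<Rightarrow> real.
      (\<forall>n\<ge>1. ranked_distribution n (p n))
    \<and> (\<lambda>n. sigma_p n (p n)) \<longlonglongrightarrow> 0
    \<and> (\<forall>i\<in>{1..I}. (\<lambda>n. p n i / sigma_p n (p n)) \<longlonglongrightarrow> \<theta> i)
    \<and> (\<forall>i>I. (\<lambda>n. p n i / sigma_p n (p n)) \<longlonglongrightarrow> 0)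
    \<and> conv_in_prob_0 uniform_marks
        (\<lambda>n x. SUP u\<in>{0..1}.
           \<bar>(\<theta> 0)\<^sup>2 / 2 * sigma_p n (p n) * H_proc n (p n) x u
             - inverse (sigma_p n (p n)) * G_proc I n (p n) x u\<bar>)"
proof -
  interpret theta_finite \<theta> I using assms by unfold_locales
  show ?thesis
    using ranked_weight sigma_tendsto_0 hub_ratio_tendsto small_ratio_tendsto conv_in_prob by blast
qed

end
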